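(* The functor $\mathcal{B}:\mathbf{AF}\to\mathbf{BD}$ is full: if $\mathcal A_1,\mathcal A_2$ are objects of $\mathbf{AF}$ and $f:\mathcal B(\mathcal A_1)\to\mathcal B(\mathcal A_2)$ is a morphism in $\mathbf{BD}$, then there is a morphism $\varphi:\mathcal A_1\to\mathcal A_2$ in $\mathbf{AF}$ such that $\mathcal B(\varphi)=f$.
   Context: Multiplicity matrices. For a $k_1\times 1$ matrix $V_1$ and a $k_2\times 1$ matrix $V_2$ of strictly positive integers, a multiplicity matrix $E:V_1\to V_2$ is a $k_2\times k_1$ matrix of non-negative integers with $EV_1\le V_2$ entrywise; it is an embedding matrix if no column is zero. For a $*$-homomorphism $\varphi:\mathcal M_{n_1}\oplus\cdots\oplus\mathcal M_{n_k}\to\mathcal M_{m_1}\oplus\cdots\oplus\mathcal M_{m_l}$, $R_\varphi=(a_{ij})$ is the unique $l\times k$ matrix of non-negative integers such that for some unitary $v=(v_1,\dots,v_l)$ of the codomain, $v_i\varphi_i(u_1,\dots,u_k)v_i^*=\mathrm{diag}(u_1^{(a_{i1})},\dots,u_k^{(a_{ik})},0^{(s_i)})$ for all $i$, where $\varphi_i$ is the $i$-th component of $\varphi$ and $u^{(a)}$ denotes $a$ diagonal copies of $u$. Category $\mathbf{BD}$. A (non-zero) Bratteli diagram is a pair $(V,E)=((V_n)_{n\ge1},(E_n)_{n\ge1})$ with $V_n$ a $k_n\times1$ matrix of strictly positive integers ($k_n\ge1$) and $E_n:V_n\to V_{n+1}$ an embedding matrix; $E_{nm}=E_{m-1}\cdots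 E_n$ for $n<m$, $E_{nn}=I$. A premorphism $(V,E)\to(W,S)$ is a pair $((F_n),(f_n))$ with $f_1\le f_2\le\cdots$ positive integers, $\sup f_n=\infty$, $F_n:V_n\to W_{f_n}$ multiplicity matrices, and $F_{n+1}E_n=S_{f_nf_{n+1}}F_n$ for all $n$. Composition: $((G_n),(g_n))((F_n),(f_n))=((G_{f_n}F_n)_n,(g_{f_n})_n)$; identity: $((I)_n,(n)_n)$. Premorphisms $((F_n),(f_n)),((G_n),(g_n)):(V,E)\to(W,S)$ are equivalent if and only if for each $n$ there is $m\ge f_n,g_n$ with $S_{f_nm}F_n=S_{g_nm}G_n$. Morphisms of $\mathbf{BD}$ are equivalence classes of premorphisms. There is also a zero diagram $0$, with exactly one morphism to and from each diagram; a composite $B\to0\to C$ of non-zero diagrams is the class of the premorphism with all matrices zero. Category $\mathbf{AF}$. Objects are triples $\mathcal A=(A,(A_n)_{n\ge1},(\varphi_n)_{n\ge1})$ where $A$ is an AF algebra, $(A_n)$ is an increasing sequence of finite dimensional C$^*$-subalgebras with dense union in $A$, and $\varphi_n$ is a $*$-isomorphism of $A_n$ onto an algebra $A_n'=\mathcal M_{m_{n1}}\oplus\cdots\oplus\mathcal M_{m_{nk_n}}$ (with $k_n\ge1$, $m_{ni}\ge1$ when $A\ne0$). A morphism from $(A,(A_n),(\varphi_n))$ to $(B,(B_n),(\psi_n))$ is a $*$-homomorphism $A\to B$. The functor $\mathcal B$. On objects: $\mathcal B(\mathcal A)=((V_n),(E_n))$ with $V_n=(m_{n1},\dots,m_{nk_n})^T$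 and $E_n=R_{\varphi_n'}$, where $\varphi_n'=\varphi_{n+1}\varphi_n^{-1}:A_n'\to A_{n+1}'$. On a morphism $\varphi:A\to B$ from $(A,(A_n),(\varphi_n))$ to $(B,(B_n),(\psi_n))$: choose unitaries $u_n\in B^\sim$ ($B^\sim=B$ if $B$ is unital, otherwise the unitization of $B$) and positive integers $f_1\le f_2\le\cdots$ with $\sup f_n=\infty$, $\|u_n-1\|<\frac12$ and $u_n\varphi(A_n)u_n^*\subseteq B_{f_n}$ (such choices exist); put $g_n=(\mathrm{Ad}\,u_n)\circ\varphi|_{A_n}:A_n\to B_{f_n}$ and $F_n=R_{\psi_{f_n}g_n\varphi_n^{-1}}$; $\mathcal B(\varphi)$ is the equivalence class of $((F_n),(f_n))$, which is independent of the choices. The zero algebra is sent to the zero diagram and zero homomorphisms to zero morphisms. *)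

theory Defs
  imports "HOL-Analysis.Operator_Norm" "HOL-Analysis.Elementary_Topology"
    "Jordan_Normal_Form.Schur_Decomposition"
begin

section \<open>C*-algebras\<close>

text \<open>
  A C*-algebra is a type of the following class. No unit is assumed, and the zero algebra
  (a one-element type) is not excluded.
\<close>

class cstar_algebra = real_normed_algebra + banach +
  fixes scaleC :: "complex \<Rightarrow> 'a \<Rightarrow> 'a"  (infixr "*\<^sub>C" 75)
    and adj :: "'a \<Rightarrow> 'a"
  assumes scaleC_add_right: "c *\<^sub>C (x + y) = c *\<^sub>C x + c *\<^sub>C y"
    and scaleC_add_left: "(c + d) *\<^sub>C x = c *\<^sub>C x + d *\<^sub>C x"
    and scaleC_scaleC: "c *\<^sub>C d *\<^sub>C x = (c * d) *\<^sub>C x"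
    and scaleC_one: "1 *\<^sub>C x = x"
    and scaleR_scaleC: "scaleR r x = complex_of_real r *\<^sub>C x"
    and norm_scaleC: "norm (c *\<^sub>C x) = cmod c * norm x"
    and mult_scaleC_left: "(c *\<^sub>C x) * y = c *\<^sub>C (x * y)"
    and mult_scaleC_right: "x * (c *\<^sub>C y) = c *\<^sub>C (x * y)"
    and adj_add: "adj (x + y) = adj x + adj y"
    and adj_scaleC: "adj (c *\<^sub>C x) = cnj c *\<^sub>C adj x"
    and adj_mult: "adj (x * y) = adj y * adj x"
    and adj_adj: "adj (adj x) = x"
    and norm_adj_mult: "norm (adj x * x) = (norm x)\<^sup>2"

definition star_hom :: "('a::cstar_algebra \<Rightarrow> 'b::cstar_algebra) \<Rightarrow> bool" where
  "star_hom \<phi> \<longleftrightarrow>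
     (\<forall>x y. \<phi> (x + y) = \<phi> x + \<phi> y) \<and> (\<forall>c x. \<phi> (c *\<^sub>C x) = c *\<^sub>C \<phi> x) \<and>
     (\<forall>x y. \<phi> (x * y) = \<phi> x * \<phi> y) \<and> (\<forall>x. \<phi> (adj x) = adj (\<phi> x))"

text \<open>The span is qualified because it is the one over the scalars \<open>complex\<close>, taken from the
  vector space library of HOL and not from HOL-Algebra.\<close>

definition fin_dim_cstar_subalgebra :: "'a::cstar_algebra set \<Rightarrow> bool" where
  "fin_dim_cstar_subalgebra S \<longleftrightarrow>
     0 \<in> S \<and> (\<forall>x\<in>S. \<forall>y\<in>S. x + y \<in> S) \<and> (\<forall>c. \<forall>x\<in>S. c *\<^sub>C x \<in> S) \<and>
     (\<forall>x\<in>S. \<forall>y\<in>S. x * y \<in> S) \<and> (\<forall>x\<in>S. adj x \<in> S) \<and> closed S \<and>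
     (\<exists>b. finite b \<and> S = Modules.module.span (*\<^sub>C) b)"


section \<open>The algebra \<open>B\<^sup>\<sim>\<close>\<close>

definition is_unit_elt :: "'a::cstar_algebra \<Rightarrow> bool" where
  "is_unit_elt e \<longleftrightarrow> (\<forall>x. e * x = x \<and> x * e = x)"

definition unital :: "'a::cstar_algebra itself \<Rightarrow> bool" where
  "unital _ \<longleftrightarrow> (\<exists>e::'a. is_unit_elt e)"

text \<open>
  The elements of \<open>B\<^sup>\<sim>\<close> are written as pairs \<open>(c, b)\<close>, standing for \<open>c1 + b\<close>. If \<open>B\<close> is unital,
  then \<open>B\<^sup>\<sim> = B\<close>, so only the pairs \<open>(0, b)\<close> occur and the unit is the one of \<open>B\<close>; otherwise
  \<open>B\<^sup>\<sim>\<close> consists of all pairs and carries the C*-norm of the unitization, which is the norm of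
  the operator of left multiplication on \<open>B\<close>. An element \<open>b\<close> of \<open>B\<close> is \<open>(0, b)\<close> in both cases.
\<close>

definition tilde_carrier :: "(complex \<times> 'a::cstar_algebra) set" where
  "tilde_carrier = (if unital TYPE('a) then {0} \<times> UNIV else UNIV)"

definition tilde_one :: "complex \<times> 'a::cstar_algebra" where
  "tilde_one = (if unital TYPE('a) then (0, THE e. is_unit_elt e) else (1, 0))"

fun tilde_mult :: "complex \<times> 'a::cstar_algebra \<Rightarrow> complex \<times> 'a \<Rightarrow> complex \<times> 'a" where
  "tilde_mult (c, a) (d, b) = (c * d, c *\<^sub>C b + d *\<^sub>C a + a * b)"

fun tilde_adj :: "complex \<times> 'a::cstar_algebra \<Rightarrow> complex \<times> 'a" where
  "tilde_adj (c, a) = (cnj c, adj a)"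

fun tilde_norm :: "complex \<times> 'a::cstar_algebra \<Rightarrow> real" where
  "tilde_norm (c, a) =
     (if unital TYPE('a) then norm a else onorm (\<lambda>x. c *\<^sub>C x + a * x))"

definition tilde_unitary :: "complex \<times> 'a::cstar_algebra \<Rightarrow> bool" where
  "tilde_unitary u \<longleftrightarrow> u \<in> tilde_carrier \<and>
     tilde_mult u (tilde_adj u) = tilde_one \<and> tilde_mult (tilde_adj u) u = tilde_one"

definition Ad :: "complex \<times> 'a::cstar_algebra \<Rightarrow> 'a \<Rightarrow> 'a" where
  "Ad u x = snd (tilde_mult (tilde_mult u (0, x)) (tilde_adj u))"


section \<open>Finite direct sums of matrix algebras and multiplicity matrices\<close>

text \<open>\<open>mat_sum [n\<^sub>1, \<dots>, n\<^sub>k]\<close> is \<open>\<M>\<^sub>n\<^sub>1 \<oplus> \<dots> \<oplus> \<M>\<^sub>n\<^sub>k\<close>; its operations are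
  componentwise.\<close>

definition mat_sum :: "nat list \<Rightarrow> complex mat list set" where
  "mat_sum ns = {u. length u = length ns \<and>
     (\<forall>i<length ns. u ! i \<in> carrier_mat (ns ! i) (ns ! i))}"

definition star_iso_onto_mat_sum ::
  "'a::cstar_algebra set \<Rightarrow> ('a \<Rightarrow> complex mat list) \<Rightarrow> nat list \<Rightarrow> bool" where
  "star_iso_onto_mat_sum S \<phi> ns \<longleftrightarrow> bij_betw \<phi> S (mat_sum ns) \<and>
     (\<forall>x\<in>S. \<forall>y\<in>S. \<phi> (x + y) = map2 (+) (\<phi> x) (\<phi> y)) \<and>
     (\<forall>c. \<forall>x\<in>S. \<phi> (c *\<^sub>C x) = map (\<lambda>M. c \<cdot>\<^sub>m M) (\<phi> x)) \<and>
     (\<forall>x\<in>S. \<forall>y\<in>S. \<phi> (x * y) = map2 (*) (\<phi> x) (\<phi> y)) \<and>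
     (\<forall>x\<in>S. \<phi> (adj x) = map mat_adjoint (\<phi> x))"

definition unitary_mat :: "nat \<Rightarrow> complex mat \<Rightarrow> bool" where
  "unitary_mat n v \<longleftrightarrow> v \<in> carrier_mat n n \<and>
     v * mat_adjoint v = 1\<^sub>m n \<and> mat_adjoint v * v = 1\<^sub>m n"

definition has_mult_matrix ::
  "nat list \<Rightarrow> nat list \<Rightarrow> (complex mat list \<Rightarrow> complex mat list) \<Rightarrow> nat mat \<Rightarrow> bool" where
  "has_mult_matrix ns ms \<phi> R \<longleftrightarrow> R \<in> carrier_mat (length ms) (length ns) \<and>
     (\<exists>v. length v = length ms \<and> (\<forall>i<length ms. unitary_mat (ms ! i) (v ! i)) \<and>
       (\<forall>i<length ms. \<exists>s. \<forall>u\<in>mat_sum ns.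
          v ! i * (\<phi> u ! i) * mat_adjoint (v ! i) =
          diag_block_mat
            (concat (map (\<lambda>j. replicate (R $$ (i, j)) (u ! j)) [0..<length ns]) @ [0\<^sub>m s s])))"

text \<open>\<open>R\<^sub>\<phi>\<close> for a *-homomorphism \<open>\<phi>\<close> from \<open>mat_sum ns\<close> to \<open>mat_sum ms\<close>.\<close>

definition mult_matrix_of ::
  "nat list \<Rightarrow> nat list \<Rightarrow> (complex mat list \<Rightarrow> complex mat list) \<Rightarrow> nat mat" where
  "mult_matrix_of ns ms \<phi> = (THE R. has_mult_matrix ns ms \<phi> R)"

definition multiplicity_matrix :: "nat vec \<Rightarrow> nat vec \<Rightarrow> nat mat \<Rightarrow> bool" where
  "multiplicity_matrix V W E \<longleftrightarrow> E \<in> carrier_mat (dim_vec W) (dim_vec V) \<and> E *\<^sub>v V \<le> W"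

definition embedding_matrix :: "nat vec \<Rightarrow> nat vec \<Rightarrow> nat mat \<Rightarrow> bool" where
  "embedding_matrix V W E \<longleftrightarrow>
     multiplicity_matrix V W E \<and> (\<forall>j<dim_vec V. col E j \<noteq> 0\<^sub>v (dim_vec W))"


section \<open>Bratteli diagrams and their morphisms\<close>

text \<open>All sequences are indexed from \<open>0\<close>; accordingly the values of the index sequences \<open>(f\<^sub>n)\<close>
  are arbitrary natural numbers.\<close>

type_synonym vec_seq = "nat \<Rightarrow> nat vec"
type_synonym mat_seq = "nat \<Rightarrow> nat mat"
type_synonym premorphism = "mat_seq \<times> (nat \<Rightarrow> nat)"

datatype bd_object = Zero_diagram | Diagram vec_seq mat_seq

fun bratteli_diagram :: "bd_object \<Rightarrow> bool" where
  "bratteli_diagram Zero_diagram \<longleftrightarrow> True"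
| "bratteli_diagram (Diagram V E) \<longleftrightarrow>
     (\<forall>n. 1 \<le> dim_vec (V n) \<and> (\<forall>i<dim_vec (V n). 0 < V n $ i) \<and>
          embedding_matrix (V n) (V (Suc n)) (E n))"

text \<open>\<open>path_matrix V E n d\<close> is the product \<open>E\<^sub>n\<^sub>m\<close> for \<open>m = n + d\<close>.\<close>

primrec path_matrix :: "vec_seq \<Rightarrow> mat_seq \<Rightarrow> nat \<Rightarrow> nat \<Rightarrow> nat mat" where
  "path_matrix V E n 0 = 1\<^sub>m (dim_vec (V n))"
| "path_matrix V E n (Suc d) = E (n + d) * path_matrix V E n d"

definition connecting :: "vec_seq \<Rightarrow> mat_seq \<Rightarrow> nat \<Rightarrow> nat \<Rightarrow> nat mat" where
  "connecting V E n m = path_matrix V E n (m - n)"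

definition premorphisms ::
  "vec_seq \<Rightarrow> mat_seq \<Rightarrow> vec_seq \<Rightarrow> mat_seq \<Rightarrow> premorphism set" where
  "premorphisms V E W S = {(F, f). mono f \<and> filterlim f at_top sequentially \<and>
     (\<forall>n. multiplicity_matrix (V n) (W (f n)) (F n)) \<and>
     (\<forall>n. F (Suc n) * E n = connecting W S (f n) (f (Suc n)) * F n)}"

definition premorphism_rel ::
  "vec_seq \<Rightarrow> mat_seq \<Rightarrow> vec_seq \<Rightarrow> mat_seq \<Rightarrow> (premorphism \<times> premorphism) set" where
  "premorphism_rel V E W S = {((F, f), (G, g)).
     (F, f) \<in> premorphisms V E W S \<and> (G, g) \<in> premorphisms V E W S \<and>
     (\<forall>n. \<exists>m. f n \<le> m \<and> g n \<le> m \<and>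
        connecting W S (f n) m * F n = connecting W S (g n) m * G n)}"

datatype bd_morphism = Zero_morphism | Class "premorphism set"

text \<open>The set of morphisms between two diagrams; there is exactly one morphism to and from the
  zero diagram. The objects of \<open>BD\<close> are the data satisfying \<open>bratteli_diagram\<close>; the definition
  of the morphisms does not test this condition.\<close>

fun bd_hom :: "bd_object \<Rightarrow> bd_object \<Rightarrow> bd_morphism set" where
  "bd_hom (Diagram V E) (Diagram W S) =
     Class ` (premorphisms V E W S // premorphism_rel V E W S)"
| "bd_hom _ _ = {Zero_morphism}"


section \<open>The category \<open>AF\<close> and the functor \<open>\<B>\<close>\<close>

text \<open>
  An object of \<open>AF\<close> whose algebra is the type \<open>'a\<close>: the subalgebras \<open>A\<^sub>n\<close>, the lists of sizes
  \<open>m\<^sub>n\<^sub>1, \<dots>, m\<^sub>n\<^sub>k\<close> of the summands of \<open>A\<^sub>n'\<close>, and the isomorphisms \<open>\<phi>\<^sub>n\<close>. A morphism is a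
  *-homomorphism between the underlying types, that is, a function satisfying \<open>star_hom\<close>.
\<close>

record 'a af_data =
  subalg :: "nat \<Rightarrow> 'a set"
  sizes :: "nat \<Rightarrow> nat list"
  iso :: "nat \<Rightarrow> 'a \<Rightarrow> complex mat list"

definition zero_algebra :: "'a::cstar_algebra itself \<Rightarrow> bool" where
  "zero_algebra _ \<longleftrightarrow> (UNIV :: 'a set) = {0}"

text \<open>That \<open>'a\<close> is an AF algebra need not be required separately: the sequence \<open>subalg A\<close>
  exhibits it as one.\<close>

definition af_object :: "'a::cstar_algebra af_data \<Rightarrow> bool" where
  "af_object A \<longleftrightarrow>
     (\<forall>n. fin_dim_cstar_subalgebra (subalg A n)) \<and>
     (\<forall>n. subalg A n \<subseteq> subalg A (Suc n)) \<and>
     closure (\<Union>n. subalg A n) = UNIV \<and>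
     (\<forall>n. star_iso_onto_mat_sum (subalg A n) (iso A n) (sizes A n)) \<and>
     (\<not> zero_algebra TYPE('a) \<longrightarrow>
        (\<forall>n. sizes A n \<noteq> [] \<and> (\<forall>m\<in>set (sizes A n). 1 \<le> m)))"

definition iso_inv :: "'a af_data \<Rightarrow> nat \<Rightarrow> complex mat list \<Rightarrow> 'a" where
  "iso_inv A n = inv_into (subalg A n) (iso A n)"

definition diagram_vecs :: "'a af_data \<Rightarrow> vec_seq" where
  "diagram_vecs A n = vec_of_list (sizes A n)"

definition diagram_mats :: "'a af_data \<Rightarrow> mat_seq" where
  "diagram_mats A n =
     mult_matrix_of (sizes A n) (sizes A (Suc n)) (iso A (Suc n) \<circ> iso_inv A n)"

definition B_obj :: "'a::cstar_algebra af_data \<Rightarrow> bd_object" where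
  "B_obj A = (if zero_algebra TYPE('a) then Zero_diagram
     else Diagram (diagram_vecs A) (diagram_mats A))"

definition admissible_choice ::
  "'a::cstar_algebra af_data \<Rightarrow> 'b::cstar_algebra af_data \<Rightarrow> ('a \<Rightarrow> 'b) \<Rightarrow>
     (nat \<Rightarrow> complex \<times> 'b) \<Rightarrow> (nat \<Rightarrow> nat) \<Rightarrow> bool" where
  "admissible_choice A B \<phi> u f \<longleftrightarrow> mono f \<and> filterlim f at_top sequentially \<and>
     (\<forall>n. tilde_unitary (u n) \<and> tilde_norm (u n - tilde_one) < 1 / 2 \<and>
          Ad (u n) ` \<phi> ` subalg A n \<subseteq> subalg B (f n))"

definition induced_mats ::
  "'a::cstar_algebra af_data \<Rightarrow> 'b::cstar_algebra af_data \<Rightarrow> ('a \<Rightarrow> 'b) \<Rightarrow>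
     (nat \<Rightarrow> complex \<times> 'b) \<Rightarrow> (nat \<Rightarrow> nat) \<Rightarrow> mat_seq" where
  "induced_mats A B \<phi> u f n =
     mult_matrix_of (sizes A n) (sizes B (f n)) (iso B (f n) \<circ> Ad (u n) \<circ> \<phi> \<circ> iso_inv A n)"

text \<open>
  The class does not depend on the admissible choice. If \<open>\<phi> = 0\<close>, all the matrices are zero, so
  the formula yields the zero morphism in this case too.
\<close>

definition B_mor ::
  "'a::cstar_algebra af_data \<Rightarrow> 'b::cstar_algebra af_data \<Rightarrow> ('a \<Rightarrow> 'b) \<Rightarrow> bd_morphism" where
  "B_mor A B \<phi> = (if zero_algebra TYPE('a) \<or> zero_algebra TYPE('b) then Zero_morphism
     else let (u, f) = (SOME (u, f). admissible_choice A B \<phi> u f) in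
       Class (premorphism_rel (diagram_vecs A) (diagram_mats A) (diagram_vecs B) (diagram_mats B)
                `` {(induced_mats A B \<phi> u f, f)}))"

end

theory Submission
  imports Defs "HOL-Analysis.Elementary_Metric_Spaces"
begin

text \<open>
  A homomorphism of finite direct sums of matrix algebras is determined up to unitary equivalence by
  its multiplicity matrix, whose entries are the traces of the images of minimal projections. Given a
  premorphism, realize the matrices \<open>F\<^sub>n\<close> one after the other by homomorphisms \<open>A\<^sub>n \<rightarrow> B\<^sub>f\<^sub>n\<close>; the relation
  \<open>F\<^sub>n\<^sub>+\<^sub>1E\<^sub>n = SF\<^sub>n\<close> says that the next one restricts on \<open>A\<^sub>n\<close> to a homomorphism unitarily equivalent to
  the previous one, so after conjugation it extends it. The union of these homomorphisms is
  contractive and extends to the closure.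

  The functor evaluates this limit on an arbitrary admissible choice of unitaries. If \<open>u\<close>, \<open>v\<close> are
  unitaries with \<open>\<parallel>u - 1\<parallel>, \<parallel>v - 1\<parallel> < 1/2\<close> and \<open>p\<close> is a projection, then no non-zero \<open>b\<close> satisfies both
  \<open>(upu*)b = b\<close> and \<open>(vpv*)b = 0\<close>. Hence \<open>upu*\<close> and \<open>vpv*\<close> have the same traces in every \<open>B\<^sub>m\<close> that
  contains them, and all choices yield equivalent premorphisms.
\<close>


section \<open>Complex matrices\<close>

text \<open>\<open>B_mor\<close> evaluates the functor at a pair \<open>(u, g)\<close> taken by a
  choice operator, of which only \<open>admissible_choice\<close> is known. The unitaries need not
  lie in the subalgebra where two images are compared, so they cannot conjugate one image to the
  other there. The comparison therefore uses elements of that subalgebra as test vectors for two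
  projections, and the conjugating invertible matrix is built inside one summand. The bound 1/2
  enters twice: two displacements of \<open>b\<close>, each below \<open>norm b / 2\<close>, cannot
  add up to \<open>norm b\<close>. Traces suit \<open>mult_matrix_of\<close>, which is described
  through unknown unitaries: they see neither the unitary nor the zero block, so uniqueness,
  composition and comparison become statements about numbers. Homomorphisms need not be unital; the
  size of the zero block is determined by the multiplicities and the size of the target, so equal
  multiplicities give equal normal forms. In the inductive construction only the newest homomorphism
  is conjugated. The earlier ones stay fixed, the limit maps each subalgebra into its target without
  perturbation, and the constant unitary 1 is admissible.\<close>

lemma dim_mat_adjoint [simp]:
  "dim_row (mat_adjoint A) = dim_col A" "dim_col (mat_adjoint A) = dim_row A"
  by (auto simp: mat_adjoint_def)

lemma mat_adjoint_carrier [simp, intro]: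
  "A \<in> carrier_mat m n \<Longrightarrow> mat_adjoint A \<in> carrier_mat n m"
  unfolding carrier_mat_def by simp

lemma index_mat_adjoint [simp]:
  "i < dim_col A \<Longrightarrow> j < dim_row A \<Longrightarrow> mat_adjoint A $$ (i, j) = conjugate (A $$ (j, i))"
  by (auto simp: mat_adjoint_def mat_of_rows_index)

lemma mat_adjoint_adjoint [simp]: "mat_adjoint (mat_adjoint A) = A"
  by (rule eq_matI) auto

lemma mat_adjoint_one [simp]: "mat_adjoint (1\<^sub>m n :: complex mat) = 1\<^sub>m n"
  by (rule eq_matI) auto

lemma mat_adjoint_zero [simp]: "mat_adjoint (0\<^sub>m m n :: complex mat) = 0\<^sub>m n m"
  by (rule eq_matI) auto

lemma mat_adjoint_minus:
  fixes A :: "complex mat"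
  assumes "A \<in> carrier_mat m n" "B \<in> carrier_mat m n"
  shows "mat_adjoint (A - B) = mat_adjoint A - mat_adjoint B"
  using assms by (intro eq_matI) auto

lemma mat_adjoint_smult:
  fixes A :: "complex mat"
  shows "mat_adjoint (c \<cdot>\<^sub>m A) = cnj c \<cdot>\<^sub>m mat_adjoint A"
  by (intro eq_matI) auto

lemma smult_smult_mat:
  fixes A :: "'a :: semigroup_mult mat"
  shows "a \<cdot>\<^sub>m (b \<cdot>\<^sub>m A) = (a * b) \<cdot>\<^sub>m A"
  by (intro eq_matI) (auto simp: mult.assoc)

lemma index_mult_mat_sum:
  assumes "A \<in> carrier_mat m n" "B \<in> carrier_mat n k" "i < m" "j < k"
  shows "(A * B) $$ (i, j) = (\<Sum>l<n. A $$ (i, l) * B $$ (l, j))"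
  using assms by (auto simp: scalar_prod_def lessThan_atLeast0 intro!: sum.cong)

lemma mat_adjoint_mult:
  fixes A :: "complex mat"
  assumes "A \<in> carrier_mat m n" "B \<in> carrier_mat n k"
  shows "mat_adjoint (A * B) = mat_adjoint B * mat_adjoint A"
proof (rule eq_matI)
  fix i j assume "i < dim_row (mat_adjoint B * mat_adjoint A)" "j < dim_col (mat_adjoint B * mat_adjoint A)"
  then have ij: "i < k" "j < m" using assms by auto
  have "(mat_adjoint B * mat_adjoint A) $$ (i, j) = (\<Sum>l<n. mat_adjoint B $$ (i, l) * mat_adjoint A $$ (l, j))"
    using assms ij by (intro index_mult_mat_sum) auto
  also have "\<dots> = (\<Sum>l<n. cnj (A $$ (j, l) * B $$ (l, i)))"
    using assms ij by (intro sum.cong) auto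
  also have "\<dots> = cnj ((A * B) $$ (j, i))"
    using assms ij by (subst index_mult_mat_sum[of A m n B k]) auto
  finally show "mat_adjoint (A * B) $$ (i, j) = (mat_adjoint B * mat_adjoint A) $$ (i, j)"
    using assms ij by auto
qed (use assms in auto)

section \<open>Traces\<close>

definition mtrace :: "complex mat \<Rightarrow> complex" where
  "mtrace A = (\<Sum>i<dim_row A. A $$ (i, i))"

lemma mtrace_mult_comm:
  assumes "A \<in> carrier_mat m n" "B \<in> carrier_mat n m"
  shows "mtrace (A * B) = mtrace (B * A)"
proof -
  have "mtrace (A * B) = (\<Sum>i<m. \<Sum>l<n. A $$ (i, l) * B $$ (l, i))"
    using assms by (auto simp: mtrace_def index_mult_mat_sum intro!: sum.cong simp del: index_mult_mat(1))
  also have "\<dots> = (\<Sum>l<n. \<Sum>i<m. B $$ (l, i) * A $$ (i, l))"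
    by (subst sum.swap) (simp add: mult.commute)
  also have "\<dots> = mtrace (B * A)"
    using assms by (auto simp: mtrace_def index_mult_mat_sum intro!: sum.cong simp del: index_mult_mat(1))
  finally show ?thesis .
qed

lemma mtrace_one [simp]: "mtrace (1\<^sub>m n) = of_nat n"
  by (simp add: mtrace_def)

lemma mtrace_zero [simp]: "mtrace (0\<^sub>m n n) = 0"
  by (simp add: mtrace_def)

lemma mtrace_add:
  "A \<in> carrier_mat n n \<Longrightarrow> B \<in> carrier_mat n n \<Longrightarrow> mtrace (A + B) = mtrace A + mtrace B"
  by (auto simp: mtrace_def sum.distrib)

lemma mtrace_conj_unitary:
  assumes "unitary_mat n v" "A \<in> carrier_mat n n"
  shows "mtrace (v * A * mat_adjoint v) = mtrace A"
proof -
  have v: "v \<in> carrier_mat n n" "mat_adjoint v * v = 1\<^sub>m n" using assms by (auto simp: unitary_mat_def)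
  have "mtrace (v * A * mat_adjoint v) = mtrace (mat_adjoint v * (v * A))"
    using v assms by (intro mtrace_mult_comm) auto
  also have "mat_adjoint v * (v * A) = mat_adjoint v * v * A"
    using v assms by (subst assoc_mult_mat) auto
  finally show ?thesis using v assms by simp
qed

lemma mtrace_four_block_mat:
  assumes "A \<in> carrier_mat n n" "D \<in> carrier_mat m m"
  shows "mtrace (four_block_mat A B C D) = mtrace A + mtrace D"
proof -
  have "mtrace (four_block_mat A B C D) = (\<Sum>i<n+m. if i < n then A $$ (i, i) else D $$ (i - n, i - n))"
    using assms by (auto simp: mtrace_def intro!: sum.cong)
  also have "\<dots> = (\<Sum>i<n. A $$ (i, i)) + (\<Sum>i<m. D $$ (i, i))"
    by (simp add: lessThan_atLeast0 sum.atLeastLessThan_concat[of 0 n "n+m", symmetric] 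
        sum.shift_bounds_nat_ivl[of _ 0 n m, simplified add.commute, simplified])
       (simp add: sum.atLeastLessThan_shift_0[of _ n "m+n"] add.commute)
  finally show ?thesis using assms by (auto simp: mtrace_def)
qed

lemma mtrace_diag_block_mat:
  assumes "\<forall>A\<in>set As. square_mat A"
  shows "mtrace (diag_block_mat As) = sum_list (map mtrace As)"
  using assms
proof (induction As)
  case (Cons A As)
  let ?D = "diag_block_mat As"
  have "square_mat ?D" using Cons.prems by (intro diag_block_mat_square) auto
  then have D: "?D \<in> carrier_mat (dim_row ?D) (dim_row ?D)" by (intro carrier_matI) simp_all
  have "A \<in> carrier_mat (dim_row A) (dim_row A)" using Cons.prems by (intro carrier_matI) simp_all
  from mtrace_four_block_mat[OF this D] Cons show ?case by (simp add: Let_def)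
qed (simp add: mtrace_def)

text \<open>The squared Frobenius norm; it normalizes column vectors and shows that the trace of a
  projection is non-negative.\<close>

lemma mtrace_adjoint_mult_self:
  assumes "A \<in> carrier_mat m n"
  shows "mtrace (mat_adjoint A * A) = of_real (\<Sum>j<n. \<Sum>i<m. (cmod (A $$ (i, j)))\<^sup>2)"
proof -
  have "(mat_adjoint A * A) $$ (j, j) = of_real (\<Sum>i<m. (cmod (A $$ (i, j)))\<^sup>2)" if "j < n" for j
  proof -
    have "(mat_adjoint A * A) $$ (j, j) = (\<Sum>i<m. mat_adjoint A $$ (j, i) * A $$ (i, j))"
      using assms that by (intro index_mult_mat_sum[of _ n _ _ n]) auto
    also have "\<dots> = (\<Sum>i<m. of_real ((cmod (A $$ (i, j)))\<^sup>2))"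
      using assms that by (intro sum.cong refl) (simp add: complex_norm_square mult.commute del: of_real_power)
    finally show ?thesis by simp
  qed
  then show ?thesis using assms by (simp add: mtrace_def del: index_mult_mat(1))
qed

text \<open>Vectors are matrices with one column.\<close>

lemma unit_vector_in_range:
  fixes Q :: "complex mat"
  assumes Q: "Q \<in> carrier_mat m m" "Q * Q = Q" "Q \<noteq> 0\<^sub>m m m"
  obtains w where "w \<in> carrier_mat m 1" "Q * w = w" "mat_adjoint w * w = 1\<^sub>m 1"
proof -
  obtain a b where ab: "a < m" "b < m" "Q $$ (a, b) \<noteq> 0"
    using Q(1,3) by (metis carrier_matD eq_matI index_zero_mat)
  \<comment> \<open>A non-zero column of \<open>Q\<close>; idempotence makes \<open>Q\<close> fix
    each of its columns.\<close>
  define q where "q = mat m 1 (\<lambda>(i, _). Q $$ (i, b))"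
  have q: "q \<in> carrier_mat m 1" by (auto simp: q_def)
  have Qq: "Q * q = q"
  proof (rule eq_matI)
    fix i j assume "i < dim_row q" "j < dim_col q"
    then have ij: "i < m" "j = 0" by (auto simp: q_def)
    have "(Q * q) $$ (i, j) = (\<Sum>l<m. Q $$ (i, l) * q $$ (l, j))"
      using Q q ij by (intro index_mult_mat_sum) auto
    also have "\<dots> = (\<Sum>l<m. Q $$ (i, l) * Q $$ (l, b))"
      using ij by (auto simp: q_def)
    also have "\<dots> = (Q * Q) $$ (i, b)"
      using Q ij ab by (intro index_mult_mat_sum[symmetric]) auto
    finally show "(Q * q) $$ (i, j) = q $$ (i, j)" using Q ij by (auto simp: q_def)
  qed (use Q in \<open>auto simp: q_def\<close>)
  define s where "s = (\<Sum>i<m. (cmod (q $$ (i, 0)))\<^sup>2)"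
  have "s \<ge> (cmod (q $$ (a, 0)))\<^sup>2"
    unfolding s_def using ab by (intro member_le_sum) auto
  moreover have "(cmod (q $$ (a, 0)))\<^sup>2 > 0" using ab by (simp add: q_def)
  ultimately have s: "s > 0" by linarith
  have qq: "mat_adjoint q * q = of_real s \<cdot>\<^sub>m 1\<^sub>m 1"
  proof (rule eq_matI)
    fix i j assume "i < dim_row (of_real s \<cdot>\<^sub>m 1\<^sub>m 1 :: complex mat)" "j < dim_col (of_real s \<cdot>\<^sub>m 1\<^sub>m 1 :: complex mat)"
    then have ij: "i = 0" "j = 0" by auto
    have "mtrace (mat_adjoint q * q) = of_real s"
      using mtrace_adjoint_mult_self[OF q] by (simp add: s_def)
    then show "(mat_adjoint q * q) $$ (i, j) = (of_real s \<cdot>\<^sub>m 1\<^sub>m 1) $$ (i, j)"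
      using q ij by (simp add: mtrace_def)
  qed (use q in auto)
  define w where "w = of_real (1 / sqrt s) \<cdot>\<^sub>m q"
  show thesis
  proof
    show w: "w \<in> carrier_mat m 1" using q by (simp add: w_def)
    show "Q * w = w" using Q q Qq by (simp add: w_def mult_smult_distrib)
    have "mat_adjoint w * w = (of_real (1 / sqrt s) * of_real (1 / sqrt s)) \<cdot>\<^sub>m (mat_adjoint q * q)"
      using mult_smult_distrib[of "mat_adjoint q" 1 m q 1] q
        mult_smult_assoc_mat[of "mat_adjoint q" 1 m "of_real (1 / sqrt s) \<cdot>\<^sub>m q" 1]
      by (simp add: w_def mat_adjoint_smult smult_smult_mat)
    also have "\<dots> = 1\<^sub>m 1"
      using s unfolding qq by (intro eq_matI) (auto simp: smult_smult_mat simp flip: of_real_mult)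
    finally show "mat_adjoint w * w = 1\<^sub>m 1" .
  qed
qed

section \<open>Orthonormal bases of the ranges of projections\<close>

text \<open>The columns of \<open>X\<close> followed by those of \<open>Y\<close>. The lower blocks
  have no rows, so the multiplication rule for \<open>four_block_mat\<close> applies.\<close>

definition hcat :: "complex mat \<Rightarrow> complex mat \<Rightarrow> complex mat" where
  "hcat X Y = four_block_mat X Y (0\<^sub>m 0 (dim_col X)) (0\<^sub>m 0 (dim_col Y))"

lemma hcat_carrier [intro]:
  "X \<in> carrier_mat m n \<Longrightarrow> Y \<in> carrier_mat m r \<Longrightarrow> hcat X Y \<in> carrier_mat m (n + r)"
  by (auto simp: hcat_def)

lemma mat_adjoint_hcat:
  assumes "X \<in> carrier_mat m n" "Y \<in> carrier_mat m r"
  shows "mat_adjoint (hcat X Y) = four_block_mat (mat_adjoint X) (0\<^sub>m n 0) (mat_adjoint Y) (0\<^sub>m r 0)"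
  using assms by (intro eq_matI) (auto simp: hcat_def)

lemma hcat_outer:
  assumes X: "X \<in> carrier_mat m n" and Y: "Y \<in> carrier_mat m r"
  shows "hcat X Y * mat_adjoint (hcat X Y) = X * mat_adjoint X + Y * mat_adjoint Y"
proof -
  have d: "dim_col X = n" "dim_col Y = r" using X Y by auto
  have "hcat X Y * mat_adjoint (hcat X Y) = four_block_mat (X * mat_adjoint X + Y * mat_adjoint Y)
     (X * 0\<^sub>m n 0 + Y * 0\<^sub>m r 0) (0\<^sub>m 0 n * mat_adjoint X + 0\<^sub>m 0 r * mat_adjoint Y)
     (0\<^sub>m 0 n * 0\<^sub>m n 0 + 0\<^sub>m 0 r * 0\<^sub>m r 0)"
    unfolding mat_adjoint_hcat[OF assms] unfolding hcat_def d
    by (rule mult_four_block_mat[OF X Y zero_carrier_mat zero_carrier_mat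
          mat_adjoint_carrier[OF X] zero_carrier_mat mat_adjoint_carrier[OF Y] zero_carrier_mat])
  also have "\<dots> = X * mat_adjoint X + Y * mat_adjoint Y"
    using X Y by (intro eq_matI) (simp_all del: index_mult_mat(1))
  finally show ?thesis .
qed

lemma mult_hcat:
  assumes X: "X \<in> carrier_mat m n" and Y: "Y \<in> carrier_mat m r" and B: "B \<in> carrier_mat k m"
  shows "B * hcat X Y = hcat (B * X) (B * Y)"
proof (rule eq_matI)
  fix i j assume "i < dim_row (hcat (B * X) (B * Y))" "j < dim_col (hcat (B * X) (B * Y))"
  then have ij: "i < k" "j < n + r" using X Y B by (auto simp: hcat_def)
  have "col (hcat X Y) j = (if j < n then col X j else col Y (j - n))"
    using X Y ij by (intro eq_vecI) (auto simp: hcat_def)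
  then show "(B * hcat X Y) $$ (i, j) = hcat (B * X) (B * Y) $$ (i, j)"
    using X Y B ij by (auto simp: hcat_def)
qed (use X Y B in \<open>auto simp: hcat_def\<close>)

text \<open>Expresses \<open>B\<close> in the basis formed by the columns. It is used with
  \<open>B\<close> the identity, to check orthonormality, and with \<open>B\<close> a value of a
  representation, to see its block form.\<close>

lemma hcat_gram:
  assumes X: "X \<in> carrier_mat m n" and Y: "Y \<in> carrier_mat m r" and B: "B \<in> carrier_mat m m"
  shows "mat_adjoint (hcat X Y) * B * hcat X Y = four_block_mat
     (mat_adjoint X * B * X) (mat_adjoint X * B * Y) (mat_adjoint Y * B * X) (mat_adjoint Y * B * Y)"
proof -
  note H = hcat_carrier[OF X Y]
  have "mat_adjoint (hcat X Y) * B * hcat X Y = mat_adjoint (hcat X Y) * hcat (B * X) (B * Y)"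
    unfolding mult_hcat[OF X Y B, symmetric] by (rule assoc_mult_mat[OF mat_adjoint_carrier[OF H] B H])
  also have "\<dots> = four_block_mat (mat_adjoint X * (B * X) + 0\<^sub>m n 0 * 0\<^sub>m 0 n) (mat_adjoint X * (B * Y) + 0\<^sub>m n 0 * 0\<^sub>m 0 r)
       (mat_adjoint Y * (B * X) + 0\<^sub>m r 0 * 0\<^sub>m 0 n) (mat_adjoint Y * (B * Y) + 0\<^sub>m r 0 * 0\<^sub>m 0 r)"
  proof -
    have d: "dim_col (B * X) = n" "dim_col (B * Y) = r" using X Y by auto
    show ?thesis
      unfolding mat_adjoint_hcat[OF X Y] unfolding hcat_def d
      by (rule mult_four_block_mat[OF mat_adjoint_carrier[OF X] zero_carrier_mat
          mat_adjoint_carrier[OF Y] zero_carrier_mat mult_carrier_mat[OF B X] mult_carrier_mat[OF B Y]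
          zero_carrier_mat zero_carrier_mat])
  qed
  also have "\<dots> = four_block_mat
     (mat_adjoint X * B * X) (mat_adjoint X * B * Y) (mat_adjoint Y * B * X) (mat_adjoint Y * B * Y)"
  proof (intro cong_four_block_mat)
    have "mat_adjoint U * (B * Z) + 0\<^sub>m k 0 * 0\<^sub>m 0 l = mat_adjoint U * B * Z"
      if "U \<in> carrier_mat m k" "Z \<in> carrier_mat m l" for U Z k l
      using assoc_mult_mat[OF mat_adjoint_carrier[OF that(1)] B that(2)]
        right_add_zero_mat[OF mult_carrier_mat[OF mat_adjoint_carrier[OF that(1)] mult_carrier_mat[OF B that(2)]]]
      by simp
    then show "mat_adjoint X * (B * X) + 0\<^sub>m n 0 * 0\<^sub>m 0 n = mat_adjoint X * B * X"
      "mat_adjoint X * (B * Y) + 0\<^sub>m n 0 * 0\<^sub>m 0 r = mat_adjoint X * B * Y"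
      "mat_adjoint Y * (B * X) + 0\<^sub>m r 0 * 0\<^sub>m 0 n = mat_adjoint Y * B * X"
      "mat_adjoint Y * (B * Y) + 0\<^sub>m r 0 * 0\<^sub>m 0 r = mat_adjoint Y * B * Y"
      using X Y by blast+
  qed
  finally show ?thesis .
qed

text \<open>Splitting off a unit vector \<open>w\<close> of the range leaves the projection
  \<open>Q - w * mat_adjoint w\<close>, whose trace is smaller by one. The vectors collected in this
  way are the columns of \<open>Y\<close>, and \<open>r\<close> is the rank.\<close>

lemma projection_factorization:
  fixes Q :: "complex mat"
  assumes "Q \<in> carrier_mat m m" "mat_adjoint Q = Q" "Q * Q = Q"
  obtains r Y where "Y \<in> carrier_mat m r" "Y * mat_adjoint Y = Q" "mat_adjoint Y * Y = 1\<^sub>m r"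
proof -
  \<comment> \<open>Induction on a strict bound \<open>k\<close> for the trace. The trace of a
    projection equals that of \<open>mat_adjoint Q * Q\<close>, hence is non-negative, and the bound
    0 is impossible.\<close>
  have "\<exists>r Y. Y \<in> carrier_mat m r \<and> Y * mat_adjoint Y = Q \<and> mat_adjoint Y * Y = 1\<^sub>m r"
    if "Q \<in> carrier_mat m m" "mat_adjoint Q = Q" "Q * Q = Q" "Re (mtrace Q) < real k" for Q k
    using that
  proof (induction k arbitrary: Q)
    case 0
    have "mtrace Q = of_real (\<Sum>j<m. \<Sum>i<m. (cmod (Q $$ (i, j)))\<^sup>2)"
      using mtrace_adjoint_mult_self[OF 0(1)] 0 by simp
    then have "Re (mtrace Q) \<ge> 0" by (simp add: sum_nonneg)
    then show ?case using 0 by simp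
  next
    case (Suc k)
    show ?case
    proof (cases "Q = 0\<^sub>m m m")
      case True
      then show ?thesis by (intro exI[of _ 0] exI[of _ "0\<^sub>m m 0"]) auto
    next
      case False
      obtain w where w: "w \<in> carrier_mat m 1" "Q * w = w" "mat_adjoint w * w = 1\<^sub>m 1"
        using unit_vector_in_range[OF Suc.prems(1,3) False] by blast
      define Q' where "Q' = Q - w * mat_adjoint w"
      note Q = Suc.prems
      have ww: "w * mat_adjoint w \<in> carrier_mat m m" using w by auto
      have wQ: "mat_adjoint w * Q = mat_adjoint w"
        using mat_adjoint_mult[OF Q(1) w(1)] w Q by simp
      have Q': "Q' \<in> carrier_mat m m" unfolding Q'_def using ww by (rule minus_carrier_mat)
      have 1: "Q * (w * mat_adjoint w) = w * mat_adjoint w"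
        using w Q by (subst assoc_mult_mat[symmetric]) auto
      have 2: "w * mat_adjoint w * Q = w * mat_adjoint w"
        using w Q wQ by (subst assoc_mult_mat) auto
      have 3: "w * mat_adjoint w * w = w"
        using w by (subst assoc_mult_mat) auto
      have 4: "w * mat_adjoint w * (w * mat_adjoint w) = w * mat_adjoint w"
          using assoc_mult_mat[symmetric, OF ww w(1), of "mat_adjoint w" m] w 3 by simp
      have Q'w: "Q' * w = 0\<^sub>m m 1"
        unfolding Q'_def using w Q ww 3 by (subst minus_mult_distrib_mat[of _ m m]) auto
      have adj: "mat_adjoint Q' = Q'"
        using Q ww w unfolding Q'_def by (simp add: mat_adjoint_minus[of _ m m] mat_adjoint_mult[of _ m 1 _ m])
      have idem: "Q' * Q' = Q'"
      proof -
        have "Q' * Q' = Q' * Q - Q' * (w * mat_adjoint w)"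
          using Q' Q ww unfolding Q'_def by (intro mult_minus_distrib_mat) auto
        also have "Q' * (w * mat_adjoint w) = 0\<^sub>m m m"
          using Q' w Q'w by (subst assoc_mult_mat[symmetric]) auto
        also have "Q' * Q = Q * Q - w * mat_adjoint w * Q"
          using Q ww unfolding Q'_def by (intro minus_mult_distrib_mat) auto
        finally show ?thesis using 2 Q ww by (simp add: Q'_def) (intro eq_matI; auto)
      qed
      have "mtrace (w * mat_adjoint w) = 1"
        using mtrace_mult_comm[of w m 1 "mat_adjoint w"] w by simp
      moreover have "mtrace Q = mtrace Q' + mtrace (w * mat_adjoint w)"
        using Q Q' ww by (subst mtrace_add[symmetric, of _ m]) (auto simp: Q'_def intro!: arg_cong[where f=mtrace] eq_matI)
      ultimately have "Re (mtrace Q') < real k" using Q by simp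
      from Suc.IH[OF Q' adj idem this] obtain r Y where
        Y: "Y \<in> carrier_mat m r" "Y * mat_adjoint Y = Q'" "mat_adjoint Y * Y = 1\<^sub>m r" by blast
      have Q'Y: "Y = Q' * Y"
        using assoc_mult_mat[OF Y(1) mat_adjoint_carrier[OF Y(1)] Y(1)] Y by simp
      \<comment> \<open>\<open>Y = Q' * Y\<close> and \<open>Q' * w = 0\<close> make
        \<open>w\<close> orthogonal to the columns found for \<open>Q'\<close>.\<close>
      have wY: "mat_adjoint w * Y = 0\<^sub>m 1 r"
      proof -
        have "mat_adjoint w * Y = mat_adjoint w * Q' * Y"
          using assoc_mult_mat[OF mat_adjoint_carrier[OF w(1)] Q' Y(1)] Q'Y by simp
        also have "mat_adjoint w * Q' = 0\<^sub>m 1 m"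
          using mat_adjoint_mult[OF Q' w(1)] Q'w adj by simp
        finally show ?thesis using Y by simp
      qed
      have Yw: "mat_adjoint Y * w = 0\<^sub>m r 1"
        using mat_adjoint_mult[of "mat_adjoint w" 1 m Y r] wY w Y by simp
      have "hcat w Y * mat_adjoint (hcat w Y) = Q"
        unfolding hcat_outer[OF w(1) Y(1)] Y(2) Q'_def using Q ww by (intro eq_matI) auto
      moreover have "mat_adjoint (hcat w Y) * hcat w Y = 1\<^sub>m (1 + r)"
      proof -
        have "mat_adjoint (hcat w Y) * hcat w Y = mat_adjoint (hcat w Y) * 1\<^sub>m m * hcat w Y"
          using right_mult_one_mat[of "mat_adjoint (hcat w Y)" "1 + r" m] hcat_carrier[OF w(1) Y(1)] by simp
        also have "\<dots> = four_block_mat (1\<^sub>m 1) (0\<^sub>m 1 r) (0\<^sub>m r 1) (1\<^sub>m r)"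
          unfolding hcat_gram[OF w(1) Y(1) one_carrier_mat]
          using right_mult_one_mat[of "mat_adjoint w" 1 m] right_mult_one_mat[of "mat_adjoint Y" r m] w(1,3) Y(1,3) wY Yw
          by (intro cong_four_block_mat) simp_all
        finally show ?thesis by (simp only: four_block_one_mat)
      qed
      ultimately show ?thesis using hcat_carrier[OF w(1) Y(1)] by blast
    qed
  qed
  moreover obtain k where "Re (mtrace Q) < real k" using reals_Archimedean2 by blast
  ultimately have "\<exists>r Y. Y \<in> carrier_mat m r \<and> Y * mat_adjoint Y = Q \<and> mat_adjoint Y * Y = 1\<^sub>m r"
    using assms by simp
  then show thesis using that by blast
qed

section \<open>Direct sums of matrix algebras\<close>

lemma mat_sum_length: "u \<in> mat_sum ns \<Longrightarrow> length u = length ns"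
  by (simp add: mat_sum_def)

lemma mat_sum_nth: "u \<in> mat_sum ns \<Longrightarrow> j < length ns \<Longrightarrow> u ! j \<in> carrier_mat (ns ! j) (ns ! j)"
  by (simp add: mat_sum_def)

lemma mat_sum_eqI:
  assumes "u \<in> mat_sum ns" "v \<in> mat_sum ns" "\<And>j. j < length ns \<Longrightarrow> u ! j = v ! j"
  shows "u = v"
  using assms by (intro nth_equalityI) (auto simp: mat_sum_length)

lemma mat_sum_add: "u \<in> mat_sum ns \<Longrightarrow> v \<in> mat_sum ns \<Longrightarrow> map2 (+) u v \<in> mat_sum ns"
  by (simp add: mat_sum_def)

lemma mat_sum_mult: "u \<in> mat_sum ns \<Longrightarrow> v \<in> mat_sum ns \<Longrightarrow> map2 (*) u v \<in> mat_sum ns"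
  using mult_carrier_mat by (fastforce simp: mat_sum_def)

lemma mat_sum_smult: "u \<in> mat_sum ns \<Longrightarrow> map (\<lambda>M. c \<cdot>\<^sub>m M) u \<in> mat_sum ns"
  by (simp add: mat_sum_def)

lemma mat_sum_adjoint: "u \<in> mat_sum ns \<Longrightarrow> map mat_adjoint u \<in> mat_sum ns"
  by (simp add: mat_sum_def)

lemmas mat_sum_closed = mat_sum_add mat_sum_mult mat_sum_smult mat_sum_adjoint

section \<open>Matrix units and additive expansions\<close>

text \<open>\<open>c\<close> times a matrix unit of summand \<open>j\<close>. Keeping the
  coefficient inside lets expansions rest on additivity alone; indices out of range, or
  \<open>c = 0\<close>, give the zero element.\<close>

definition munit :: "nat list \<Rightarrow> nat \<Rightarrow> nat \<Rightarrow> nat \<Rightarrow> complex \<Rightarrow> complex mat list" where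
  "munit ns j a b c =
     map (\<lambda>i. mat (ns ! i) (ns ! i) (\<lambda>(x, y). if i = j \<and> x = a \<and> y = b then c else 0)) [0..<length ns]"

lemma munit_mat_sum [simp, intro]: "munit ns j a b c \<in> mat_sum ns"
  by (simp add: munit_def mat_sum_def)

lemma nth_munit:
  "i < length ns \<Longrightarrow>
    munit ns j a b c ! i = mat (ns ! i) (ns ! i) (\<lambda>(x, y). if i = j \<and> x = a \<and> y = b then c else 0)"
  by (simp add: munit_def)

lemma length_munit [simp]: "length (munit ns j a b c) = length ns"
  by (simp add: munit_def)

lemma index_munit:
  "i < length ns \<Longrightarrow> x < ns ! i \<Longrightarrow> y < ns ! i \<Longrightarrow>
    munit ns j a b c ! i $$ (x, y) = (if i = j \<and> x = a \<and> y = b then c else 0)"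
  by (simp add: munit_def)

lemma munit_zero: "munit ns j a b 0 = map (\<lambda>n. 0\<^sub>m n n) ns"
  by (rule nth_equalityI) (auto simp: munit_def intro!: eq_matI)

lemma smult_munit: "map (\<lambda>M. c \<cdot>\<^sub>m M) (munit ns j a b d) = munit ns j a b (c * d)"
  by (rule nth_equalityI) (auto simp: munit_def intro!: eq_matI)

lemma adjoint_munit: "map mat_adjoint (munit ns j a b c) = munit ns j b a (cnj c)"
  by (rule nth_equalityI) (auto simp: munit_def intro!: eq_matI)

text \<open>The bound on \<open>b\<close> matters: for \<open>b = b'\<close> out of range the
  product consists of zero blocks, while \<open>munit ns j a d\<close> need not.\<close>

lemma munit_mult_munit:
  assumes "b < ns ! j"
  shows "map2 (*) (munit ns j a b c) (munit ns k b' d c') =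
    (if j = k \<and> b = b' then munit ns j a d (c * c') else map (\<lambda>n. 0\<^sub>m n n) ns)"
proof -
  let ?r = "if j = k \<and> b = b' then munit ns j a d (c * c') else map (\<lambda>n. 0\<^sub>m n n) ns"
  have r: "?r \<in> mat_sum ns" by (auto simp: mat_sum_def nth_munit)
  show ?thesis
  proof (rule mat_sum_eqI[OF mat_sum_mult r])
    fix i assume i: "i < length ns"
    have "(munit ns j a b c ! i * munit ns k b' d c' ! i) $$ (x, y) = ?r ! i $$ (x, y)"
      if xy: "x < ns ! i" "y < ns ! i" for x y
    proof -
      have "(munit ns j a b c ! i * munit ns k b' d c' ! i) $$ (x, y) =
          (\<Sum>l<ns ! i. munit ns j a b c ! i $$ (x, l) * munit ns k b' d c' ! i $$ (l, y))"
        using i xy by (intro index_mult_mat_sum[of _ "ns ! i" _ _ "ns ! i"] mat_sum_nth) auto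
      also have "\<dots> = (\<Sum>l<ns ! i. if l = b then (if i = j \<and> x = a \<and> i = k \<and> b = b' \<and> y = d then c * c' else 0) else 0)"
        using i xy by (intro sum.cong refl) (auto simp: index_munit)
      also have "\<dots> = ?r ! i $$ (x, y)"
        using i xy assms by (auto simp: sum.delta index_munit)
      finally show ?thesis .
    qed
    then show "map2 (*) (munit ns j a b c) (munit ns k b' d c') ! i = ?r ! i"
      using i carrier_matD[OF mat_sum_nth[OF r i]] carrier_matD[OF mat_sum_nth[OF munit_mat_sum i]]
      by (intro eq_matI) (simp_all del: index_mult_mat(1))
  qed auto
qed

definition mat_index :: "nat list \<Rightarrow> (nat \<times> nat \<times> nat) set" where
  "mat_index ns = (SIGMA j:{..<length ns}. {..<ns ! j} \<times> {..<ns ! j})"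

lemma finite_mat_index [simp]: "finite (mat_index ns)"
  by (auto simp: mat_index_def)

text \<open>The entries of \<open>u\<close> are added one position at a time. Only sums are
  involved, so the same expansion serves for entries of matrices and for values in a
  C*-algebra.\<close>

lemma additive_expansion:
  fixes L :: "complex mat list \<Rightarrow> 'c::ab_group_add"
  assumes add: "\<And>u v. u \<in> mat_sum ns \<Longrightarrow> v \<in> mat_sum ns \<Longrightarrow> L (map2 (+) u v) = L u + L v"
    and u: "u \<in> mat_sum ns"
  shows "L u = (\<Sum>(j, a, b)\<in>mat_index ns. L (munit ns j a b (u ! j $$ (a, b))))"
proof -
  define res where "res S = map (\<lambda>j. mat (ns ! j) (ns ! j)
    (\<lambda>(a, b). if (j, a, b) \<in> S then u ! j $$ (a, b) else 0)) [0..<length ns]" for S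
  have res: "res S \<in> mat_sum ns" for S by (auto simp: res_def mat_sum_def)
  have "L (res S) = (\<Sum>(j, a, b)\<in>S. L (munit ns j a b (u ! j $$ (a, b))))" if "finite S" for S
    using that
  proof (induction S)
    case empty
    have "map2 (+) (res {}) (res {}) = res {}"
      by (rule nth_equalityI) (auto simp: res_def intro!: eq_matI)
    \<comment> \<open>\<open>L\<close> vanishes at zero because zero is its own double.\<close>
    with add[OF res res, of "{}" "{}"] show ?case by simp
  next
    case (insert t S)
    obtain j a b where t: "t = (j, a, b)" by (cases t) auto
    have "res (insert t S) = map2 (+) (munit ns j a b (u ! j $$ (a, b))) (res S)"
      using insert.hyps by (intro nth_equalityI) (auto simp: res_def t munit_def intro!: eq_matI)
    then show ?case using add[OF munit_mat_sum res] insert by (simp add: t)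
  qed
  from this[OF finite_mat_index]
  have "L (res (mat_index ns)) = (\<Sum>(j, a, b)\<in>mat_index ns. L (munit ns j a b (u ! j $$ (a, b))))" .
  moreover have "res (mat_index ns) = u"
    using u by (intro mat_sum_eqI[OF res u]) (auto simp: res_def mat_index_def mat_sum_def intro!: eq_matI)
  ultimately show ?thesis by simp
qed

section \<open>Representations and invariant subspaces\<close>

text \<open>One component of a homomorphism of direct sums, possibly not unital. The laws are
  required on \<open>mat_sum ns\<close> only, since lists of another shape have no meaning.\<close>

definition mat_rep :: "nat list \<Rightarrow> nat \<Rightarrow> (complex mat list \<Rightarrow> complex mat) \<Rightarrow> bool" where
  "mat_rep ns m h \<longleftrightarrow>
     (\<forall>u\<in>mat_sum ns. h u \<in> carrier_mat m m) \<and>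
     (\<forall>u\<in>mat_sum ns. \<forall>v\<in>mat_sum ns. h (map2 (+) u v) = h u + h v) \<and>
     (\<forall>c. \<forall>u\<in>mat_sum ns. h (map (\<lambda>M. c \<cdot>\<^sub>m M) u) = c \<cdot>\<^sub>m h u) \<and>
     (\<forall>u\<in>mat_sum ns. \<forall>v\<in>mat_sum ns. h (map2 (*) u v) = h u * h v) \<and>
     (\<forall>u\<in>mat_sum ns. h (map mat_adjoint u) = mat_adjoint (h u))"

lemma mat_repD:
  assumes "mat_rep ns m h" "u \<in> mat_sum ns"
  shows "h u \<in> carrier_mat m m" "h (map (\<lambda>M. c \<cdot>\<^sub>m M) u) = c \<cdot>\<^sub>m h u"
    "h (map mat_adjoint u) = mat_adjoint (h u)"
    "v \<in> mat_sum ns \<Longrightarrow> h (map2 (+) u v) = h u + h v"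
    "v \<in> mat_sum ns \<Longrightarrow> h (map2 (*) u v) = h u * h v"
  using assms by (auto simp: mat_rep_def)

lemma mat_rep_munit:
  assumes "mat_rep ns m h"
  shows "h (munit ns j a b c) = c \<cdot>\<^sub>m h (munit ns j a b 1)"
  using mat_repD(2)[OF assms munit_mat_sum, of c j a b 1] by (simp add: smult_munit)

lemma mat_rep_zero:
  assumes "mat_rep ns m h"
  shows "h (map (\<lambda>n. 0\<^sub>m n n) ns) = 0\<^sub>m m m"
  using mat_rep_munit[OF assms, of 0 0 0 0] mat_repD(1)[OF assms munit_mat_sum, of 0 0 0 1]
  unfolding munit_zero by (auto intro!: eq_matI)

text \<open>Matrices of arbitrary sizes do not form a group, so the additive expansion is applied to
  each entry separately.\<close>

lemma mat_rep_expansion: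
  assumes h: "mat_rep ns m h" and u: "u \<in> mat_sum ns" and xy: "x < m" "y < m"
  shows "h u $$ (x, y) = (\<Sum>(j, a, b)\<in>mat_index ns. u ! j $$ (a, b) * h (munit ns j a b 1) $$ (x, y))"
proof -
  have "h u $$ (x, y) = (\<Sum>(j, a, b)\<in>mat_index ns. h (munit ns j a b (u ! j $$ (a, b))) $$ (x, y))"
  proof (rule additive_expansion[OF _ u])
    fix p q assume "p \<in> mat_sum ns" "q \<in> mat_sum ns"
    then show "h (map2 (+) p q) $$ (x, y) = h p $$ (x, y) + h q $$ (x, y)"
      using mat_repD(4)[OF h, of p q] carrier_matD[OF mat_repD(1)[OF h, of q]] xy by simp
  qed
  also have "\<dots> = (\<Sum>(j, a, b)\<in>mat_index ns. u ! j $$ (a, b) * h (munit ns j a b 1) $$ (x, y))"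
    using xy carrier_matD[OF mat_repD(1)[OF h munit_mat_sum]]
    by (intro sum.cong refl) (auto simp: mat_rep_munit[OF h, of _ _ _ "_ $$ _"])
  finally show ?thesis .
qed

text \<open>Each matrix unit factors through the corner, \<open>e_ab = e_a0 e_00 e_0b\<close>, so a
  summand is killed as soon as its first minimal projection is.\<close>

lemma mat_rep_eq_0:
  assumes h: "mat_rep ns m h" and u: "u \<in> mat_sum ns"
    and 0: "\<And>j. j < length ns \<Longrightarrow> h (munit ns j 0 0 1) = 0\<^sub>m m m"
  shows "h u = 0\<^sub>m m m"
proof -
  have "h (munit ns j a b 1) = 0\<^sub>m m m" if "(j, a, b) \<in> mat_index ns" for j a b
  proof -
    have j: "j < length ns" "0 < ns ! j" using that by (auto simp: mat_index_def)
    have "munit ns j a b 1 = map2 (*) (munit ns j a 0 1) (map2 (*) (munit ns j 0 0 1) (munit ns j 0 b 1))"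
      using j by (simp add: munit_mult_munit)
    then have "h (munit ns j a b 1) = h (munit ns j a 0 1) * (h (munit ns j 0 0 1) * h (munit ns j 0 b 1))"
      by (simp add: mat_repD(5)[OF h] mat_sum_mult)
    then show ?thesis using 0[OF j(1)] mat_repD(1)[OF h munit_mat_sum]
      by (metis left_mult_zero_mat right_mult_zero_mat)
  qed
  then have "h u $$ (x, y) = 0" if "x < m" "y < m" for x y
    using that mat_rep_expansion[OF h u that] by (auto intro!: sum.neutral)
  then show ?thesis using mat_repD(1)[OF h u] by (intro eq_matI) auto
qed

text \<open>A unit vector \<open>w\<close> in the range of the image of \<open>e_00\<close>
  generates a copy of summand \<open>j\<close>: the vectors \<open>e_a0 w\<close> are orthonormal,
  and \<open>h\<close> transforms them like the standard basis of that summand. They are the columns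
  of \<open>X\<close>.\<close>

lemma mat_rep_isometry:
  assumes h: "mat_rep ns m h" and j: "j < length ns" "1 \<le> ns ! j"
    and nz: "h (munit ns j 0 0 1) \<noteq> 0\<^sub>m m m"
  obtains X where "X \<in> carrier_mat m (ns ! j)" "mat_adjoint X * X = 1\<^sub>m (ns ! j)"
    "\<And>u. u \<in> mat_sum ns \<Longrightarrow> h u * X = X * (u ! j)"
proof -
  let ?n = "ns ! j" and ?e = "\<lambda>a b. h (munit ns j a b 1)"
  have e: "?e a b \<in> carrier_mat m m" for a b using mat_repD(1)[OF h] by auto
  have ee: "?e a b * ?e c d = (if b = c then ?e a d else 0\<^sub>m m m)" if "b < ?n" for a b c d
    using mat_repD(5)[OF h munit_mat_sum munit_mat_sum, of j a b 1 j c d 1] munit_mult_munit[OF that, of a 1 j c d 1]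
      mat_rep_zero[OF h] by (auto split: if_splits)
  have adj: "mat_adjoint (?e a b) = ?e b a" for a b
    using mat_repD(3)[OF h munit_mat_sum, of j a b 1] by (simp add: adjoint_munit)
  obtain w where w: "w \<in> carrier_mat m 1" "?e 0 0 * w = w" "mat_adjoint w * w = 1\<^sub>m 1"
    using unit_vector_in_range[OF e _ nz] ee j by auto
  define wv where "wv a = ?e a 0 * w" for a
  have wv: "wv a \<in> carrier_mat m 1" for a unfolding wv_def by (rule mult_carrier_mat[OF e w(1)])
  define X where "X = mat m ?n (\<lambda>(x, a). wv a $$ (x, 0))"
  have X: "X \<in> carrier_mat m ?n" by (simp add: X_def)
  have gram: "mat_adjoint (wv a) * wv b = (if a = b then 1\<^sub>m 1 else 0\<^sub>m 1 1)" if "a < ?n" "b < ?n" for a b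
  proof -
    have "mat_adjoint (wv a) * wv b = mat_adjoint w * ?e 0 a * (?e b 0 * w)"
      unfolding wv_def using mat_adjoint_mult[OF e w(1)] by (simp add: adj)
    also have "\<dots> = mat_adjoint w * (?e 0 a * (?e b 0 * w))"
      by (rule assoc_mult_mat[OF mat_adjoint_carrier[OF w(1)] e mult_carrier_mat[OF e w(1)]])
    also have "?e 0 a * (?e b 0 * w) = (?e 0 a * ?e b 0) * w"
      by (rule assoc_mult_mat[OF e e w(1), symmetric])
    also have "\<dots> = (if a = b then w else 0\<^sub>m m 1)"
      using ee[OF that(1)] w by simp
    also have "mat_adjoint w * \<dots> = (if a = b then 1\<^sub>m 1 else 0\<^sub>m 1 1)"
      using w by simp
    finally show ?thesis .
  qed
  have 1: "mat_adjoint X * X = 1\<^sub>m ?n"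
  proof (rule eq_matI)
    fix a b assume "a < dim_row (1\<^sub>m ?n :: complex mat)" "b < dim_col (1\<^sub>m ?n :: complex mat)"
    then have ab: "a < ?n" "b < ?n" by auto
    have "(mat_adjoint X * X) $$ (a, b) = (\<Sum>x<m. mat_adjoint X $$ (a, x) * X $$ (x, b))"
      using X ab by (intro index_mult_mat_sum[of _ ?n _ _ ?n]) auto
    also have "\<dots> = (\<Sum>x<m. mat_adjoint (wv a) $$ (0, x) * wv b $$ (x, 0))"
      using X ab wv by (intro sum.cong refl) (simp add: X_def carrier_matD[OF wv])
    also have "\<dots> = (mat_adjoint (wv a) * wv b) $$ (0, 0)"
      using wv by (intro index_mult_mat_sum[of _ 1 _ _ 1, symmetric]) auto
    finally show "(mat_adjoint X * X) $$ (a, b) = 1\<^sub>m ?n $$ (a, b)"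
      using gram[OF ab] ab by simp
  qed (use X in auto)
  have 2: "h u * X = X * (u ! j)" if u: "u \<in> mat_sum ns" for u
  proof (rule eq_matI)
    note uj = mat_sum_nth[OF u j(1)]
    note hu = mat_repD(1)[OF h u]
    fix x a assume "x < dim_row (X * (u ! j))" "a < dim_col (X * (u ! j))"
    then have xa: "x < m" "a < ?n" using X uj by auto
    \<comment> \<open>Moves \<open>wv a\<close> back to \<open>w\<close>, so that products of matrix
      units are evaluated in \<open>mat_sum\<close> before \<open>h\<close> is applied.\<close>
    have Lh: "h (map2 (*) v (munit ns j a 0 1)) * w = h v * wv a" if "v \<in> mat_sum ns" for v
      unfolding wv_def mat_repD(5)[OF h that munit_mat_sum]
      by (rule assoc_mult_mat[OF mat_repD(1)[OF h that] e w(1)])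
    define L where "L v = (h v * wv a) $$ (x, 0)" for v
    have "L u = (\<Sum>(i, b, c)\<in>mat_index ns. L (munit ns i b c (u ! i $$ (b, c))))"
    proof (rule additive_expansion[OF _ u])
      fix p q assume pq: "p \<in> mat_sum ns" "q \<in> mat_sum ns"
      show "L (map2 (+) p q) = L p + L q"
        unfolding L_def mat_repD(4)[OF h pq] 
          add_mult_distrib_mat[OF mat_repD(1)[OF h pq(1)] mat_repD(1)[OF h pq(2)] wv]
        using xa carrier_matD[OF wv] carrier_matD[OF mat_repD(1)[OF h pq(2)]] by simp
    qed
    \<comment> \<open>Only the units of summand \<open>j\<close> with column index \<open>a\<close>
      survive multiplication by \<open>e_a0\<close>.\<close>
    also have "\<dots> = (\<Sum>(i, b, c)\<in>mat_index ns. if i = j \<and> c = a then u ! j $$ (b, a) * wv b $$ (x, 0) else 0)"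
    proof (intro sum.cong refl, clarsimp simp del: One_nat_def split del: if_split)
      fix i b c assume "(i, b, c) \<in> mat_index ns"
      then have ibc: "i < length ns" "b < ns ! i" "c < ns ! i" by (auto simp: mat_index_def)
      have "L (munit ns i b c (u ! i $$ (b, c))) =
         (h (map2 (*) (munit ns i b c (u ! i $$ (b, c))) (munit ns j a 0 1)) * w) $$ (x, 0)"
        unfolding L_def by (simp only: Lh[OF munit_mat_sum])
      also have "\<dots> = (if i = j \<and> c = a then u ! j $$ (b, a) * wv b $$ (x, 0) else 0)"
      proof (cases "i = j \<and> c = a")
        case True
        then show ?thesis using ibc xa carrier_matD[OF w(1)] carrier_matD[OF e] wv
          mult_smult_assoc_mat[OF e w(1)]
          by (simp add: munit_mult_munit mat_rep_munit[OF h, of _ _ _ "_ $$ _"] wv_def)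
      next
        case False
        then show ?thesis using ibc xa munit_mult_munit[OF ibc(3)] mat_rep_zero[OF h] left_mult_zero_mat[OF w(1)] by auto
      qed
      finally show "L (munit ns i b c (u ! i $$ (b, c))) = \<dots>" .
    qed
    also have "\<dots> = (\<Sum>t\<in>(\<lambda>b. (j, b, a)) ` {..<?n}. case t of (i, b, c) \<Rightarrow> 
        if i = j \<and> c = a then u ! j $$ (b, a) * wv b $$ (x, 0) else 0)"
      using j xa by (intro sum.mono_neutral_right) (auto simp: mat_index_def)
    also have "\<dots> = (\<Sum>b<?n. u ! j $$ (b, a) * wv b $$ (x, 0))"
      by (subst sum.reindex) (auto simp: inj_on_def)
    also have "\<dots> = (\<Sum>b<?n. X $$ (x, b) * u ! j $$ (b, a))"
      using xa by (intro sum.cong) (auto simp: X_def)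
    also have "\<dots> = (X * (u ! j)) $$ (x, a)"
      using xa by (intro index_mult_mat_sum[OF X uj, symmetric])
    finally have Lu: "L u = (X * (u ! j)) $$ (x, a)" .
    have "(h u * X) $$ (x, a) = (\<Sum>y<m. h u $$ (x, y) * X $$ (y, a))"
      using xa by (intro index_mult_mat_sum[OF hu X])
    also have "\<dots> = (\<Sum>y<m. h u $$ (x, y) * wv a $$ (y, 0))"
      using xa by (intro sum.cong) (auto simp: X_def)
    also have "\<dots> = L u"
      unfolding L_def using xa by (intro index_mult_mat_sum[OF hu wv, symmetric]) auto
    finally show "(h u * X) $$ (x, a) = (X * (u ! j)) $$ (x, a)" using Lu by simp
  qed (use X mat_sum_nth[OF that j(1)] mat_repD(1)[OF h that] in auto)
  show thesis by (rule that[OF X 1 2])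
qed

text \<open>The range of \<open>X\<close> is invariant under all \<open>h u\<close>, and
  \<open>h\<close> respects adjoints, so the orthogonal complement is invariant too. The columns of
  \<open>Y\<close> form an orthonormal basis of it, in which \<open>h\<close> restricts to a
  representation.\<close>

lemma mat_rep_compress:
  assumes h: "mat_rep ns m h" and j: "j < length ns"
    and X: "X \<in> carrier_mat m (ns ! j)" "mat_adjoint X * X = 1\<^sub>m (ns ! j)"
      "\<And>u. u \<in> mat_sum ns \<Longrightarrow> h u * X = X * (u ! j)"
  obtains r Y where "m = ns ! j + r" "Y \<in> carrier_mat m r" "X * mat_adjoint X + Y * mat_adjoint Y = 1\<^sub>m m"
    "mat_adjoint Y * Y = 1\<^sub>m r"
    "\<And>u. u \<in> mat_sum ns \<Longrightarrow> mat_adjoint X * h u * X = u ! j"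
    "\<And>u. u \<in> mat_sum ns \<Longrightarrow> mat_adjoint X * h u * Y = 0\<^sub>m (ns ! j) r"
    "\<And>u. u \<in> mat_sum ns \<Longrightarrow> mat_adjoint Y * h u * X = 0\<^sub>m r (ns ! j)"
    "mat_rep ns r (\<lambda>u. mat_adjoint Y * h u * Y)"
proof -
  let ?n = "ns ! j"
  define P where "P = X * mat_adjoint X"
  note Xa = mat_adjoint_carrier[OF X(1)]
  have P: "P \<in> carrier_mat m m" unfolding P_def by (rule mult_carrier_mat[OF X(1) Xa])
  have Padj: "mat_adjoint P = P"
    unfolding P_def using mat_adjoint_mult[OF X(1) Xa] by simp
  have PX: "P * X = X"
    unfolding P_def assoc_mult_mat[OF X(1) Xa X(1)] X(2) by (rule right_mult_one_mat[OF X(1)])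
  have PP: "P * P = P"
    using assoc_mult_mat[OF P X(1) Xa] PX by (simp add: P_def)
  define Q where "Q = 1\<^sub>m m - P"
  have Q: "Q \<in> carrier_mat m m" unfolding Q_def using P by (rule minus_carrier_mat)
  have PQ: "P + Q = 1\<^sub>m m" using P by (intro eq_matI) (auto simp: Q_def)
  have Qadj: "mat_adjoint Q = Q"
    unfolding Q_def mat_adjoint_minus[OF one_carrier_mat P] Padj by simp
  have QX: "Q * X = 0\<^sub>m m ?n"
    unfolding Q_def minus_mult_distrib_mat[OF one_carrier_mat P X(1)] PX using X(1) by simp
  have "Q * P = 0\<^sub>m m m"
    unfolding P_def assoc_mult_mat[OF Q X(1) Xa, symmetric] QX by (rule left_mult_zero_mat[OF Xa])
  then have QQ: "Q * Q = Q"
    using mult_minus_distrib_mat[OF Q one_carrier_mat P] Q by (simp flip: Q_def) (intro eq_matI; auto)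
  obtain r Y where Y: "Y \<in> carrier_mat m r" "Y * mat_adjoint Y = Q" "mat_adjoint Y * Y = 1\<^sub>m r"
    using projection_factorization[OF Q Qadj QQ] by blast
  note Ya = mat_adjoint_carrier[OF Y(1)]
  \<comment> \<open>The trace counts dimensions: \<open>P\<close> contributes \<open>ns ! j\<close>
    and \<open>Q\<close> contributes \<open>r\<close>.\<close>
  have "mtrace P = of_nat ?n"
    unfolding P_def mtrace_mult_comm[OF X(1) Xa] X(2) by simp
  moreover have "mtrace Q = of_nat r"
    using mtrace_mult_comm[OF Y(1) Ya] unfolding Y(2,3) by simp
  ultimately have "of_nat m = (of_nat (?n + r) :: complex)"
    using mtrace_add[OF P Q] unfolding PQ by simp
  then have m: "m = ?n + r" by (simp only: of_nat_eq_iff)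
  have YX: "mat_adjoint Y * X = 0\<^sub>m r ?n"
  proof -
    have "mat_adjoint Y * X = (mat_adjoint Y * Y) * (mat_adjoint Y * X)"
      unfolding Y(3) by (rule left_mult_one_mat[OF mult_carrier_mat[OF Ya X(1)], symmetric])
    also have "\<dots> = mat_adjoint Y * (Y * (mat_adjoint Y * X))"
      by (rule assoc_mult_mat[OF Ya Y(1) mult_carrier_mat[OF Ya X(1)]])
    also have "Y * (mat_adjoint Y * X) = Q * X"
      unfolding Y(2)[symmetric] by (rule assoc_mult_mat[OF Y(1) Ya X(1), symmetric])
    finally show ?thesis unfolding QX right_mult_zero_mat[OF Ya] .
  qed
  have YhX: "mat_adjoint Y * h u * X = 0\<^sub>m r ?n" if u: "u \<in> mat_sum ns" for u
  proof -
    have "mat_adjoint Y * h u * X = mat_adjoint Y * (X * (u ! j))"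
      unfolding assoc_mult_mat[OF Ya mat_repD(1)[OF h u] X(1)] X(3)[OF u] ..
    also have "\<dots> = mat_adjoint Y * X * (u ! j)"
      by (rule assoc_mult_mat[OF Ya X(1) mat_sum_nth[OF u j], symmetric])
    finally show ?thesis unfolding YX left_mult_zero_mat[OF mat_sum_nth[OF u j]] .
  qed
  have XhX: "mat_adjoint X * h u * X = u ! j" if u: "u \<in> mat_sum ns" for u
  proof -
    have "mat_adjoint X * h u * X = mat_adjoint X * (X * (u ! j))"
      unfolding assoc_mult_mat[OF Xa mat_repD(1)[OF h u] X(1)] X(3)[OF u] ..
    also have "\<dots> = mat_adjoint X * X * (u ! j)"
      by (rule assoc_mult_mat[OF Xa X(1) mat_sum_nth[OF u j], symmetric])
    finally show ?thesis unfolding X(2) left_mult_one_mat[OF mat_sum_nth[OF u j]] .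
  qed
  \<comment> \<open>This off-diagonal block is the adjoint of the one in \<open>YhX\<close>, taken
    at the adjoint of \<open>u\<close>.\<close>
  have XhY: "mat_adjoint X * h u * Y = 0\<^sub>m ?n r" if u: "u \<in> mat_sum ns" for u
  proof -
    let ?u = "map mat_adjoint u"
    note ua = mat_sum_adjoint[OF u]
    have hu: "h ?u = mat_adjoint (h u)" by (rule mat_repD(3)[OF h u])
    have "mat_adjoint (mat_adjoint Y * h ?u * X) = mat_adjoint X * (h u * Y)"
      using mat_adjoint_mult[OF mult_carrier_mat[OF Ya mat_repD(1)[OF h ua]] X(1)]
        mat_adjoint_mult[OF Ya mat_repD(1)[OF h ua]] by (simp add: hu)
    then show ?thesis
      unfolding YhX[OF ua] assoc_mult_mat[OF Xa mat_repD(1)[OF h u] Y(1)] by simp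
  qed
  have "mat_rep ns r (\<lambda>u. mat_adjoint Y * h u * Y)"
    unfolding mat_rep_def
  proof (intro conjI ballI allI)
    fix u assume u: "u \<in> mat_sum ns"
    note hu = mat_repD(1)[OF h u]
    note Yh = mult_carrier_mat[OF Ya hu]
    show "mat_adjoint Y * h u * Y \<in> carrier_mat r r"
      by (rule mult_carrier_mat[OF Yh Y(1)])
    show "mat_adjoint Y * h (map ((\<cdot>\<^sub>m) c) u) * Y = c \<cdot>\<^sub>m (mat_adjoint Y * h u * Y)" for c
      unfolding mat_repD(2)[OF h u] mult_smult_distrib[OF Ya hu] mult_smult_assoc_mat[OF Yh Y(1)] ..
    show "mat_adjoint Y * h (map mat_adjoint u) * Y = mat_adjoint (mat_adjoint Y * h u * Y)"
      unfolding mat_repD(3)[OF h u] mat_adjoint_mult[OF Yh Y(1)] mat_adjoint_mult[OF Ya hu] mat_adjoint_adjoint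
      by (rule assoc_mult_mat[OF Ya mat_adjoint_carrier[OF hu] Y(1)])
    fix v assume v: "v \<in> mat_sum ns"
    note hv = mat_repD(1)[OF h v]
    note Yhv = mult_carrier_mat[OF Ya hv]
    show "mat_adjoint Y * h (map2 (+) u v) * Y = mat_adjoint Y * h u * Y + mat_adjoint Y * h v * Y"
      unfolding mat_repD(4)[OF h u v] mult_add_distrib_mat[OF Ya hu hv] add_mult_distrib_mat[OF Yh Yhv Y(1)] ..
    \<comment> \<open>By \<open>YhX\<close> the part of \<open>h u\<close> leading from the range of
      \<open>P\<close> to the complement vanishes, so \<open>Q = Y * mat_adjoint Y\<close> can be
      inserted between two factors; this makes the compression multiplicative.\<close>
    have "mat_adjoint Y * h u * P = 0\<^sub>m r m"
      unfolding P_def assoc_mult_mat[OF Yh X(1) Xa, symmetric] YhX[OF u] by (rule left_mult_zero_mat[OF Xa])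
    then have "mat_adjoint Y * h u * Q = mat_adjoint Y * h u - 0\<^sub>m r m"
      unfolding Q_def mult_minus_distrib_mat[OF Yh one_carrier_mat P] right_mult_one_mat[OF Yh] by simp
    also have "\<dots> = mat_adjoint Y * h u"
      using carrier_matD[OF Yh] by (intro eq_matI) (simp_all del: index_mult_mat)
    finally have YhQ: "mat_adjoint Y * h u * Q = mat_adjoint Y * h u" .
    have "mat_adjoint Y * h (map2 (*) u v) * Y = (mat_adjoint Y * h u) * h v * Y"
      unfolding mat_repD(5)[OF h u v] assoc_mult_mat[OF Ya hu hv] ..
    also have "\<dots> = mat_adjoint Y * h u * Q * h v * Y" unfolding YhQ ..
    also have "mat_adjoint Y * h u * Q = mat_adjoint Y * h u * Y * mat_adjoint Y"
      unfolding Y(2)[symmetric] by (rule assoc_mult_mat[OF Yh Y(1) Ya, symmetric])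
    also have "\<dots> * h v * Y = mat_adjoint Y * h u * Y * mat_adjoint Y * (h v * Y)"
      by (rule assoc_mult_mat[OF mult_carrier_mat[OF mult_carrier_mat[OF Yh Y(1)] Ya] hv Y(1)])
    also have "\<dots> = mat_adjoint Y * h u * Y * (mat_adjoint Y * (h v * Y))"
      by (rule assoc_mult_mat[OF mult_carrier_mat[OF Yh Y(1)] Ya mult_carrier_mat[OF hv Y(1)]])
    also have "mat_adjoint Y * (h v * Y) = mat_adjoint Y * h v * Y"
      by (rule assoc_mult_mat[OF Ya hv Y(1), symmetric])
    finally show "mat_adjoint Y * h (map2 (*) u v) * Y = mat_adjoint Y * h u * Y * (mat_adjoint Y * h v * Y)" .
  qed
  with that[OF m Y(1) _ Y(3) XhX XhY YhX] show thesis
    using PQ by (simp add: Y(2) P_def)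
qed

section \<open>Block sums and the normal form\<close>

text \<open>The normal form by which multiplicity matrices are defined, started at summand
  \<open>j0\<close>. The start index serves the induction; \<open>j0 = 0\<close> gives the full
  form.\<close>

definition block_sum ::
  "nat list \<Rightarrow> (nat \<Rightarrow> nat) \<Rightarrow> nat \<Rightarrow> nat \<Rightarrow> complex mat list \<Rightarrow> complex mat" where
  "block_sum ns r j0 s u =
     diag_block_mat (concat (map (\<lambda>j. replicate (r j) (u ! j)) [j0..<length ns]) @ [0\<^sub>m s s])"

lemma block_sum_end: "block_sum ns r (length ns) s u = 0\<^sub>m s s"
  by (simp add: block_sum_def)

lemma block_sum_skip:
  assumes "j0 < length ns"
  shows "block_sum ns (r(j0 := 0)) j0 s u = block_sum ns r (Suc j0) s u"
  unfolding block_sum_def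
  by (subst upt_conv_Cons[OF assms]) (auto intro!: arg_cong[where f=diag_block_mat] arg_cong[where f=concat])

lemma block_sum_Suc:
  assumes "j0 < length ns" "u ! j0 \<in> carrier_mat n n" "block_sum ns r j0 s u \<in> carrier_mat m m"
  shows "block_sum ns (r(j0 := Suc (r j0))) j0 s u =
    four_block_mat (u ! j0) (0\<^sub>m n m) (0\<^sub>m m n) (block_sum ns r j0 s u)"
proof -
  have "concat (map (\<lambda>j. replicate ((r(j0 := Suc (r j0))) j) (u ! j)) [j0..<length ns]) =
      u ! j0 # concat (map (\<lambda>j. replicate (r j) (u ! j)) [j0..<length ns])"
    unfolding upt_conv_Cons[OF assms(1)] by (auto intro!: arg_cong[where f=concat])
  then show ?thesis using assms(2,3) by (simp add: block_sum_def Let_def)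
qed

text \<open>If the first minimal projection of summand \<open>j0\<close> acts as zero, the search
  passes to the next summand; otherwise one copy of the summand is split off and the search stays at
  \<open>j0\<close> on the complement. Positive sizes make the complement smaller.\<close>

lemma mat_rep_normal_form:
  assumes "mat_rep ns m h" "\<forall>n\<in>set ns. 1 \<le> n" "j0 \<le> length ns"
    "\<forall>j<j0. h (munit ns j 0 0 1) = 0\<^sub>m m m"
  shows "\<exists>r s v. unitary_mat m v \<and>
    (\<forall>u\<in>mat_sum ns. v * h u * mat_adjoint v = block_sum ns r j0 s u)"
  using assms
\<comment> \<open>Either move lowers this sum: one consumes a summand, the other consumes
  dimension.\<close>
proof (induction "m + (length ns - j0)" arbitrary: m h j0 rule: less_induct)
  case less
  note h = less.prems(1)
  show ?case
  proof (cases "j0 = length ns")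
    case True
    have "h u = 0\<^sub>m m m" if "u \<in> mat_sum ns" for u
      using mat_rep_eq_0[OF h that] less.prems(4) True by auto
    then have "\<forall>u\<in>mat_sum ns. 1\<^sub>m m * h u * mat_adjoint (1\<^sub>m m) = block_sum ns (\<lambda>_. 0) j0 m u"
      unfolding True block_sum_end by simp
    moreover have "unitary_mat m (1\<^sub>m m)" by (simp add: unitary_mat_def)
    ultimately show ?thesis by blast
  next
    case False
    then have j0: "j0 < length ns" using less.prems(3) by simp
    show ?thesis
    proof (cases "h (munit ns j0 0 0 1) = 0\<^sub>m m m")
      case True
      then have "\<forall>j<Suc j0. h (munit ns j 0 0 1) = 0\<^sub>m m m"
        using less.prems(4) by (auto simp: less_Suc_eq)
      then obtain r s v where "unitary_mat m v"
        "\<forall>u\<in>mat_sum ns. v * h u * mat_adjoint v = block_sum ns r (Suc j0) s u"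
        using less.hyps[OF _ h less.prems(2), of "Suc j0"] j0 by fastforce
      then have "unitary_mat m v \<and>
          (\<forall>u\<in>mat_sum ns. v * h u * mat_adjoint v = block_sum ns (r(j0 := 0)) j0 s u)"
        using block_sum_skip[OF j0] by simp
      then show ?thesis by blast
    next
      case nz: False
      let ?n = "ns ! j0"
      have n: "1 \<le> ?n" using less.prems(2) j0 by simp
      obtain X where X: "X \<in> carrier_mat m ?n" "mat_adjoint X * X = 1\<^sub>m ?n"
          "\<And>u. u \<in> mat_sum ns \<Longrightarrow> h u * X = X * (u ! j0)"
        using mat_rep_isometry[OF h j0 n nz] by blast
      obtain m' Y where m: "m = ?n + m'" and Y: "Y \<in> carrier_mat m m'"
          "X * mat_adjoint X + Y * mat_adjoint Y = 1\<^sub>m m" "mat_adjoint Y * Y = 1\<^sub>m m'"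
        and XhX: "\<And>u. u \<in> mat_sum ns \<Longrightarrow> mat_adjoint X * h u * X = u ! j0"
        and XhY: "\<And>u. u \<in> mat_sum ns \<Longrightarrow> mat_adjoint X * h u * Y = 0\<^sub>m ?n m'"
        and YhX: "\<And>u. u \<in> mat_sum ns \<Longrightarrow> mat_adjoint Y * h u * X = 0\<^sub>m m' ?n"
        and rep: "mat_rep ns m' (\<lambda>u. mat_adjoint Y * h u * Y)"
        using mat_rep_compress[OF h j0 X] by blast
      note Xa = mat_adjoint_carrier[OF X(1)] and Ya = mat_adjoint_carrier[OF Y(1)]
      have "\<forall>j<j0. mat_adjoint Y * h (munit ns j 0 0 1) * Y = 0\<^sub>m m' m'"
        using less.prems(4) right_mult_zero_mat[OF Ya, of m] left_mult_zero_mat[OF Y(1), of m'] by auto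
      moreover have "m' + (length ns - j0) < m + (length ns - j0)" using m n by simp
      ultimately obtain r s v where v: "unitary_mat m' v"
        and vh: "\<And>u. u \<in> mat_sum ns \<Longrightarrow> v * (mat_adjoint Y * h u * Y) * mat_adjoint v = block_sum ns r j0 s u"
        using less.hyps[OF _ rep less.prems(2,3)] by blast
      have vc: "v \<in> carrier_mat m' m'" "mat_adjoint v * v = 1\<^sub>m m'" using v by (auto simp: unitary_mat_def)
      note va = mat_adjoint_carrier[OF vc(1)]
      \<comment> \<open>The unitary that brings the complement to normal form is absorbed into its
        basis, so that \<open>hcat X Z\<close> treats both parts at once.\<close>
      define Z where "Z = Y * mat_adjoint v"
      have Z: "Z \<in> carrier_mat m m'" unfolding Z_def by (rule mult_carrier_mat[OF Y(1) va])
      have Za: "mat_adjoint Z = v * mat_adjoint Y"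
        unfolding Z_def mat_adjoint_mult[OF Y(1) va] by simp
      have ZZ: "Z * mat_adjoint Z = Y * mat_adjoint Y"
      proof -
        have "Z * mat_adjoint Z = Y * (mat_adjoint v * (v * mat_adjoint Y))"
          unfolding Za unfolding Z_def by (rule assoc_mult_mat[OF Y(1) va mult_carrier_mat[OF vc(1) Ya]])
        also have "mat_adjoint v * (v * mat_adjoint Y) = mat_adjoint v * v * mat_adjoint Y"
          by (rule assoc_mult_mat[OF va vc(1) Ya, symmetric])
        finally show ?thesis unfolding vc(2) left_mult_one_mat[OF Ya] .
      qed
      define W where "W = hcat X Z"
      have W: "W \<in> carrier_mat m m" unfolding W_def using hcat_carrier[OF X(1) Z] m by simp
      have WW: "W * mat_adjoint W = 1\<^sub>m m"
        unfolding W_def hcat_outer[OF X(1) Z] ZZ Y(2) ..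
      \<comment> \<open>\<open>W\<close> is square, so the one-sided identity \<open>WW\<close>
        already makes it unitary.\<close>
      have unitary: "unitary_mat m (mat_adjoint W)"
        unfolding unitary_mat_def using W WW mat_mult_left_right_inverse[OF W mat_adjoint_carrier[OF W] WW] by simp
      have "mat_adjoint W * h u * mat_adjoint (mat_adjoint W) = block_sum ns (r(j0 := Suc (r j0))) j0 s u"
        if u: "u \<in> mat_sum ns" for u
      proof -
        note hu = mat_repD(1)[OF h u]
        note YhY = mult_carrier_mat[OF mult_carrier_mat[OF Ya hu] Y(1)]
        have 1: "mat_adjoint X * h u * Z = 0\<^sub>m ?n m'"
          unfolding Z_def assoc_mult_mat[OF mult_carrier_mat[OF Xa hu] Y(1) va, symmetric] XhY[OF u]
          by (rule left_mult_zero_mat[OF va])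
        have 2: "mat_adjoint Z * h u * X = 0\<^sub>m m' ?n"
          unfolding Za assoc_mult_mat[OF vc(1) Ya hu]
            assoc_mult_mat[OF vc(1) mult_carrier_mat[OF Ya hu] X(1)] YhX[OF u]
          by (rule right_mult_zero_mat[OF vc(1)])
        have 3: "mat_adjoint Z * h u * Z = block_sum ns r j0 s u"
          unfolding Za vh[OF u, symmetric] unfolding Z_def assoc_mult_mat[OF vc(1) Ya hu]
            assoc_mult_mat[OF mult_carrier_mat[OF vc(1) mult_carrier_mat[OF Ya hu]] Y(1) va, symmetric]
            assoc_mult_mat[OF vc(1) mult_carrier_mat[OF Ya hu] Y(1)] ..
        have bs: "block_sum ns r j0 s u \<in> carrier_mat m' m'"
          unfolding vh[OF u, symmetric] by (rule mult_carrier_mat[OF mult_carrier_mat[OF vc(1) YhY] va])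
        show ?thesis
          unfolding mat_adjoint_adjoint unfolding W_def hcat_gram[OF X(1) Z hu] 1 2 3 XhX[OF u]
          by (rule block_sum_Suc[OF j0 mat_sum_nth[OF u j0] bs, symmetric])
      qed
      then show ?thesis using unitary by blast
    qed
  qed
qed

lemma mat_rep_diag_cons:
  assumes h: "mat_rep ns m h" and j: "j < length ns"
  shows "mat_rep ns (ns ! j + m) (\<lambda>u. four_block_mat (u ! j) (0\<^sub>m (ns ! j) m) (0\<^sub>m m (ns ! j)) (h u))"
  unfolding mat_rep_def
proof (intro conjI ballI allI)
  let ?n = "ns ! j"
  fix u assume u: "u \<in> mat_sum ns"
  note uj = mat_sum_nth[OF u j] and hu = mat_repD(1)[OF h u] and lu = mat_sum_length[OF u]
  show "four_block_mat (u ! j) (0\<^sub>m ?n m) (0\<^sub>m m ?n) (h u) \<in> carrier_mat (?n + m) (?n + m)"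
    using uj hu by simp
  show "four_block_mat (map ((\<cdot>\<^sub>m) c) u ! j) (0\<^sub>m ?n m) (0\<^sub>m m ?n) (h (map ((\<cdot>\<^sub>m) c) u)) =
      c \<cdot>\<^sub>m four_block_mat (u ! j) (0\<^sub>m ?n m) (0\<^sub>m m ?n) (h u)" for c
    unfolding mat_repD(2)[OF h u] smult_four_block_mat[OF uj zero_carrier_mat zero_carrier_mat hu]
    using j lu by (intro cong_four_block_mat) auto
  show "four_block_mat (map mat_adjoint u ! j) (0\<^sub>m ?n m) (0\<^sub>m m ?n) (h (map mat_adjoint u)) =
      mat_adjoint (four_block_mat (u ! j) (0\<^sub>m ?n m) (0\<^sub>m m ?n) (h u))"
    unfolding mat_repD(3)[OF h u] using j lu carrier_matD[OF uj] carrier_matD[OF hu] by (intro eq_matI) auto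
  fix v assume v: "v \<in> mat_sum ns"
  note vj = mat_sum_nth[OF v j] and hv = mat_repD(1)[OF h v] and lv = mat_sum_length[OF v]
  show "four_block_mat (map2 (+) u v ! j) (0\<^sub>m ?n m) (0\<^sub>m m ?n) (h (map2 (+) u v)) =
      four_block_mat (u ! j) (0\<^sub>m ?n m) (0\<^sub>m m ?n) (h u) + four_block_mat (v ! j) (0\<^sub>m ?n m) (0\<^sub>m m ?n) (h v)"
    unfolding mat_repD(4)[OF h u v]
      add_four_block_mat[OF uj zero_carrier_mat zero_carrier_mat hu vj zero_carrier_mat zero_carrier_mat hv]
    using j lu lv by (intro cong_four_block_mat) auto
  show "four_block_mat (map2 (*) u v ! j) (0\<^sub>m ?n m) (0\<^sub>m m ?n) (h (map2 (*) u v)) =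
      four_block_mat (u ! j) (0\<^sub>m ?n m) (0\<^sub>m m ?n) (h u) * four_block_mat (v ! j) (0\<^sub>m ?n m) (0\<^sub>m m ?n) (h v)"
    unfolding mat_repD(5)[OF h u v]
      mult_four_block_mat[OF uj zero_carrier_mat zero_carrier_mat hu vj zero_carrier_mat zero_carrier_mat hv]
    using j lu lv right_add_zero_mat[OF mult_carrier_mat[OF uj vj]] left_add_zero_mat[OF mult_carrier_mat[OF hu hv]]
      carrier_matD[OF uj] carrier_matD[OF vj] carrier_matD[OF hu] carrier_matD[OF hv]
    by (intro cong_four_block_mat) auto
qed

lemma mat_rep_cong:
  assumes "\<And>u. u \<in> mat_sum ns \<Longrightarrow> h u = h' u"
  shows "mat_rep ns m h \<longleftrightarrow> mat_rep ns m h'"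
  using assms mat_sum_closed unfolding mat_rep_def by (simp cong: ball_cong)

lemma mat_rep_diag_block:
  assumes "\<forall>j\<in>set js. j < length ns"
  shows "mat_rep ns (sum_list (map ((!) ns) js) + s) (\<lambda>u. diag_block_mat (map ((!) u) js @ [0\<^sub>m s s]))"
  using assms
proof (induction js)
  case Nil
  show ?case by (simp add: mat_rep_def) 
next
  case (Cons j js)
  let ?m = "sum_list (map ((!) ns) js) + s"
  let ?h = "\<lambda>u. diag_block_mat (map ((!) u) js @ [0\<^sub>m s s])"
  have j: "j < length ns" and h: "mat_rep ns ?m ?h" using Cons by auto
  have "diag_block_mat (map ((!) u) (j # js) @ [0\<^sub>m s s]) =
      four_block_mat (u ! j) (0\<^sub>m (ns ! j) ?m) (0\<^sub>m ?m (ns ! j)) (?h u)" if u: "u \<in> mat_sum ns" for u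
    using carrier_matD[OF mat_sum_nth[OF u j]] carrier_matD[OF mat_repD(1)[OF h u]] by (simp add: Let_def)
  from mat_rep_cong[OF this] mat_rep_diag_cons[OF h j] show ?case by (simp add: add.assoc)
qed

lemma sum_list_blocks:
  fixes f :: "'b \<Rightarrow> 'c::semiring_1"
  shows "sum_list (map f (concat (map (\<lambda>j. replicate (r j) (g j)) xs))) =
    sum_list (map (\<lambda>j. of_nat (r j) * f (g j)) xs)"
  by (induction xs) (auto simp: sum_list_replicate)

lemma mat_rep_block_sum:
  "mat_rep ns ((\<Sum>j<length ns. r j * ns ! j) + s) (block_sum ns r 0 s)"
proof -
  \<comment> \<open>The blocks are listed by their summand indices, with repetition, to match
    \<open>mat_rep_diag_block\<close>.\<close>
  let ?js = "concat (map (\<lambda>j. replicate (r j) j) [0..<length ns])"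
  have 1: "block_sum ns r 0 s = (\<lambda>u. diag_block_mat (map ((!) u) ?js @ [0\<^sub>m s s]))"
    by (rule ext) (simp add: block_sum_def map_concat comp_def)
  have 2: "sum_list (map ((!) ns) ?js) = (\<Sum>j<length ns. r j * ns ! j)"
    by (simp add: sum_list_blocks interv_sum_list_conv_sum_set_nat lessThan_atLeast0)
  have "\<forall>j\<in>set ?js. j < length ns" by auto
  from mat_rep_diag_block[OF this, of s] show ?thesis unfolding 1 2 .
qed

lemma mtrace_block_sum:
  assumes "u \<in> mat_sum ns"
  shows "mtrace (block_sum ns r 0 s u) = (\<Sum>j<length ns. of_nat (r j) * mtrace (u ! j))"
proof -
  let ?As = "concat (map (\<lambda>j. replicate (r j) (u ! j)) [0..<length ns]) @ [0\<^sub>m s s]"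
  have "square_mat A" if A: "A \<in> set ?As" for A
  proof -
    have "A = 0\<^sub>m s s \<or> (\<exists>j<length ns. A \<in> set (replicate (r j) (u ! j)))"
      using A by (simp only: set_append set_concat set_map set_upt list.set Un_iff UN_iff image_iff) fastforce
    then consider "A = 0\<^sub>m s s" | j where "j < length ns" "A = u ! j" by (metis in_set_replicate)
    then show ?thesis
    proof cases
      case 2
      then show ?thesis using carrier_matD[OF mat_sum_nth[OF assms 2(1)]] by simp
    qed simp
  qed
  then have "mtrace (block_sum ns r 0 s u) = sum_list (map mtrace ?As)"
    unfolding block_sum_def by (intro mtrace_diag_block_mat) blast
  then show ?thesis
    by (simp add: sum_list_blocks interv_sum_list_conv_sum_set_nat lessThan_atLeast0)
qed

lemma mtrace_munit:
  assumes "i < length ns" "a < ns ! j"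
  shows "mtrace (munit ns j a a 1 ! i) = (if i = j then 1 else 0)"
proof -
  have "mtrace (munit ns j a a 1 ! i) = (\<Sum>x<ns ! i. if x = a then if i = j then 1 else 0 else 0)"
    using assms by (auto simp: mtrace_def nth_munit intro!: sum.cong)
  then show ?thesis using assms by (auto simp: sum.delta)
qed

section \<open>Multiplicity matrices\<close>

text \<open>Phrased through components, because multiplicities are found one summand of the codomain
  at a time.\<close>

definition mat_sum_hom :: "nat list \<Rightarrow> nat list \<Rightarrow> (complex mat list \<Rightarrow> complex mat list) \<Rightarrow> bool" where
  "mat_sum_hom ns ms \<phi> \<longleftrightarrow> (\<forall>u\<in>mat_sum ns. \<phi> u \<in> mat_sum ms) \<and>
     (\<forall>i<length ms. mat_rep ns (ms ! i) (\<lambda>u. \<phi> u ! i))"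

lemma mat_sum_homI:
  assumes "\<And>u. u \<in> mat_sum ns \<Longrightarrow> \<phi> u \<in> mat_sum ms"
    and "\<And>u v. u \<in> mat_sum ns \<Longrightarrow> v \<in> mat_sum ns \<Longrightarrow> \<phi> (map2 (+) u v) = map2 (+) (\<phi> u) (\<phi> v)"
    and "\<And>c u. u \<in> mat_sum ns \<Longrightarrow> \<phi> (map (\<lambda>M. c \<cdot>\<^sub>m M) u) = map (\<lambda>M. c \<cdot>\<^sub>m M) (\<phi> u)"
    and "\<And>u v. u \<in> mat_sum ns \<Longrightarrow> v \<in> mat_sum ns \<Longrightarrow> \<phi> (map2 (*) u v) = map2 (*) (\<phi> u) (\<phi> v)"
    and "\<And>u. u \<in> mat_sum ns \<Longrightarrow> \<phi> (map mat_adjoint u) = map mat_adjoint (\<phi> u)"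
  shows "mat_sum_hom ns ms \<phi>"
  using assms mat_sum_length[OF assms(1)] mat_sum_nth[OF assms(1)]
  by (simp add: mat_sum_hom_def mat_rep_def)

lemma mat_sum_homD:
  assumes "mat_sum_hom ns ms \<phi>" "u \<in> mat_sum ns"
  shows "\<phi> u \<in> mat_sum ms"
    and "\<phi> (map (\<lambda>M. c \<cdot>\<^sub>m M) u) = map (\<lambda>M. c \<cdot>\<^sub>m M) (\<phi> u)"
    and "\<phi> (map mat_adjoint u) = map mat_adjoint (\<phi> u)"
    and "v \<in> mat_sum ns \<Longrightarrow> \<phi> (map2 (+) u v) = map2 (+) (\<phi> u) (\<phi> v)"
    and "v \<in> mat_sum ns \<Longrightarrow> \<phi> (map2 (*) u v) = map2 (*) (\<phi> u) (\<phi> v)"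
proof -
  have closed: "\<phi> w \<in> mat_sum ms" if "w \<in> mat_sum ns" for w
    using assms(1) that by (simp add: mat_sum_hom_def)
  have rep: "mat_rep ns (ms ! i) (\<lambda>u. \<phi> u ! i)" if "i < length ms" for i
    using assms(1) that by (simp add: mat_sum_hom_def)
  note len = mat_sum_length[OF closed]
  show "\<phi> u \<in> mat_sum ms" by (rule closed[OF assms(2)])
  show "\<phi> (map (\<lambda>M. c \<cdot>\<^sub>m M) u) = map (\<lambda>M. c \<cdot>\<^sub>m M) (\<phi> u)"
    using mat_repD(2)[OF rep assms(2)] assms(2)
    by (intro mat_sum_eqI[of _ ms] closed mat_sum_smult) (auto simp: len)
  show "\<phi> (map mat_adjoint u) = map mat_adjoint (\<phi> u)"
    using mat_repD(3)[OF rep assms(2)] assms(2)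
    by (intro mat_sum_eqI[of _ ms] closed mat_sum_adjoint) (auto simp: len)
  assume v: "v \<in> mat_sum ns"
  show "\<phi> (map2 (+) u v) = map2 (+) (\<phi> u) (\<phi> v)"
    using mat_repD(4)[OF rep assms(2) v] assms(2) v
    by (intro mat_sum_eqI[of _ ms] closed mat_sum_add) (auto simp: len)
  show "\<phi> (map2 (*) u v) = map2 (*) (\<phi> u) (\<phi> v)"
    using mat_repD(5)[OF rep assms(2) v] assms(2) v
    by (intro mat_sum_eqI[of _ ms] closed mat_sum_mult) (auto simp: len)
qed

lemma mat_sum_hom_comp:
  assumes "mat_sum_hom ns ms \<phi>" "mat_sum_hom ms ls \<psi>"
  shows "mat_sum_hom ns ls (\<psi> \<circ> \<phi>)"
  using mat_sum_homD[OF assms(1)] mat_sum_homD[OF assms(2)] by (intro mat_sum_homI) simp_all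

lemma has_mult_matrix_block_sum:
  "has_mult_matrix ns ms \<phi> R \<longleftrightarrow> R \<in> carrier_mat (length ms) (length ns) \<and>
     (\<exists>v. length v = length ms \<and> (\<forall>i<length ms. unitary_mat (ms ! i) (v ! i)) \<and>
       (\<forall>i<length ms. \<exists>s. \<forall>u\<in>mat_sum ns.
          v ! i * (\<phi> u ! i) * mat_adjoint (v ! i) = block_sum ns (\<lambda>j. R $$ (i, j)) 0 s u))"
  by (simp add: has_mult_matrix_def block_sum_def)

lemma has_mult_matrix_exists:
  assumes \<phi>: "mat_sum_hom ns ms \<phi>" and ns: "\<forall>n\<in>set ns. 1 \<le> n"
  shows "\<exists>R. has_mult_matrix ns ms \<phi> R"
proof -
  have "\<forall>i<length ms. \<exists>r v. unitary_mat (ms ! i) v \<and>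
      (\<exists>s. \<forall>u\<in>mat_sum ns. v * (\<phi> u ! i) * mat_adjoint v = block_sum ns r 0 s u)"
    using mat_rep_normal_form[OF _ ns, of "ms ! i" "\<lambda>u. \<phi> u ! i" 0 for i] \<phi>
    by (simp add: mat_sum_hom_def) blast
  then obtain r v where rv: "\<And>i. i < length ms \<Longrightarrow> unitary_mat (ms ! i) (v i) \<and>
      (\<exists>s. \<forall>u\<in>mat_sum ns. v i * (\<phi> u ! i) * mat_adjoint (v i) = block_sum ns (r i) 0 s u)"
    by metis
  have "block_sum ns (\<lambda>j. mat (length ms) (length ns) (\<lambda>(i, j). r i j) $$ (i, j)) 0 s u = block_sum ns (r i) 0 s u"
    if "i < length ms" for i s u
    using that unfolding block_sum_def by (intro arg_cong[where f="\<lambda>x. diag_block_mat (concat x @ _)"] map_cong) auto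
  then have "has_mult_matrix ns ms \<phi> (mat (length ms) (length ns) (\<lambda>(i, j). r i j))"
    unfolding has_mult_matrix_block_sum using rv
    by (intro conjI mat_carrier exI[of _ "map v [0..<length ms]"]) auto
  then show ?thesis by blast
qed

text \<open>Neither the conjugation nor the zero block is visible to the trace. At minimal
  projections the formula determines the entries of \<open>R\<close>; at general \<open>u\<close> it
  yields the composition rule.\<close>

lemma has_mult_matrix_mtrace:
  assumes \<phi>: "mat_sum_hom ns ms \<phi>" and R: "has_mult_matrix ns ms \<phi> R"
    and u: "u \<in> mat_sum ns" and i: "i < length ms"
  shows "mtrace (\<phi> u ! i) = (\<Sum>j<length ns. of_nat (R $$ (i, j)) * mtrace (u ! j))"
proof -
  obtain v s where v: "unitary_mat (ms ! i) v"
    "\<forall>u\<in>mat_sum ns. v * (\<phi> u ! i) * mat_adjoint v = block_sum ns (\<lambda>j. R $$ (i, j)) 0 s u"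
    using R i unfolding has_mult_matrix_block_sum by blast
  have "mtrace (\<phi> u ! i) = mtrace (v * (\<phi> u ! i) * mat_adjoint v)"
    by (rule mtrace_conj_unitary[OF v(1) mat_sum_nth[OF mat_sum_homD(1)[OF \<phi> u] i], symmetric])
  then show ?thesis using v(2) u mtrace_block_sum[OF u] by simp
qed

lemma has_mult_matrix_entry:
  assumes \<phi>: "mat_sum_hom ns ms \<phi>" and R: "has_mult_matrix ns ms \<phi> R"
    and ns: "\<forall>n\<in>set ns. 1 \<le> n" and i: "i < length ms" and j: "j < length ns"
  shows "of_nat (R $$ (i, j)) = mtrace (\<phi> (munit ns j 0 0 1) ! i)"
proof -
  have "0 < ns ! j" using ns j nth_mem[OF j] by fastforce
  then have "mtrace (\<phi> (munit ns j 0 0 1) ! i) = (\<Sum>k<length ns. if k = j then of_nat (R $$ (i, k)) else 0)"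
    unfolding has_mult_matrix_mtrace[OF \<phi> R munit_mat_sum i]
    by (intro sum.cong) (auto simp: mtrace_munit)
  then show ?thesis using j by (simp add: sum.delta)
qed

lemma has_mult_matrix_unique:
  assumes \<phi>: "mat_sum_hom ns ms \<phi>" and ns: "\<forall>n\<in>set ns. 1 \<le> n"
    and R: "has_mult_matrix ns ms \<phi> R" and S: "has_mult_matrix ns ms \<phi> S"
  shows "R = S"
proof (rule eq_matI)
  show "R $$ (i, j) = S $$ (i, j)" if "i < dim_row S" "j < dim_col S" for i j
  proof -
    have "i < length ms" "j < length ns" using that S by (auto simp: has_mult_matrix_def)
    then have "of_nat (R $$ (i, j)) = (of_nat (S $$ (i, j)) :: complex)"
      using has_mult_matrix_entry[OF \<phi> R ns] has_mult_matrix_entry[OF \<phi> S ns] by simp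
    then show ?thesis by (simp only: of_nat_eq_iff)
  qed
qed (use R S in \<open>auto simp: has_mult_matrix_def\<close>)

lemma mult_matrix_of_eqI:
  assumes "mat_sum_hom ns ms \<phi>" "\<forall>n\<in>set ns. 1 \<le> n" "has_mult_matrix ns ms \<phi> R"
  shows "mult_matrix_of ns ms \<phi> = R"
  unfolding mult_matrix_of_def using assms(3) has_mult_matrix_unique[OF assms(1,2)] by blast

lemma has_mult_matrix_of:
  assumes "mat_sum_hom ns ms \<phi>" "\<forall>n\<in>set ns. 1 \<le> n"
  shows "has_mult_matrix ns ms \<phi> (mult_matrix_of ns ms \<phi>)"
  using has_mult_matrix_exists[OF assms] mult_matrix_of_eqI[OF assms] by auto

lemma mult_matrix_of_carrier:
  assumes "mat_sum_hom ns ms \<phi>" "\<forall>n\<in>set ns. 1 \<le> n"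
  shows "mult_matrix_of ns ms \<phi> \<in> carrier_mat (length ms) (length ns)"
  using has_mult_matrix_of[OF assms] by (simp add: has_mult_matrix_def)

text \<open>Since a normal form is known to exist, the matrix is recognized by traces alone and no
  unitary has to be exhibited.\<close>

lemma mult_matrix_of_eq_matI:
  assumes \<phi>: "mat_sum_hom ns ms \<phi>" and ns: "\<forall>n\<in>set ns. 1 \<le> n"
    and R: "R \<in> carrier_mat (length ms) (length ns)"
    and tr: "\<And>i j. i < length ms \<Longrightarrow> j < length ns \<Longrightarrow>
      mtrace (\<phi> (munit ns j 0 0 1) ! i) = of_nat (R $$ (i, j))"
  shows "mult_matrix_of ns ms \<phi> = R"
proof (rule eq_matI)
  show "mult_matrix_of ns ms \<phi> $$ (i, j) = R $$ (i, j)" if "i < dim_row R" "j < dim_col R" for i j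
  proof -
    have ij: "i < length ms" "j < length ns" using that R by auto
    then have "of_nat (mult_matrix_of ns ms \<phi> $$ (i, j)) = (of_nat (R $$ (i, j)) :: complex)"
      using has_mult_matrix_entry[OF \<phi> has_mult_matrix_of[OF \<phi> ns] ns ij] tr[OF ij] by simp
    then show ?thesis by (simp only: of_nat_eq_iff)
  qed
qed (use R mult_matrix_of_carrier[OF \<phi> ns] in auto)

lemma mult_matrix_of_comp:
  assumes \<phi>: "mat_sum_hom ns ms \<phi>" and \<psi>: "mat_sum_hom ms ls \<psi>"
    and ns: "\<forall>n\<in>set ns. 1 \<le> n" and ms: "\<forall>n\<in>set ms. 1 \<le> n"
  shows "mult_matrix_of ns ls (\<psi> \<circ> \<phi>) = mult_matrix_of ms ls \<psi> * mult_matrix_of ns ms \<phi>"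
proof (rule mult_matrix_of_eq_matI[OF mat_sum_hom_comp[OF \<phi> \<psi>] ns])
  let ?R = "mult_matrix_of ns ms \<phi>" and ?S = "mult_matrix_of ms ls \<psi>"
  note R = mult_matrix_of_carrier[OF \<phi> ns] and S = mult_matrix_of_carrier[OF \<psi> ms]
  show "?S * ?R \<in> carrier_mat (length ls) (length ns)" by (rule mult_carrier_mat[OF S R])
  fix i j assume ij: "i < length ls" "j < length ns"
  \<comment> \<open>The trace formula for \<open>\<psi>\<close> is applied to the image of a minimal
    projection, which need not be minimal itself.\<close>
  have "mtrace ((\<psi> \<circ> \<phi>) (munit ns j 0 0 1) ! i) =
      (\<Sum>k<length ms. of_nat (?S $$ (i, k)) * mtrace (\<phi> (munit ns j 0 0 1) ! k))"
    using has_mult_matrix_mtrace[OF \<psi> has_mult_matrix_of[OF \<psi> ms] mat_sum_homD(1)[OF \<phi> munit_mat_sum] ij(1)]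
    by simp
  also have "\<dots> = (\<Sum>k<length ms. of_nat (?S $$ (i, k) * ?R $$ (k, j)))"
    using has_mult_matrix_entry[OF \<phi> has_mult_matrix_of[OF \<phi> ns] ns _ ij(2)] by (intro sum.cong) auto
  also have "\<dots> = of_nat ((?S * ?R) $$ (i, j))"
    unfolding index_mult_mat_sum[OF S R ij] by simp
  finally show "mtrace ((\<psi> \<circ> \<phi>) (munit ns j 0 0 1) ! i) = of_nat ((?S * ?R) $$ (i, j))" .
qed

lemma mult_matrix_of_id:
  assumes "\<And>u. u \<in> mat_sum ns \<Longrightarrow> \<phi> u = u" "\<forall>n\<in>set ns. 1 \<le> n"
  shows "mult_matrix_of ns ns \<phi> = 1\<^sub>m (length ns)"
proof (rule mult_matrix_of_eq_matI)
  show "mat_sum_hom ns ns \<phi>" using assms(1) mat_sum_closed by (intro mat_sum_homI) auto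
  fix i j assume ij: "i < length ns" "j < length ns"
  then have "0 < ns ! j" using assms(2) nth_mem[OF ij(2)] by fastforce
  then show "mtrace (\<phi> (munit ns j 0 0 1) ! i) = of_nat (1\<^sub>m (length ns) $$ (i, j))"
    using ij by (simp add: assms(1) mtrace_munit)
qed (use assms in auto)

lemma block_sum_carrier:
  assumes "u \<in> mat_sum ns"
  shows "block_sum ns r 0 s u \<in> carrier_mat ((\<Sum>j<length ns. r j * ns ! j) + s) ((\<Sum>j<length ns. r j * ns ! j) + s)"
  by (rule mat_repD(1)[OF mat_rep_block_sum assms])

lemma mult_vec_of_list_nth:
  assumes "R \<in> carrier_mat k (length ns)" "i < k"
  shows "(R *\<^sub>v vec_of_list ns) $ i = (\<Sum>j<length ns. R $$ (i, j) * ns ! j)"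
  using assms by (auto simp: scalar_prod_def vec_of_list_index lessThan_atLeast0 intro!: sum.cong)

text \<open>Comparing sizes determines the zero block from the multiplicities. Both the inequality
  required of a multiplicity matrix and the agreement of two normal forms with the same row follow
  from this.\<close>

lemma has_mult_matrix_dims:
  assumes \<phi>: "mat_sum_hom ns ms \<phi>" and i: "i < length ms" and v: "unitary_mat (ms ! i) v"
    and "\<forall>u\<in>mat_sum ns. v * (\<phi> u ! i) * mat_adjoint v = block_sum ns r 0 s u"
  shows "(\<Sum>j<length ns. r j * ns ! j) + s = ms ! i"
proof -
  \<comment> \<open>The zero element; any element would serve, as only sizes are compared.\<close>
  let ?u = "munit ns 0 0 0 0"
  have vc: "v \<in> carrier_mat (ms ! i) (ms ! i)" using v by (simp add: unitary_mat_def)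
  have "v * (\<phi> ?u ! i) * mat_adjoint v \<in> carrier_mat (ms ! i) (ms ! i)"
    by (rule mult_carrier_mat[OF mult_carrier_mat[OF vc mat_sum_nth[OF mat_sum_homD(1)[OF \<phi> munit_mat_sum] i]]
          mat_adjoint_carrier[OF vc]])
  then have "block_sum ns r 0 s ?u \<in> carrier_mat (ms ! i) (ms ! i)" using assms(4) by simp
  with block_sum_carrier[OF munit_mat_sum, of ns r s 0 0 0 0] show ?thesis
    by (simp only: carrier_mat_def mem_Collect_eq)
qed

lemma mult_matrix_of_multiplicity:
  assumes \<phi>: "mat_sum_hom ns ms \<phi>" and ns: "\<forall>n\<in>set ns. 1 \<le> n"
  shows "multiplicity_matrix (vec_of_list ns) (vec_of_list ms) (mult_matrix_of ns ms \<phi>)"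
proof -
  let ?R = "mult_matrix_of ns ms \<phi>"
  note R = mult_matrix_of_carrier[OF \<phi> ns]
  have "(?R *\<^sub>v vec_of_list ns) $ i \<le> vec_of_list ms $ i" if i: "i < length ms" for i
  proof -
    obtain v s where "unitary_mat (ms ! i) v"
      "\<forall>u\<in>mat_sum ns. v * (\<phi> u ! i) * mat_adjoint v = block_sum ns (\<lambda>j. ?R $$ (i, j)) 0 s u"
      using has_mult_matrix_of[OF \<phi> ns] i unfolding has_mult_matrix_block_sum by blast
    from has_mult_matrix_dims[OF \<phi> i this] show ?thesis
      unfolding mult_vec_of_list_nth[OF R i] by (simp add: vec_of_list_index)
  qed
  then show ?thesis using R by (auto simp: multiplicity_matrix_def less_eq_vec_def)
qed

lemma mat_sum_hom_with_mult_matrix: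
  assumes R: "multiplicity_matrix (vec_of_list ns) (vec_of_list ms) R" and ns: "\<forall>n\<in>set ns. 1 \<le> n"
  obtains \<phi> where "mat_sum_hom ns ms \<phi>" "mult_matrix_of ns ms \<phi> = R"
proof -
  have Rc: "R \<in> carrier_mat (length ms) (length ns)" using R by (simp add: multiplicity_matrix_def)
  let ?t = "\<lambda>i. \<Sum>j<length ns. R $$ (i, j) * ns ! j"
  \<comment> \<open>The truncated difference is exact, because \<open>R\<close> applied to the sizes
    \<open>ns\<close> is bounded by \<open>ms\<close>.\<close>
  define \<phi> where "\<phi> u = map (\<lambda>i. block_sum ns (\<lambda>j. R $$ (i, j)) 0 (ms ! i - ?t i) u) [0..<length ms]" for u
  have t: "?t i + (ms ! i - ?t i) = ms ! i" if i: "i < length ms" for i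
    using R i mult_vec_of_list_nth[OF Rc i] by (auto simp: multiplicity_matrix_def less_eq_vec_def vec_of_list_index)
  have rep: "mat_rep ns (ms ! i) (\<lambda>u. \<phi> u ! i)" if i: "i < length ms" for i
    using mat_rep_block_sum[of ns "\<lambda>j. R $$ (i, j)" "ms ! i - ?t i"] i unfolding t[OF i] by (simp add: \<phi>_def)
  have "\<phi> u \<in> mat_sum ms" if "u \<in> mat_sum ns" for u
    using mat_repD(1)[OF rep that] by (simp add: mat_sum_def) (simp add: \<phi>_def)
  with rep have \<phi>: "mat_sum_hom ns ms \<phi>" by (simp add: mat_sum_hom_def)
  have "mult_matrix_of ns ms \<phi> = R"
  proof (rule mult_matrix_of_eqI[OF \<phi> ns])
    have "1\<^sub>m (ms ! i) * (\<phi> u ! i) * mat_adjoint (1\<^sub>m (ms ! i)) =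
        block_sum ns (\<lambda>j. R $$ (i, j)) 0 (ms ! i - ?t i) u" if "i < length ms" "u \<in> mat_sum ns" for i u
      using mat_repD(1)[OF rep[OF that(1)] that(2)] that by (simp add: \<phi>_def)
    then show "has_mult_matrix ns ms \<phi> R"
      unfolding has_mult_matrix_block_sum using Rc
      by (intro conjI exI[of _ "map (\<lambda>n. 1\<^sub>m n) ms"]) (auto simp: unitary_mat_def)
  qed
  with \<phi> that show thesis by blast
qed

section \<open>Inner automorphisms and unitary equivalence\<close>

definition conj_hom :: "complex mat list \<Rightarrow> complex mat list \<Rightarrow> complex mat list" where
  "conj_hom v u = map2 (\<lambda>w M. w * M * mat_adjoint w) v u"

lemma conj_hom_mat_sum_hom:
  assumes v: "length v = length ms" "\<forall>i<length ms. unitary_mat (ms ! i) (v ! i)"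
  shows "mat_sum_hom ms ms (conj_hom v)"
proof -
  have rep: "mat_rep ms (ms ! i) (\<lambda>u. conj_hom v u ! i)" if i: "i < length ms" for i
  proof -
    let ?v = "v ! i"
    have v': "?v \<in> carrier_mat (ms ! i) (ms ! i)" "mat_adjoint ?v * ?v = 1\<^sub>m (ms ! i)"
      using v i by (auto simp: unitary_mat_def)
    note va = mat_adjoint_carrier[OF v'(1)]
    have "mat_rep ms (ms ! i) (\<lambda>u. ?v * (u ! i) * mat_adjoint ?v)"
      unfolding mat_rep_def
    proof (intro conjI ballI allI)
      fix u assume u: "u \<in> mat_sum ms"
      note ui = mat_sum_nth[OF u i] and lu = mat_sum_length[OF u]
      note vu = mult_carrier_mat[OF v'(1) ui]
      show "?v * (u ! i) * mat_adjoint ?v \<in> carrier_mat (ms ! i) (ms ! i)"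
        by (rule mult_carrier_mat[OF vu va])
      show "?v * (map ((\<cdot>\<^sub>m) c) u ! i) * mat_adjoint ?v = c \<cdot>\<^sub>m (?v * (u ! i) * mat_adjoint ?v)" for c
        using i lu mult_smult_distrib[OF v'(1) ui] mult_smult_assoc_mat[OF vu va] by simp
      show "?v * (map mat_adjoint u ! i) * mat_adjoint ?v = mat_adjoint (?v * (u ! i) * mat_adjoint ?v)"
        unfolding mat_adjoint_mult[OF vu va] mat_adjoint_mult[OF v'(1) ui] mat_adjoint_adjoint
        using i lu assoc_mult_mat[OF v'(1) mat_adjoint_carrier[OF ui] va] by simp
      fix w assume w: "w \<in> mat_sum ms"
      note wi = mat_sum_nth[OF w i] and lw = mat_sum_length[OF w]
      note vw = mult_carrier_mat[OF v'(1) wi]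
      show "?v * (map2 (+) u w ! i) * mat_adjoint ?v =
          ?v * (u ! i) * mat_adjoint ?v + ?v * (w ! i) * mat_adjoint ?v"
        using i lu lw mult_add_distrib_mat[OF v'(1) ui wi] add_mult_distrib_mat[OF vu vw va] by simp
      have "?v * (u ! i) * mat_adjoint ?v * (?v * (w ! i) * mat_adjoint ?v) =
          ?v * (u ! i) * (mat_adjoint ?v * (?v * (w ! i * mat_adjoint ?v)))"
        unfolding assoc_mult_mat[OF v'(1) wi va]
        by (rule assoc_mult_mat[OF vu va mult_carrier_mat[OF v'(1) mult_carrier_mat[OF wi va]]])
      also have "mat_adjoint ?v * (?v * (w ! i * mat_adjoint ?v)) = w ! i * mat_adjoint ?v"
        unfolding assoc_mult_mat[OF va v'(1) mult_carrier_mat[OF wi va], symmetric] v'(2)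
        by (rule left_mult_one_mat[OF mult_carrier_mat[OF wi va]])
      also have "?v * (u ! i) * (w ! i * mat_adjoint ?v) = ?v * (u ! i) * (w ! i) * mat_adjoint ?v"
        by (rule assoc_mult_mat[OF vu wi va, symmetric])
      also have "?v * (u ! i) * (w ! i) = ?v * (u ! i * w ! i)"
        by (rule assoc_mult_mat[OF v'(1) ui wi])
      finally show "?v * (map2 (*) u w ! i) * mat_adjoint ?v =
          ?v * (u ! i) * mat_adjoint ?v * (?v * (w ! i) * mat_adjoint ?v)"
        using i lu lw by simp
    qed
    moreover have "conj_hom v u ! i = ?v * (u ! i) * mat_adjoint ?v" if "u \<in> mat_sum ms" for u
      using i v(1) mat_sum_length[OF that] by (simp add: conj_hom_def)
    ultimately show ?thesis using mat_rep_cong[of ms "\<lambda>u. conj_hom v u ! i"] by simp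
  qed
  moreover have "conj_hom v u \<in> mat_sum ms" if "u \<in> mat_sum ms" for u
    using mat_repD(1)[OF rep that] mat_sum_length[OF that] v(1)
    by (simp add: mat_sum_def) (simp add: conj_hom_def)
  ultimately show ?thesis by (simp add: mat_sum_hom_def)
qed

text \<open>Conjugation preserves traces; composing with an inner automorphism therefore leaves
  multiplicities unchanged.\<close>

lemma mult_matrix_of_conj_hom:
  assumes v: "length v = length ms" "\<forall>i<length ms. unitary_mat (ms ! i) (v ! i)" and ms: "\<forall>n\<in>set ms. 1 \<le> n"
  shows "mult_matrix_of ms ms (conj_hom v) = 1\<^sub>m (length ms)"
proof (rule mult_matrix_of_eq_matI[OF conj_hom_mat_sum_hom[OF v] ms one_carrier_mat])
  fix i j assume ij: "i < length ms" "j < length ms"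
  then have "0 < ms ! j" using ms nth_mem[OF ij(2)] by fastforce
  then show "mtrace (conj_hom v (munit ms j 0 0 1) ! i) = of_nat (1\<^sub>m (length ms) $$ (i, j))"
    using ij v mtrace_conj_unitary[OF _ mat_sum_nth[OF munit_mat_sum]]
    by (simp add: conj_hom_def mtrace_munit)
qed

text \<open>In each component, equal rows force equal zero blocks, so unitaries \<open>a\<close> and
  \<open>b\<close> bring \<open>\<phi>\<close> and \<open>\<psi>\<close> to the same normal form,
  and \<open>mat_adjoint b * a\<close> carries the first to the second.\<close>

lemma mat_sum_hom_unitarily_equivalent:
  assumes \<phi>: "mat_sum_hom ns ms \<phi>" and \<psi>: "mat_sum_hom ns ms \<psi>" and ns: "\<forall>n\<in>set ns. 1 \<le> n"
    and eq: "mult_matrix_of ns ms \<phi> = mult_matrix_of ns ms \<psi>"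
  obtains v where "length v = length ms" "\<forall>i<length ms. unitary_mat (ms ! i) (v ! i)"
    "\<And>u. u \<in> mat_sum ns \<Longrightarrow> conj_hom v (\<phi> u) = \<psi> u"
proof -
  let ?R = "mult_matrix_of ns ms \<psi>"
  have "\<exists>w. unitary_mat (ms ! i) w \<and> (\<forall>u\<in>mat_sum ns. w * (\<phi> u ! i) * mat_adjoint w = \<psi> u ! i)"
    if i: "i < length ms" for i
  proof -
    obtain a s where a: "unitary_mat (ms ! i) a" and as:
      "\<forall>u\<in>mat_sum ns. a * (\<phi> u ! i) * mat_adjoint a = block_sum ns (\<lambda>j. ?R $$ (i, j)) 0 s u"
      using has_mult_matrix_of[OF \<phi> ns] i unfolding eq has_mult_matrix_block_sum by blast
    obtain b t where b: "unitary_mat (ms ! i) b" and bt: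
      "\<forall>u\<in>mat_sum ns. b * (\<psi> u ! i) * mat_adjoint b = block_sum ns (\<lambda>j. ?R $$ (i, j)) 0 t u"
      using has_mult_matrix_of[OF \<psi> ns] i unfolding has_mult_matrix_block_sum by blast
    have "s = t" using has_mult_matrix_dims[OF \<phi> i a as] has_mult_matrix_dims[OF \<psi> i b bt] by simp
    have a': "a \<in> carrier_mat (ms ! i) (ms ! i)" "a * mat_adjoint a = 1\<^sub>m (ms ! i)" "mat_adjoint a * a = 1\<^sub>m (ms ! i)"
      using a by (auto simp: unitary_mat_def)
    have b': "b \<in> carrier_mat (ms ! i) (ms ! i)" "b * mat_adjoint b = 1\<^sub>m (ms ! i)" "mat_adjoint b * b = 1\<^sub>m (ms ! i)"
      using b by (auto simp: unitary_mat_def)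
    note aa = mat_adjoint_carrier[OF a'(1)] and ba = mat_adjoint_carrier[OF b'(1)]
    define w where "w = mat_adjoint b * a"
    have w: "w \<in> carrier_mat (ms ! i) (ms ! i)" unfolding w_def by (rule mult_carrier_mat[OF ba a'(1)])
    have wa: "mat_adjoint w = mat_adjoint a * b"
      unfolding w_def mat_adjoint_mult[OF ba a'(1)] by simp
    have "w * mat_adjoint w = mat_adjoint b * (a * (mat_adjoint a * b))"
      unfolding wa unfolding w_def by (rule assoc_mult_mat[OF ba a'(1) mult_carrier_mat[OF aa b'(1)]])
    also have "a * (mat_adjoint a * b) = b"
      unfolding assoc_mult_mat[OF a'(1) aa b'(1), symmetric] a'(2) by (rule left_mult_one_mat[OF b'(1)])
    finally have ww: "w * mat_adjoint w = 1\<^sub>m (ms ! i)" unfolding b'(3) .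
    have "unitary_mat (ms ! i) w"
      unfolding unitary_mat_def using w ww mat_mult_left_right_inverse[OF w mat_adjoint_carrier[OF w] ww] by simp
    moreover have "w * (\<phi> u ! i) * mat_adjoint w = \<psi> u ! i" if u: "u \<in> mat_sum ns" for u
    proof -
      note fu = mat_sum_nth[OF mat_sum_homD(1)[OF \<phi> u] i] and gu = mat_sum_nth[OF mat_sum_homD(1)[OF \<psi> u] i]
      have "w * (\<phi> u ! i) * mat_adjoint w = mat_adjoint b * (a * (\<phi> u ! i)) * (mat_adjoint a * b)"
        unfolding wa unfolding w_def assoc_mult_mat[OF ba a'(1) fu] ..
      also have "\<dots> = mat_adjoint b * (a * (\<phi> u ! i)) * mat_adjoint a * b"
        by (rule assoc_mult_mat[OF mult_carrier_mat[OF ba mult_carrier_mat[OF a'(1) fu]] aa b'(1), symmetric])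
      also have "mat_adjoint b * (a * (\<phi> u ! i)) * mat_adjoint a = mat_adjoint b * (a * (\<phi> u ! i) * mat_adjoint a)"
        by (rule assoc_mult_mat[OF ba mult_carrier_mat[OF a'(1) fu] aa])
      also have "a * (\<phi> u ! i) * mat_adjoint a = b * (\<psi> u ! i) * mat_adjoint b"
        using as bt u \<open>s = t\<close> by simp
      also have "mat_adjoint b * (b * (\<psi> u ! i) * mat_adjoint b) = mat_adjoint b * (b * (\<psi> u ! i)) * mat_adjoint b"
        by (rule assoc_mult_mat[OF ba mult_carrier_mat[OF b'(1) gu] ba, symmetric])
      also have "mat_adjoint b * (b * (\<psi> u ! i)) = \<psi> u ! i"
        unfolding assoc_mult_mat[OF ba b'(1) gu, symmetric] b'(3) by (rule left_mult_one_mat[OF gu])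
      also have "\<psi> u ! i * mat_adjoint b * b = \<psi> u ! i"
        unfolding assoc_mult_mat[OF gu ba b'(1)] b'(3) by (rule right_mult_one_mat[OF gu])
      finally show ?thesis .
    qed
    ultimately show ?thesis by blast
  qed
  then obtain w where w: "\<And>i. i < length ms \<Longrightarrow> unitary_mat (ms ! i) (w i)"
      "\<And>i u. i < length ms \<Longrightarrow> u \<in> mat_sum ns \<Longrightarrow> w i * (\<phi> u ! i) * mat_adjoint (w i) = \<psi> u ! i"
    by metis
  let ?v = "map w [0..<length ms]"
  show thesis
  proof (rule that[of ?v])
    fix u assume u: "u \<in> mat_sum ns"
    note fu = mat_sum_homD(1)[OF \<phi> u] and gu = mat_sum_homD(1)[OF \<psi> u]
    show "conj_hom ?v (\<phi> u) = \<psi> u"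
      using w(2)[OF _ u] mat_sum_length[OF fu] mat_sum_length[OF gu]
      by (intro nth_equalityI) (auto simp: conj_hom_def)
  qed (use w in auto)
qed

section \<open>C*-algebras\<close>

lemma scaleC_zero_right [simp]: "c *\<^sub>C (0 :: 'a::cstar_algebra) = 0"
  using scaleC_add_right[of c "0 :: 'a" 0] by simp

lemma scaleC_zero_left [simp]: "0 *\<^sub>C (x :: 'a::cstar_algebra) = 0"
  using scaleC_add_left[of 0 0 x] by simp

lemma scaleC_minus_right: "c *\<^sub>C (x - y) = c *\<^sub>C x - c *\<^sub>C (y :: 'a::cstar_algebra)"
  using scaleC_add_right[of c "x - y" y] by simp

lemma scaleC_minus_left: "(c - d) *\<^sub>C x = c *\<^sub>C x - d *\<^sub>C (x :: 'a::cstar_algebra)"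
proof -
  have "c *\<^sub>C x = (c - d) *\<^sub>C x + d *\<^sub>C x" unfolding scaleC_add_left[symmetric] by simp
  then show ?thesis by simp
qed

lemma adj_zero [simp]: "adj (0 :: 'a::cstar_algebra) = 0"
  using adj_add[of "0 :: 'a" 0] by simp

text \<open>The class postulates only the C*-identity; it gives
  \<open>norm y * norm y \<le> norm (adj y) * norm y\<close>, which is applied to \<open>x\<close>
  and to \<open>adj x\<close>.\<close>

lemma norm_adj [simp]: "norm (adj x) = norm (x :: 'a::cstar_algebra)"
proof -
  have le: "norm y \<le> norm (adj y)" for y :: 'a
  proof (cases "y = 0")
    case False
    have "norm y * norm y \<le> norm (adj y) * norm y"
      using norm_mult_ineq[of "adj y" y] by (simp add: norm_adj_mult power2_eq_square)
    then show ?thesis using False by simp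
  qed simp
  from le[of x] le[of "adj x"] show ?thesis by (simp add: adj_adj)
qed

lemma norm_projection_le_1:
  fixes p :: "'a::cstar_algebra"
  assumes "p * p = p" "adj p = p"
  shows "norm p \<le> 1"
proof (cases "p = 0")
  case False
  have "norm p * norm p = norm p"
    using norm_adj_mult[of p] assms by (simp add: power2_eq_square)
  then show ?thesis using False by simp
qed simp

text \<open>Functions are total, so domain and codomain are recorded as sets and values outside
  \<open>S\<close> stay free; an inclusion of subalgebras is then just \<open>id\<close>.\<close>

definition star_hom_on ::
  "'a::cstar_algebra set \<Rightarrow> 'b::cstar_algebra set \<Rightarrow> ('a \<Rightarrow> 'b) \<Rightarrow> bool" where
  "star_hom_on S T \<theta> \<longleftrightarrow> (\<forall>x\<in>S. \<theta> x \<in> T) \<and> (\<forall>x\<in>S. \<forall>y\<in>S. \<theta> (x + y) = \<theta> x + \<theta> y) \<and>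
     (\<forall>c. \<forall>x\<in>S. \<theta> (c *\<^sub>C x) = c *\<^sub>C \<theta> x) \<and> (\<forall>x\<in>S. \<forall>y\<in>S. \<theta> (x * y) = \<theta> x * \<theta> y) \<and>
     (\<forall>x\<in>S. \<theta> (adj x) = adj (\<theta> x))"

lemma star_hom_onD:
  assumes "star_hom_on S T \<theta>" "x \<in> S"
  shows "\<theta> x \<in> T" "\<theta> (c *\<^sub>C x) = c *\<^sub>C \<theta> x" "\<theta> (adj x) = adj (\<theta> x)"
    "y \<in> S \<Longrightarrow> \<theta> (x + y) = \<theta> x + \<theta> y" "y \<in> S \<Longrightarrow> \<theta> (x * y) = \<theta> x * \<theta> y"
  using assms by (auto simp: star_hom_on_def)

lemma star_hom_on_comp:
  assumes "star_hom_on S T \<theta>" "star_hom_on T U \<eta>"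
  shows "star_hom_on S U (\<eta> \<circ> \<theta>)"
  using assms by (simp add: star_hom_on_def)

lemma star_hom_imp_star_hom_on: "star_hom \<theta> \<Longrightarrow> \<theta> ` S \<subseteq> T \<Longrightarrow> star_hom_on S T \<theta>"
  by (auto simp: star_hom_on_def star_hom_def)

lemma star_hom_comp: "star_hom \<theta> \<Longrightarrow> star_hom \<eta> \<Longrightarrow> star_hom (\<eta> \<circ> \<theta>)"
  by (simp add: star_hom_def)

lemma af_objectD:
  assumes "af_object A"
  shows "fin_dim_cstar_subalgebra (subalg A n)" "subalg A n \<subseteq> subalg A (Suc n)"
    "closure (\<Union>n. subalg A n) = UNIV" "star_iso_onto_mat_sum (subalg A n) (iso A n) (sizes A n)"
  using assms by (simp_all only: af_object_def simp_thms)

lemma subalg_closed: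
  assumes "af_object A" "x \<in> subalg A n"
  shows "c *\<^sub>C x \<in> subalg A n" "adj x \<in> subalg A n"
    "y \<in> subalg A n \<Longrightarrow> x + y \<in> subalg A n" "y \<in> subalg A n \<Longrightarrow> x * y \<in> subalg A n"
  using af_objectD(1)[OF assms(1), of n] assms(2) by (simp_all add: fin_dim_cstar_subalgebra_def)

lemma subalg_mono:
  assumes "af_object A" "n \<le> m"
  shows "subalg A n \<subseteq> subalg A m"
  by (rule lift_Suc_mono_le[where f="subalg A", OF af_objectD(2)[OF assms(1)] assms(2)])

lemma zero_in_subalg: "af_object A \<Longrightarrow> 0 \<in> subalg A n"
  using af_objectD(1)[of A n] by (simp add: fin_dim_cstar_subalgebra_def)

lemma iso_bij:
  assumes "af_object A"
  shows "bij_betw (iso A n) (subalg A n) (mat_sum (sizes A n))"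
  using af_objectD(4)[OF assms, of n] by (simp add: star_iso_onto_mat_sum_def)

lemma isoD:
  assumes "af_object A" "x \<in> subalg A n"
  shows "iso A n x \<in> mat_sum (sizes A n)" "iso_inv A n (iso A n x) = x"
    "iso A n (c *\<^sub>C x) = map (\<lambda>M. c \<cdot>\<^sub>m M) (iso A n x)" "iso A n (adj x) = map mat_adjoint (iso A n x)"
    "y \<in> subalg A n \<Longrightarrow> iso A n (x + y) = map2 (+) (iso A n x) (iso A n y)"
    "y \<in> subalg A n \<Longrightarrow> iso A n (x * y) = map2 (*) (iso A n x) (iso A n y)"
proof -
  note iso = af_objectD(4)[OF assms(1), of n]
  show "iso A n x \<in> mat_sum (sizes A n)"
    using bij_betwE[OF iso_bij[OF assms(1)]] assms(2) by blast
  show "iso_inv A n (iso A n x) = x"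
    unfolding iso_inv_def by (rule bij_betw_inv_into_left[OF iso_bij[OF assms(1)] assms(2)])
  show "iso A n (c *\<^sub>C x) = map (\<lambda>M. c \<cdot>\<^sub>m M) (iso A n x)" "iso A n (adj x) = map mat_adjoint (iso A n x)"
    "y \<in> subalg A n \<Longrightarrow> iso A n (x + y) = map2 (+) (iso A n x) (iso A n y)"
    "y \<in> subalg A n \<Longrightarrow> iso A n (x * y) = map2 (*) (iso A n x) (iso A n y)"
    using iso assms(2) by (simp_all add: star_iso_onto_mat_sum_def)
qed

lemma iso_inv_subalg:
  assumes "af_object A" "u \<in> mat_sum (sizes A n)"
  shows "iso_inv A n u \<in> subalg A n" "iso A n (iso_inv A n u) = u"
proof -
  show "iso_inv A n u \<in> subalg A n"
    unfolding iso_inv_def using bij_betwE[OF bij_betw_inv_into[OF iso_bij[OF assms(1)]]] assms(2) by blast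
  show "iso A n (iso_inv A n u) = u"
    unfolding iso_inv_def by (rule bij_betw_inv_into_right[OF iso_bij[OF assms(1)] assms(2)])
qed

lemma iso_invD:
  assumes A: "af_object A" and u: "u \<in> mat_sum (sizes A n)"
  shows "iso_inv A n (map (\<lambda>M. c \<cdot>\<^sub>m M) u) = c *\<^sub>C iso_inv A n u"
    "iso_inv A n (map mat_adjoint u) = adj (iso_inv A n u)"
    "v \<in> mat_sum (sizes A n) \<Longrightarrow> iso_inv A n (map2 (+) u v) = iso_inv A n u + iso_inv A n v"
    "v \<in> mat_sum (sizes A n) \<Longrightarrow> iso_inv A n (map2 (*) u v) = iso_inv A n u * iso_inv A n v"
proof -
  have *: "iso_inv A n w = x" if "x \<in> subalg A n" "iso A n x = w" for w x
    using isoD(2)[OF A that(1)] that(2) by simp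
  note inv = iso_inv_subalg[OF A]
  show "iso_inv A n (map (\<lambda>M. c \<cdot>\<^sub>m M) u) = c *\<^sub>C iso_inv A n u"
    by (rule *) (simp_all add: subalg_closed[OF A] isoD[OF A] inv u)
  show "iso_inv A n (map mat_adjoint u) = adj (iso_inv A n u)"
    by (rule *) (simp_all add: subalg_closed[OF A] isoD[OF A] inv u)
  assume v: "v \<in> mat_sum (sizes A n)"
  show "iso_inv A n (map2 (+) u v) = iso_inv A n u + iso_inv A n v"
    by (rule *) (simp_all add: subalg_closed[OF A] isoD[OF A] inv u v)
  show "iso_inv A n (map2 (*) u v) = iso_inv A n u * iso_inv A n v"
    by (rule *) (simp_all add: subalg_closed[OF A] isoD[OF A] inv u v)
qed

section \<open>Norm estimates for homomorphisms of finite dimensional subalgebras\<close>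

text \<open>Isolates an entry by multiplications alone, so that the norm of the algebra controls
  it.\<close>

lemma munit_sandwich:
  assumes u: "u \<in> mat_sum ns" and ab: "a < ns ! j" "b < ns ! j"
  shows "map2 (*) (map2 (*) (munit ns j a a 1) u) (munit ns j b b 1) = munit ns j a b (u ! j $$ (a, b))"
proof (rule mat_sum_eqI[OF mat_sum_mult[OF mat_sum_mult[OF munit_mat_sum u] munit_mat_sum] munit_mat_sum])
  fix i assume i: "i < length ns"
  let ?n = "ns ! i" and ?U = "munit ns j a a 1 ! i * u ! i"
  note ui = mat_sum_nth[OF u i] and ei = mat_sum_nth[OF munit_mat_sum i]
  have "?U * munit ns j b b 1 ! i = munit ns j a b (u ! j $$ (a, b)) ! i"
  proof (rule eq_matI)
    fix x y assume "x < dim_row (munit ns j a b (u ! j $$ (a, b)) ! i)" "y < dim_col (munit ns j a b (u ! j $$ (a, b)) ! i)"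
    then have xy: "x < ?n" "y < ?n" using carrier_matD[OF ei] by auto
    have U: "?U $$ (x, l) = (if i = j \<and> x = a then u ! j $$ (a, l) else 0)" if "l < ?n" for l
    proof -
      have "?U $$ (x, l) = (\<Sum>k<?n. munit ns j a a 1 ! i $$ (x, k) * u ! i $$ (k, l))"
        using xy that by (intro index_mult_mat_sum[OF ei ui])
      also have "\<dots> = (\<Sum>k<?n. if k = a then (if i = j \<and> x = a then u ! j $$ (a, l) else 0) else 0)"
        using xy i by (intro sum.cong) (auto simp: index_munit)
      finally show ?thesis using ab i by (auto simp: sum.delta)
    qed
    have "(?U * munit ns j b b 1 ! i) $$ (x, y) = (\<Sum>l<?n. ?U $$ (x, l) * munit ns j b b 1 ! i $$ (l, y))"
      using xy by (intro index_mult_mat_sum[OF mult_carrier_mat[OF ei ui] ei])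
    also have "\<dots> = (\<Sum>l<?n. if l = b then (if i = j \<and> x = a \<and> y = b then u ! j $$ (a, b) else 0) else 0)"
      using xy i by (intro sum.cong refl) (auto simp: index_munit U simp del: index_mult_mat)
    also have "\<dots> = munit ns j a b (u ! j $$ (a, b)) ! i $$ (x, y)"
      using xy i ab by (auto simp: sum.delta index_munit)
    finally show "(?U * munit ns j b b 1 ! i) $$ (x, y) = munit ns j a b (u ! j $$ (a, b)) ! i $$ (x, y)" .
  qed (use carrier_matD[OF ei] in auto)
  then show "map2 (*) (map2 (*) (munit ns j a a 1) u) (munit ns j b b 1) ! i = munit ns j a b (u ! j $$ (a, b)) ! i"
    using i mat_sum_length[OF u] by simp
qed

text \<open>Each coefficient of \<open>x\<close> over the matrix units is recovered from
  \<open>e j a a * x * e j b b\<close>, hence is bounded by a multiple of \<open>norm x\<close>. The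
  constant is crude and depends on \<open>\<theta>\<close>; its existence is all that the
  contractivity argument requires.\<close>

lemma star_hom_on_bounded:
  assumes A: "af_object A" and \<theta>: "star_hom_on (subalg A n) T \<theta>"
  obtains C where "\<And>x. x \<in> subalg A n \<Longrightarrow> norm (\<theta> x) \<le> C * norm x"
proof
  let ?ns = "sizes A n"
  define e where "e j a b = iso_inv A n (munit ?ns j a b 1)" for j a b
  have e: "e j a b \<in> subalg A n" for j a b
    unfolding e_def by (rule iso_inv_subalg[OF A munit_mat_sum])
  fix x assume x: "x \<in> subalg A n"
  let ?u = "iso A n x"
  note u = isoD(1)[OF A x]
  have inv_munit: "iso_inv A n (munit ?ns j a b c) = c *\<^sub>C e j a b" for j a b c
    unfolding e_def using iso_invD(1)[OF A munit_mat_sum, of n c j a b 1] by (simp add: smult_munit)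
  have "\<theta> (iso_inv A n ?u) =
      (\<Sum>(j, a, b)\<in>mat_index ?ns. \<theta> (iso_inv A n (munit ?ns j a b (?u ! j $$ (a, b)))))"
    using u by (intro additive_expansion) (simp_all add: iso_invD[OF A] iso_inv_subalg[OF A] star_hom_onD[OF \<theta>])
  then have "norm (\<theta> x) \<le> (\<Sum>(j, a, b)\<in>mat_index ?ns. norm (\<theta> (?u ! j $$ (a, b) *\<^sub>C e j a b)))"
    using norm_sum[of "\<lambda>(j, a, b). \<theta> (?u ! j $$ (a, b) *\<^sub>C e j a b)" "mat_index ?ns"]
    by (simp add: isoD[OF A x] inv_munit case_prod_unfold)
  also have "\<dots> \<le> (\<Sum>(j, a, b)\<in>mat_index ?ns. norm (e j a a) * norm (e j b b) * norm (\<theta> (e j a b)) / norm (e j a b) * norm x)"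
  proof (rule sum_mono, clarify)
    fix j a b assume "(j, a, b) \<in> mat_index ?ns"
    then have jab: "j < length ?ns" "a < ?ns ! j" "b < ?ns ! j" by (auto simp: mat_index_def)
    let ?c = "?u ! j $$ (a, b)"
    have e_iso: "iso A n (e j a b) = munit ?ns j a b 1"
      unfolding e_def by (rule iso_inv_subalg[OF A munit_mat_sum])
    \<comment> \<open>Coordinates tell a matrix unit from zero; the division by its norm relies on
      this.\<close>
    have "e j a b \<noteq> 0"
    proof
      assume "e j a b = 0"
      then have "iso A n (0 *\<^sub>C e j a b) = iso A n (e j a b)" by simp
      then have "munit ?ns j a b 0 = munit ?ns j a b 1"
        unfolding isoD(3)[OF A e] e_iso smult_munit by simp
      then have "munit ?ns j a b 0 ! j $$ (a, b) = munit ?ns j a b 1 ! j $$ (a, b)" by simp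
      then show False using jab by (simp add: index_munit)
    qed
    then have pos: "norm (e j a b) > 0" by simp
    have "e j a a * x * e j b b = iso_inv A n (map2 (*) (map2 (*) (munit ?ns j a a 1) ?u) (munit ?ns j b b 1))"
      by (simp add: iso_invD[OF A] mat_sum_mult u isoD[OF A x] e_def)
    also have "\<dots> = ?c *\<^sub>C e j a b"
      by (simp add: munit_sandwich[OF u jab(2,3)] inv_munit)
    finally have "cmod ?c * norm (e j a b) = norm (e j a a * x * e j b b)" by (simp add: norm_scaleC)
    also have "\<dots> \<le> norm (e j a a) * norm x * norm (e j b b)"
      by (meson norm_mult_ineq norm_ge_zero mult_right_mono order_trans)
    finally have "cmod ?c \<le> norm (e j a a) * norm x * norm (e j b b) / norm (e j a b)"
      using pos by (simp add: pos_le_divide_eq)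
    then have "cmod ?c * norm (\<theta> (e j a b)) \<le>
        norm (e j a a) * norm x * norm (e j b b) / norm (e j a b) * norm (\<theta> (e j a b))"
      by (intro mult_right_mono) auto
    then show "norm (\<theta> (?c *\<^sub>C e j a b)) \<le>
        norm (e j a a) * norm (e j b b) * norm (\<theta> (e j a b)) / norm (e j a b) * norm x"
      by (simp add: star_hom_onD[OF \<theta> e] norm_scaleC mult_ac)
  qed
  also have "\<dots> = (\<Sum>(j, a, b)\<in>mat_index ?ns. norm (e j a a) * norm (e j b b) * norm (\<theta> (e j a b)) / norm (e j a b)) * norm x"
    by (simp add: sum_distrib_right case_prod_unfold)
  finally show "norm (\<theta> x) \<le> (\<Sum>(j, a, b)\<in>mat_index ?ns. norm (iso_inv A n (munit ?ns j a a 1)) *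
      norm (iso_inv A n (munit ?ns j b b 1)) * norm (\<theta> (iso_inv A n (munit ?ns j a b 1))) /
      norm (iso_inv A n (munit ?ns j a b 1))) * norm x"
    unfolding e_def .
qed

text \<open>For self-adjoint \<open>y\<close> and \<open>k\<close> a power of two, \<open>norm (y ^ k) = norm y ^ k\<close>; applied to the powers of
  \<open>y\<close>, any bound for \<open>\<theta>\<close> therefore improves to \<open>1\<close> in the limit.\<close>

lemma star_hom_on_contractive:
  assumes A: "af_object A" and \<theta>: "star_hom_on (subalg A n) T \<theta>" and x: "x \<in> subalg A n"
  shows "norm (\<theta> x) \<le> norm x"
proof -
  obtain C where C: "\<And>x. x \<in> subalg A n \<Longrightarrow> norm (\<theta> x) \<le> C * norm x"
    using star_hom_on_bounded[OF A \<theta>] by blast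
  let ?S = "subalg A n"
  \<comment> \<open>The C*-identity reduces the claim to the self-adjoint element
    \<open>adj x * x\<close>.\<close>
  define y where "y = adj x * x"
  \<comment> \<open>The power of \<open>y\<close> with exponent \<open>2 ^ k\<close>, by repeated
    squaring, as the algebra may lack a unit.\<close>
  define p where "p k = ((\<lambda>z. z * z) ^^ k) y" for k
  have y: "y \<in> ?S" "adj y = y"
    using subalg_closed[OF A] x by (auto simp: y_def adj_mult adj_adj)
  have p: "p k \<in> ?S \<and> adj (p k) = p k \<and> norm (p k) = norm y ^ (2 ^ k) \<and> norm (\<theta> (p k)) = norm (\<theta> y) ^ (2 ^ k)" for k
  proof (induction k)
    case 0
    then show ?case using y by (simp add: p_def)
  next
    case (Suc k)
    let ?p = "p k"
    have ps: "p (Suc k) = ?p * ?p" by (simp add: p_def)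
    have "norm (?p * ?p) = (norm ?p)\<^sup>2" using norm_adj_mult[of ?p] Suc by simp
    moreover have "norm (\<theta> ?p * \<theta> ?p) = (norm (\<theta> ?p))\<^sup>2"
      using norm_adj_mult[of "\<theta> ?p"] star_hom_onD(3)[OF \<theta>, of ?p] Suc by simp
    moreover have "\<theta> (?p * ?p) = \<theta> ?p * \<theta> ?p"
      using Suc star_hom_onD(5)[OF \<theta>] by blast
    ultimately show ?case
      unfolding ps using Suc subalg_closed(4)[OF A]
      by (simp add: adj_mult power_mult[symmetric] mult.commute)
  qed
  have "norm (\<theta> y) \<le> norm y"
  proof (rule ccontr)
    assume "\<not> norm (\<theta> y) \<le> norm y"
    then have lt: "norm y < norm (\<theta> y)" by simp
    then have pos: "norm y > 0" using C[OF y(1)] by (cases "y = 0") auto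
    define q where "q = norm (\<theta> y) / norm y"
    have q: "1 < q" using lt pos by (simp add: q_def)
    \<comment> \<open>The bound for \<open>p k\<close> gives \<open>q ^ (2 ^ k) \<le> C\<close>,
      while already \<open>q ^ k\<close>, which is not larger, exceeds \<open>C\<close>.\<close>
    then obtain k where k: "C < q ^ k" using real_arch_pow by blast
    have "norm (\<theta> y) ^ (2 ^ k) \<le> C * norm y ^ (2 ^ k)" using C[of "p k"] p[of k] by simp
    then have "q ^ (2 ^ k) \<le> C" using pos by (simp add: q_def power_divide pos_divide_le_eq)
    moreover have "q ^ k \<le> q ^ (2 ^ k)" using q by (intro power_increasing) auto
    ultimately show False using k by linarith
  qed
  moreover have "\<theta> y = adj (\<theta> x) * \<theta> x"
    using star_hom_onD(3,5)[OF \<theta>] subalg_closed(2)[OF A x] x by (simp add: y_def)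
  ultimately have "(norm (\<theta> x))\<^sup>2 \<le> (norm x)\<^sup>2" by (simp add: norm_adj_mult y_def)
  then show ?thesis by (rule power2_le_imp_le) simp
qed

section \<open>Unitaries of \<open>B\<^sup>\<sim>\<close>\<close>

text \<open>The action of the unitized algebra on \<open>B\<close> by left multiplication. The
  formula also covers the unital case, where the scalar part is 0, so most later arguments need no
  case distinction.\<close>

definition lmul :: "complex \<times> 'b::cstar_algebra \<Rightarrow> 'b \<Rightarrow> 'b" where
  "lmul u x = fst u *\<^sub>C x + snd u * x"

lemma lmul_add: "lmul u (x + y) = lmul u x + lmul u y"
  by (simp add: lmul_def scaleC_add_right ring_distribs)

lemma lmul_minus: "lmul u (x - y) = lmul u x - lmul u y"
  by (simp add: lmul_def scaleC_minus_right ring_distribs)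

lemma lmul_zero [simp]: "lmul u 0 = 0"
  by (simp add: lmul_def)

lemma lmul_scaleC: "lmul u (c *\<^sub>C x) = c *\<^sub>C lmul u x"
  by (simp add: lmul_def scaleC_add_right scaleC_scaleC mult_scaleC_right mult.commute)

lemma lmul_mult: "lmul u x * y = lmul u (x * y)"
  by (simp add: lmul_def ring_distribs mult_scaleC_left mult.assoc)

lemma lmul_tilde_mult: "lmul (tilde_mult u v) x = lmul u (lmul v x)"
  by (cases u; cases v) (simp add: lmul_def scaleC_add_right scaleC_add_left scaleC_scaleC
      mult_scaleC_left mult_scaleC_right ring_distribs mult.assoc)

text \<open>\<open>adj x * y\<close> acts as an inner product with values in \<open>B\<close>, for
  which \<open>tilde_adj u\<close> is the adjoint operator of \<open>u\<close>.\<close>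

lemma adj_lmul: "adj (lmul u x) * y = adj x * lmul (tilde_adj u) y"
  by (cases u) (simp add: lmul_def adj_add adj_scaleC adj_mult ring_distribs
      mult_scaleC_left mult_scaleC_right mult.assoc)

text \<open>Right multiplication by \<open>tilde_adj u\<close> is left multiplication by
  \<open>u\<close> between two adjoints.\<close>

lemma Ad_conv_lmul: "Ad u x = adj (lmul u (adj (lmul u x)))"
  by (cases u) (simp add: Ad_def lmul_def adj_add adj_scaleC adj_mult adj_adj)

text \<open>Associativity of left multiplication by \<open>u\<close> and right multiplication by
  \<open>tilde_adj v\<close>, at the element \<open>adj x\<close>; the right multiplication is
  written through adjoints.\<close>

lemma lmul_adj_lmul: "lmul u (adj (lmul v x)) = adj (lmul v (adj (lmul u (adj x))))"
  by (simp add: lmul_def adj_add adj_scaleC adj_mult adj_adj scaleC_add_right ring_distribs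
      scaleC_scaleC mult_scaleC_left mult_scaleC_right mult.assoc mult.commute[of "cnj _"] add_ac)

lemma Ad_mult: "Ad u x * y = lmul u (x * lmul (tilde_adj u) y)"
proof -
  have "Ad u x = lmul u (adj (lmul u (adj x)))"
    unfolding Ad_conv_lmul lmul_adj_lmul[of u u "adj x"] by (simp add: adj_adj)
  then show ?thesis using adj_lmul[of u "adj x" y] by (simp add: lmul_mult adj_adj)
qed

lemma is_unit_elt_unique: "is_unit_elt e \<Longrightarrow> is_unit_elt e' \<Longrightarrow> e = e'"
  unfolding is_unit_elt_def by metis

lemma lmul_tilde_one [simp]: "lmul tilde_one x = x"
proof (cases "unital TYPE('a)")
  case True
  then obtain e :: 'a where e: "is_unit_elt e" by (auto simp: unital_def)
  then have "(THE e :: 'a. is_unit_elt e) = e" using is_unit_elt_unique by blast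
  then have "lmul tilde_one x = e * x" using True by (simp add: tilde_one_def lmul_def)
  then show ?thesis using e by (simp add: is_unit_elt_def)
next
  case False
  then show ?thesis by (simp add: tilde_one_def lmul_def scaleC_one)
qed

lemma tilde_unitary_lmul:
  assumes "tilde_unitary u"
  shows "lmul u (lmul (tilde_adj u) x) = x" "lmul (tilde_adj u) (lmul u x) = x"
  using assms by (simp_all add: tilde_unitary_def flip: lmul_tilde_mult)

lemma tilde_unitary_norm:
  assumes "tilde_unitary u"
  shows "norm (lmul u x) = norm x"
proof -
  have "(norm (lmul u x))\<^sup>2 = (norm x)\<^sup>2"
    using norm_adj_mult[of "lmul u x"] norm_adj_mult[of x]
    by (simp add: adj_lmul tilde_unitary_lmul[OF assms])
  then show ?thesis by (simp add: power2_eq_iff_nonneg)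
qed

lemma star_hom_Ad:
  assumes "tilde_unitary u"
  shows "star_hom (Ad u)"
  unfolding star_hom_def
proof (intro conjI allI)
  fix x y c
  show "Ad u (x + y) = Ad u x + Ad u y" by (simp add: Ad_conv_lmul lmul_add adj_add)
  show "Ad u (c *\<^sub>C x) = c *\<^sub>C Ad u x" by (simp add: Ad_conv_lmul lmul_scaleC adj_scaleC)
  have 1: "Ad u z = lmul u (adj (lmul u (adj z)))" for z
    unfolding Ad_conv_lmul lmul_adj_lmul[of u u "adj z"] by (simp add: adj_adj)
  show "Ad u (adj x) = adj (Ad u x)"
    unfolding 1[of "adj x"] Ad_conv_lmul[of u x] adj_adj ..
  have "Ad u x * Ad u y = lmul u (x * adj (lmul u (adj y)))"
    unfolding Ad_mult unfolding 1[of y] tilde_unitary_lmul(2)[OF assms] ..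
  also have "x * adj (lmul u (adj y)) = adj (lmul u (adj (x * y)))"
    by (simp only: adj_mult lmul_mult[symmetric] adj_adj)
  finally show "Ad u (x * y) = Ad u x * Ad u y" by (simp add: 1)
qed

text \<open>In the unital case \<open>tilde_norm\<close> ignores the scalar part, which the carrier
  condition forces to be 0. Otherwise it is an operator norm, and \<open>onorm\<close> yields an
  estimate only once the map is known to be bounded.\<close>

lemma tilde_norm_lmul:
  fixes u :: "complex \<times> 'b::cstar_algebra"
  assumes "u \<in> tilde_carrier"
  shows "norm (lmul u x) \<le> tilde_norm u * norm x"
proof (cases u)
  case (Pair c a)
  show ?thesis
  proof (cases "unital TYPE('b)")
    case True
    then show ?thesis using assms Pair norm_mult_ineq[of a x] by (simp add: tilde_carrier_def lmul_def)
  next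
    case False
    have "bounded_linear (\<lambda>x. c *\<^sub>C x + a * x)"
    proof (rule bounded_linear_intro)
      show "c *\<^sub>C (r *\<^sub>R x) + a * (r *\<^sub>R x) = r *\<^sub>R (c *\<^sub>C x + a * x)" for r x
        by (simp add: scaleR_scaleC scaleC_scaleC scaleC_add_right mult_scaleC_right mult.commute)
      show "norm (c *\<^sub>C x + a * x) \<le> norm x * (cmod c + norm a)" for x
        using norm_triangle_ineq[of "c *\<^sub>C x" "a * x"] norm_mult_ineq[of a x]
        by (simp add: norm_scaleC algebra_simps)
    qed (simp add: scaleC_add_right ring_distribs)
    from onorm[OF this, of x] show ?thesis using False Pair by (simp add: lmul_def)
  qed
qed

definition near_one :: "complex \<times> 'b::cstar_algebra \<Rightarrow> bool" where
  "near_one u \<longleftrightarrow> tilde_unitary u \<and> tilde_norm (u - tilde_one) < 1 / 2"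

text \<open>Applying the isometry \<open>lmul u\<close> turns the displacement by
  \<open>tilde_adj u\<close> into the one by \<open>u\<close>, to which the norm bound
  applies.\<close>

lemma near_one_adj:
  assumes "near_one u" "x \<noteq> 0"
  shows "norm (lmul (tilde_adj u) x - x) < norm x / 2"
proof -
  have u: "tilde_unitary u" "tilde_norm (u - tilde_one) < 1 / 2" using assms by (auto simp: near_one_def)
  have "norm (lmul (tilde_adj u) x - x) = norm (lmul u (lmul (tilde_adj u) x - x))"
    by (simp add: tilde_unitary_norm[OF u(1)])
  also have "\<dots> = norm (lmul (u - tilde_one) x)"
  proof -
    have "lmul (u - tilde_one) x = lmul u x - lmul tilde_one x"
      by (simp add: lmul_def left_diff_distrib scaleC_minus_left)
    then show ?thesis by (simp add: lmul_minus tilde_unitary_lmul[OF u(1)] norm_minus_commute)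
  qed
  also have "\<dots> \<le> tilde_norm (u - tilde_one) * norm x"
    using u(1) by (intro tilde_norm_lmul) (auto simp: tilde_unitary_def tilde_carrier_def tilde_one_def)
  also have "\<dots> < 1 / 2 * norm x" using u(2) assms(2) by (intro mult_strict_right_mono) auto
  finally show ?thesis by simp
qed

text \<open>Makes the constant choice 1 available, and lets an unperturbed homomorphism be compared
  with a perturbed one.\<close>

lemma near_one_tilde_one: "near_one (tilde_one :: complex \<times> 'b::cstar_algebra)"
proof -
  have "tilde_norm (0 :: complex \<times> 'b) = 0"
    by (simp add: zero_prod_def onorm_zero)
  moreover have "tilde_unitary (tilde_one :: complex \<times> 'b)"
  proof (cases "unital TYPE('b)")
    case True
    then obtain e :: 'b where e: "is_unit_elt e" by (auto simp: unital_def)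
    then have the: "(THE e :: 'b. is_unit_elt e) = e" using is_unit_elt_unique by blast
    have "adj e = e"
      using e by (metis adj_adj adj_mult is_unit_elt_def)
    then show ?thesis using True e
      by (simp add: tilde_unitary_def tilde_one_def tilde_carrier_def the is_unit_elt_def)
  next
    case False
    then show ?thesis by (simp add: tilde_unitary_def tilde_one_def tilde_carrier_def)
  qed
  ultimately show ?thesis by (simp add: near_one_def)
qed

lemma Ad_tilde_one [simp]: "Ad tilde_one x = x"
  by (simp add: Ad_conv_lmul adj_adj)

text \<open>Moving \<open>b\<close> back by the two unitaries gives \<open>c\<close> and
  \<open>d\<close> with \<open>p * c = c\<close> and \<open>p * d = 0\<close>, so \<open>norm b =
  norm c = norm (p * (c - d)) \<le> norm (c - b) + norm (d - b)\<close>. For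
  \<open>b \<noteq> 0\<close> both summands are below \<open>norm b / 2\<close>.\<close>

lemma Ad_projections_disjoint:
  assumes u: "near_one u" and v: "near_one v" and p: "p * p = p" "adj p = p"
    and b: "Ad u p * b = b" "Ad v p * b = 0"
  shows "b = 0"
proof (rule ccontr)
  assume "b \<noteq> 0"
  have uu: "tilde_unitary u" and vv: "tilde_unitary v" using u v by (auto simp: near_one_def)
  define c d where "c = lmul (tilde_adj u) b" and "d = lmul (tilde_adj v) b"
  have pc: "p * c = c"
    using arg_cong[OF b(1), of "lmul (tilde_adj u)"] by (simp add: Ad_mult tilde_unitary_lmul[OF uu] c_def)
  have pd: "p * d = 0"
    using arg_cong[OF b(2), of "lmul (tilde_adj v)"] by (simp add: Ad_mult tilde_unitary_lmul[OF vv] d_def)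
  have "norm b = norm c"
    using tilde_unitary_norm[OF uu, of c] by (simp add: c_def tilde_unitary_lmul[OF uu])
  also have "c = p * (c - d)" using pc pd by (simp add: right_diff_distrib)
  also have "norm (p * (c - d)) \<le> norm p * norm (c - d)" by (rule norm_mult_ineq)
  also have "\<dots> \<le> norm (c - d)"
    using norm_projection_le_1[OF p] by (intro mult_left_le_one_le) auto
  also have "\<dots> \<le> norm (c - b) + norm (d - b)"
    using norm_triangle_ineq4[of "c - b" "d - b"] by simp
  also have "\<dots> < norm b"
    using near_one_adj[OF u \<open>b \<noteq> 0\<close>] near_one_adj[OF v \<open>b \<noteq> 0\<close>] by (simp add: c_def d_def)
  finally show False by simp
qed

text \<open>If two idempotents have no common vector in the range of one and the kernel of the other, then
  \<open>QP + (1 - Q)(1 - P)\<close> is invertible and conjugates \<open>P\<close> to \<open>Q\<close>.\<close>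

lemma mtrace_eq_of_disjoint:
  assumes P: "P \<in> carrier_mat m m" "P * P = P" and Q: "Q \<in> carrier_mat m m" "Q * Q = Q"
    and PQ: "\<And>X. X \<in> carrier_mat m m \<Longrightarrow> P * X = X \<Longrightarrow> Q * X = 0\<^sub>m m m \<Longrightarrow> X = 0\<^sub>m m m"
    and QP: "\<And>X. X \<in> carrier_mat m m \<Longrightarrow> Q * X = X \<Longrightarrow> P * X = 0\<^sub>m m m \<Longrightarrow> X = 0\<^sub>m m m"
  shows "mtrace P = mtrace Q"
proof -
  define P' Q' where "P' = 1\<^sub>m m - P" and "Q' = 1\<^sub>m m - Q"
  have P': "P' \<in> carrier_mat m m" unfolding P'_def using P(1) by (rule minus_carrier_mat)
  have Q': "Q' \<in> carrier_mat m m" unfolding Q'_def using Q(1) by (rule minus_carrier_mat)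
  have minus_self: "A - A = 0\<^sub>m m m" if "A \<in> carrier_mat m m" for A :: "complex mat"
    using that by (intro eq_matI) auto
  have add_zero: "A + 0\<^sub>m m m = A" "0\<^sub>m m m + A = A" if "A \<in> carrier_mat m m" for A :: "complex mat"
    using that by (intro eq_matI; auto)+
  have P'P: "P' * P = 0\<^sub>m m m"
    unfolding P'_def minus_mult_distrib_mat[OF one_carrier_mat P(1) P(1)] P(2) left_mult_one_mat[OF P(1)]
    by (rule minus_self[OF P(1)])
  have QQ': "Q * Q' = 0\<^sub>m m m"
    unfolding Q'_def mult_minus_distrib_mat[OF Q(1) one_carrier_mat Q(1)] Q(2) right_mult_one_mat[OF Q(1)]
    by (rule minus_self[OF Q(1)])
  note QP_c = mult_carrier_mat[OF Q(1) P(1)] and Q'P'_c = mult_carrier_mat[OF Q' P']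
  define Z where "Z = Q * P + Q' * P'"
  have Z: "Z \<in> carrier_mat m m" unfolding Z_def by (rule add_carrier_mat[OF Q'P'_c])
  have QZ: "Q * Z = Q * P"
    unfolding Z_def mult_add_distrib_mat[OF Q(1) QP_c Q'P'_c] assoc_mult_mat[OF Q(1) Q(1) P(1), symmetric]
      assoc_mult_mat[OF Q(1) Q' P', symmetric] Q(2) QQ' left_mult_zero_mat[OF P'] by (rule add_zero(1)[OF QP_c])
  have ZP: "Z * P = Q * P"
    unfolding Z_def add_mult_distrib_mat[OF QP_c Q'P'_c P(1)] assoc_mult_mat[OF Q(1) P(1) P(1)]
      assoc_mult_mat[OF Q' P' P(1)] P(2) P'P right_mult_zero_mat[OF Q'] by (rule add_zero(1)[OF QP_c])
  have "det Z \<noteq> 0"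
  proof
    assume "det Z = 0"
    then obtain x where x: "x \<in> carrier_vec m" "x \<noteq> 0\<^sub>v m" "Z *\<^sub>v x = 0\<^sub>v m"
      using det_0_iff_vec_prod_zero_field[OF Z] by blast
    \<comment> \<open>The hypotheses speak of square matrices, so the kernel vector is repeated in
      every column.\<close>
    define X where "X = mat m m (\<lambda>(i, j). x $ i)"
    have X: "X \<in> carrier_mat m m" by (simp add: X_def)
    have ZX: "Z * X = 0\<^sub>m m m"
    proof (rule eq_matI)
      fix i j assume "i < dim_row (0\<^sub>m m m :: complex mat)" "j < dim_col (0\<^sub>m m m :: complex mat)"
      then have ij: "i < m" "j < m" by auto
      have "col X j = x" using x(1) ij by (intro eq_vecI) (auto simp: X_def)
      then have "(Z * X) $$ (i, j) = (Z *\<^sub>v x) $ i" using Z X ij by simp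
      then show "(Z * X) $$ (i, j) = 0\<^sub>m m m $$ (i, j)" using x(3) ij by simp
    qed (use Z X in auto)
    \<comment> \<open>Multiplying \<open>Z * X = 0\<close> by \<open>Q\<close> puts
      \<open>P * X\<close> into the range of \<open>P\<close> and the kernel of \<open>Q\<close>, so
      it vanishes. What is left of \<open>Z * X\<close> is then \<open>X - Q * X\<close>, which puts
      \<open>X\<close> into the range of \<open>Q\<close> and the kernel of
      \<open>P\<close>.\<close>
    have "Q * (P * X) = Q * Z * X"
      unfolding QZ by (rule assoc_mult_mat[OF Q(1) P(1) X, symmetric])
    also have "\<dots> = 0\<^sub>m m m"
      unfolding assoc_mult_mat[OF Q(1) Z X] ZX by (rule right_mult_zero_mat[OF Q(1)])
    finally have "P * X = 0\<^sub>m m m"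
      using PQ[OF mult_carrier_mat[OF P(1) X]] assoc_mult_mat[OF P(1) P(1) X] P(2) by simp
    have P'X: "P' * X = X"
      unfolding P'_def minus_mult_distrib_mat[OF one_carrier_mat P(1) X] \<open>P * X = 0\<^sub>m m m\<close> left_mult_one_mat[OF X]
      using X by (intro eq_matI) auto
    have "Z * X = Q' * X"
      unfolding Z_def add_mult_distrib_mat[OF QP_c Q'P'_c X] assoc_mult_mat[OF Q(1) P(1) X]
        assoc_mult_mat[OF Q' P' X] P'X \<open>P * X = 0\<^sub>m m m\<close> right_mult_zero_mat[OF Q(1)]
      by (rule add_zero(2)[OF mult_carrier_mat[OF Q' X]])
    also have "\<dots> = X - Q * X"
      unfolding Q'_def minus_mult_distrib_mat[OF one_carrier_mat Q(1) X] left_mult_one_mat[OF X] ..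
    finally have *: "X - Q * X = 0\<^sub>m m m" using ZX by simp
    have "Q * X = X"
    proof (rule eq_matI)
      fix i j assume "i < dim_row X" "j < dim_col X"
      then have "i < m" "j < m" using X by auto
      then show "(Q * X) $$ (i, j) = X $$ (i, j)"
        using arg_cong[OF *, of "\<lambda>A. A $$ (i, j)"] carrier_matD[OF X] carrier_matD[OF mult_carrier_mat[OF Q(1) X]]
        by (simp del: index_mult_mat)
    qed (use Q X in auto)
    from QP[OF X this \<open>P * X = 0\<^sub>m m m\<close>] have X0: "X = 0\<^sub>m m m" .
    have "x $ i = 0" if "i < m" for i
      using arg_cong[OF X0, of "\<lambda>A. A $$ (i, i)"] that by (simp add: X_def)
    then show False using x(1,2) by (auto simp: vec_eq_iff)
  qed
  from det_non_zero_imp_unit[OF Z this, of "()"] obtain W where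
    W: "W \<in> carrier_mat m m" "W * Z = 1\<^sub>m m" "Z * W = 1\<^sub>m m"
    by (auto simp: Units_def ring_mat_def)
  \<comment> \<open>\<open>Q * Z = Z * P\<close> with \<open>Z\<close> invertible, so
    \<open>Q\<close> and \<open>P\<close> are similar.\<close>
  have "mtrace Q = mtrace (Q * (Z * W))" unfolding W(3) right_mult_one_mat[OF Q(1)] ..
  also have "Q * (Z * W) = Z * P * W"
    unfolding assoc_mult_mat[OF Q(1) Z W(1), symmetric] QZ ZP ..
  also have "mtrace (Z * P * W) = mtrace (W * (Z * P))"
    by (rule mtrace_mult_comm[OF mult_carrier_mat[OF Z P(1)] W(1)])
  also have "W * (Z * P) = P"
    unfolding assoc_mult_mat[OF W(1) Z P(1), symmetric] W(2) by (rule left_mult_one_mat[OF P(1)])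
  finally show ?thesis by simp
qed

section \<open>Multiplicity matrices of homomorphisms of subalgebras\<close>

lemma mult_matrix_of_cong:
  assumes "\<And>u. u \<in> mat_sum ns \<Longrightarrow> \<phi> u = \<psi> u"
  shows "mult_matrix_of ns ms \<phi> = mult_matrix_of ns ms \<psi>"
  using assms unfolding mult_matrix_of_def has_mult_matrix_def by simp

text \<open>The common form of the diagram matrices, where \<open>\<theta> = id\<close>, and of the
  induced matrices, where \<open>\<theta> = Ad (u n) \<circ> \<phi>\<close>.\<close>

definition sub_mult ::
  "'a::cstar_algebra af_data \<Rightarrow> nat \<Rightarrow> 'b::cstar_algebra af_data \<Rightarrow> nat \<Rightarrow> ('a \<Rightarrow> 'b) \<Rightarrow> nat mat" where
  "sub_mult A n B m \<theta> = mult_matrix_of (sizes A n) (sizes B m) (iso B m \<circ> \<theta> \<circ> iso_inv A n)"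

text \<open>\<open>af_object\<close> grants this only for a non-zero algebra. It makes each
  \<open>munit ns j 0 0 1\<close> a genuine minimal projection.\<close>

definition pos_sizes :: "'a af_data \<Rightarrow> bool" where
  "pos_sizes A \<longleftrightarrow> (\<forall>n. \<forall>m\<in>set (sizes A n). 1 \<le> m)"

lemma pos_sizesD: "pos_sizes A \<Longrightarrow> \<forall>m\<in>set (sizes A n). 1 \<le> m"
  by (simp add: pos_sizes_def)

lemma sub_mult_cong:
  assumes "af_object A" "\<And>x. x \<in> subalg A n \<Longrightarrow> \<theta> x = \<eta> x"
  shows "sub_mult A n B m \<theta> = sub_mult A n B m \<eta>"
  unfolding sub_mult_def using iso_inv_subalg(1)[OF assms(1)] assms(2)
  by (intro mult_matrix_of_cong) simp

lemma mat_sum_hom_iso_comp: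
  assumes A: "af_object A" and B: "af_object B" and \<theta>: "star_hom_on (subalg A n) (subalg B m) \<theta>"
  shows "mat_sum_hom (sizes A n) (sizes B m) (iso B m \<circ> \<theta> \<circ> iso_inv A n)"
  by (rule mat_sum_homI) (simp_all add: iso_invD[OF A] star_hom_onD[OF \<theta>] iso_inv_subalg[OF A] isoD[OF B])

lemma star_hom_on_inclusion:
  assumes "af_object A" "n \<le> m"
  shows "star_hom_on (subalg A n) (subalg A m) id"
  using subalg_mono[OF assms] by (auto simp: star_hom_on_def)

lemma sub_mult_comp:
  assumes A: "af_object A" and B: "af_object B" and C: "af_object C" and pos: "pos_sizes A" "pos_sizes B"
    and \<theta>: "star_hom_on (subalg A n) (subalg B m) \<theta>" and \<eta>: "star_hom_on (subalg B m) (subalg C l) \<eta>"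
  shows "sub_mult A n C l (\<eta> \<circ> \<theta>) = sub_mult B m C l \<eta> * sub_mult A n B m \<theta>"
proof -
  have "sub_mult A n C l (\<eta> \<circ> \<theta>) = mult_matrix_of (sizes A n) (sizes C l)
      ((iso C l \<circ> \<eta> \<circ> iso_inv B m) \<circ> (iso B m \<circ> \<theta> \<circ> iso_inv A n))"
    unfolding sub_mult_def using isoD(2)[OF B star_hom_onD(1)[OF \<theta> iso_inv_subalg(1)[OF A]]]
    by (intro mult_matrix_of_cong) simp
  then show ?thesis
    unfolding sub_mult_def using mult_matrix_of_comp[OF mat_sum_hom_iso_comp[OF A B \<theta>] mat_sum_hom_iso_comp[OF B C \<eta>]
        pos_sizesD[OF pos(1)] pos_sizesD[OF pos(2)]] by simp
qed

lemma sub_mult_carrier: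
  assumes "af_object A" "af_object B" "pos_sizes A" "star_hom_on (subalg A n) (subalg B m) \<theta>"
  shows "sub_mult A n B m \<theta> \<in> carrier_mat (length (sizes B m)) (length (sizes A n))"
  unfolding sub_mult_def by (rule mult_matrix_of_carrier[OF mat_sum_hom_iso_comp[OF assms(1,2,4)] pos_sizesD[OF assms(3)]])

lemma sub_mult_multiplicity:
  assumes "af_object A" "af_object B" "pos_sizes A" "star_hom_on (subalg A n) (subalg B m) \<theta>"
  shows "multiplicity_matrix (diagram_vecs A n) (diagram_vecs B m) (sub_mult A n B m \<theta>)"
  unfolding sub_mult_def diagram_vecs_def
  by (rule mult_matrix_of_multiplicity[OF mat_sum_hom_iso_comp[OF assms(1,2,4)] pos_sizesD[OF assms(3)]])

lemma diagram_mats_sub_mult: "diagram_mats A n = sub_mult A n A (Suc n) id"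
  by (simp add: diagram_mats_def sub_mult_def)

lemma induced_mats_sub_mult: "induced_mats A B \<phi> u f n = sub_mult A n B (f n) (Ad (u n) \<circ> \<phi>)"
  by (simp add: induced_mats_def sub_mult_def comp_assoc)

text \<open>Each edge matrix belongs to an inclusion, so path products compose to the matrix of a
  longer inclusion. Equations in diagrams thus become equations about homomorphisms into one
  subalgebra.\<close>

lemma connecting_sub_mult:
  assumes A: "af_object A" and pos: "pos_sizes A" and nm: "n \<le> m"
  shows "connecting (diagram_vecs A) (diagram_mats A) n m = sub_mult A n A m id"
proof -
  have "path_matrix (diagram_vecs A) (diagram_mats A) n d = sub_mult A n A (n + d) id" for d
  proof (induction d)
    case 0
    have "sub_mult A n A n id = 1\<^sub>m (length (sizes A n))"
      unfolding sub_mult_def by (rule mult_matrix_of_id[OF _ pos_sizesD[OF pos]]) (simp add: iso_inv_subalg[OF A])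
    then show ?case by (simp add: diagram_vecs_def id_def)
  next
    case (Suc d)
    show ?case
      using sub_mult_comp[OF A A A pos pos star_hom_on_inclusion[OF A, of n "n + d"]
          star_hom_on_inclusion[OF A, of "n + d" "Suc (n + d)"]] Suc
      by (simp add: diagram_mats_sub_mult id_def comp_def)
  qed
  from this[of "m - n"] nm show ?thesis by (simp add: connecting_def)
qed

text \<open>Lets homomorphisms into different levels of \<open>B\<close> be compared at a later
  level.\<close>

lemma connecting_mult_sub_mult:
  assumes A: "af_object A" and B: "af_object B" and pos: "pos_sizes A" "pos_sizes B"
    and \<theta>: "star_hom_on (subalg A n) (subalg B k) \<theta>" and kl: "k \<le> l"
  shows "connecting (diagram_vecs B) (diagram_mats B) k l * sub_mult A n B k \<theta> = sub_mult A n B l \<theta>"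
  using sub_mult_comp[OF A B B pos \<theta> star_hom_on_inclusion[OF B kl]]
  by (simp add: connecting_sub_mult[OF B pos(2) kl])

lemma sub_mult_mult_diagram_mats:
  assumes A: "af_object A" and B: "af_object B" and pos: "pos_sizes A"
    and \<theta>: "star_hom_on (subalg A (Suc n)) (subalg B k) \<theta>"
  shows "sub_mult A (Suc n) B k \<theta> * diagram_mats A n = sub_mult A n B k \<theta>"
  using sub_mult_comp[OF A A B pos pos star_hom_on_inclusion[OF A le_SucI[OF order_refl]] \<theta>]
  unfolding diagram_mats_sub_mult comp_id by (rule sym)

text \<open>The two images of a minimal projection of \<open>A\<^sub>n\<close> are not assumed to be close to each other in a
  common finite dimensional algebra, only to be conjugates of one projection by unitaries near \<open>1\<close>.\<close>

lemma sub_mult_perturb: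
  assumes A: "af_object A" and B: "af_object B" and pos: "pos_sizes A"
    and u: "near_one u" and v: "near_one v" and \<phi>: "star_hom_on (subalg A n) UNIV \<phi>"
    and \<theta>: "star_hom_on (subalg A n) (subalg B m) (Ad u \<circ> \<phi>)"
    and \<eta>: "star_hom_on (subalg A n) (subalg B m) (Ad v \<circ> \<phi>)"
  shows "sub_mult A n B m (Ad u \<circ> \<phi>) = sub_mult A n B m (Ad v \<circ> \<phi>)"
proof -
  let ?ns = "sizes A n" and ?ms = "sizes B m"
  let ?\<alpha> = "iso B m \<circ> (Ad u \<circ> \<phi>) \<circ> iso_inv A n" and ?\<beta> = "iso B m \<circ> (Ad v \<circ> \<phi>) \<circ> iso_inv A n"
  note \<alpha> = mat_sum_hom_iso_comp[OF A B \<theta>] and \<beta> = mat_sum_hom_iso_comp[OF A B \<eta>]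
  have "mult_matrix_of ?ns ?ms ?\<alpha> = mult_matrix_of ?ns ?ms ?\<beta>"
  proof (rule mult_matrix_of_eq_matI[OF \<alpha> pos_sizesD[OF pos] mult_matrix_of_carrier[OF \<beta> pos_sizesD[OF pos]]])
    fix i j assume ij: "i < length ?ms" "j < length ?ns"
    then have nj: "0 < ?ns ! j" using pos_sizesD[OF pos] nth_mem[OF ij(2)] by fastforce
    \<comment> \<open>A minimal projection of summand \<open>j\<close>; entry \<open>(i, j)\<close>
      of either matrix is the trace of its image in summand \<open>i\<close>.\<close>
    define e where "e = iso_inv A n (munit ?ns j 0 0 1)"
    have e: "e \<in> subalg A n" unfolding e_def by (rule iso_inv_subalg[OF A munit_mat_sum])
    have ee: "e * e = e"
      using iso_invD(4)[OF A munit_mat_sum munit_mat_sum, of n j 0 0 1 j 0 0 1] nj by (simp add: e_def munit_mult_munit)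
    have ea: "adj e = e"
      using iso_invD(2)[OF A munit_mat_sum, of n j 0 0 1] by (simp add: e_def adjoint_munit)
    define p where "p = \<phi> e"
    have p: "p * p = p" "adj p = p"
      using star_hom_onD(3,5)[OF \<phi> e] e ee ea by (simp_all add: p_def flip: star_hom_onD(5)[OF \<phi> e e])
    define a b where "a = Ad u p" and "b = Ad v p"
    have ab: "a \<in> subalg B m" "b \<in> subalg B m"
      using star_hom_onD(1)[OF \<theta> e] star_hom_onD(1)[OF \<eta> e] by (auto simp: a_def b_def p_def)
    have idem: "a * a = a" "b * b = b"
      using star_hom_onD(5)[OF \<theta> e e] star_hom_onD(5)[OF \<eta> e e] by (simp_all add: a_def b_def p_def ee)
    \<comment> \<open>A matrix of summand \<open>i\<close>, extended by zero, is an element of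
      \<open>subalg B m\<close>; disjointness known in \<open>B\<close> thereby passes to the
      matrices of the summand.\<close>
    have disjoint: "X = 0\<^sub>m (?ms ! i) (?ms ! i)"
      if cd: "c \<in> subalg B m" "d \<in> subalg B m" and X: "X \<in> carrier_mat (?ms ! i) (?ms ! i)"
        and cX: "iso B m c ! i * X = X" and dX: "iso B m d ! i * X = 0\<^sub>m (?ms ! i) (?ms ! i)"
        and disj: "\<And>y. c * y = y \<Longrightarrow> d * y = 0 \<Longrightarrow> y = 0" for X :: "complex mat" and c d
    proof -
      define z where "z = map (\<lambda>k. if k = i then X else 0\<^sub>m (?ms ! k) (?ms ! k)) [0..<length ?ms]"
      have z: "z \<in> mat_sum ?ms" using X by (auto simp: z_def mat_sum_def)
      let ?y = "iso_inv B m z"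
      note y = iso_inv_subalg[OF B z]
      have zero: "iso B m 0 = map (\<lambda>n. 0\<^sub>m n n) ?ms"
      proof -
        have "iso B m (0 *\<^sub>C 0) = map (\<lambda>M. 0 \<cdot>\<^sub>m M) (iso B m 0)"
          by (rule isoD(3)[OF B zero_in_subalg[OF B]])
        also have "\<dots> = map (\<lambda>n. 0\<^sub>m n n) ?ms"
          using isoD(1)[OF B zero_in_subalg[OF B], of m]
          by (intro nth_equalityI) (auto simp: mat_sum_def intro!: eq_matI)
        finally show ?thesis by simp
      qed
      have mult: "iso B m (w * ?y) = map (\<lambda>k. if k = i then iso B m w ! i * X else 0\<^sub>m (?ms ! k) (?ms ! k)) [0..<length ?ms]"
        if w: "w \<in> subalg B m" for w
      proof -
        have "iso B m (w * ?y) = map2 (*) (iso B m w) z" using isoD(6)[OF B w y(1)] y(2) by simp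
        also have "\<dots> = map (\<lambda>k. if k = i then iso B m w ! i * X else 0\<^sub>m (?ms ! k) (?ms ! k)) [0..<length ?ms]"
          using mat_sum_length[OF isoD(1)[OF B w]] right_mult_zero_mat[OF mat_sum_nth[OF isoD(1)[OF B w]]]
          by (intro nth_equalityI) (auto simp: z_def)
        finally show ?thesis .
      qed
      have "iso B m (c * ?y) = iso B m ?y"
        unfolding mult[OF cd(1)] cX y(2) by (simp add: z_def)
      then have 1: "c * ?y = ?y"
        using isoD(2)[OF B subalg_closed(4)[OF B cd(1) y(1)]] isoD(2)[OF B y(1)] by metis
      have "iso B m (d * ?y) = iso B m 0"
        unfolding mult[OF cd(2)] dX zero by (rule nth_equalityI) auto
      then have "d * ?y = 0"
        using isoD(2)[OF B subalg_closed(4)[OF B cd(2) y(1)]] isoD(2)[OF B zero_in_subalg[OF B]] by metis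
      from disj[OF 1 this] have "z = map (\<lambda>n. 0\<^sub>m n n) ?ms" using y(2) zero by simp
      then have "z ! i = 0\<^sub>m (?ms ! i) (?ms ! i)" using ij by simp
      then show ?thesis using ij by (simp add: z_def)
    qed
    have mult: "iso B m w ! i * iso B m w ! i = iso B m w ! i" if "w \<in> subalg B m" "w * w = w" for w
      using isoD(6)[OF B that(1) that(1)] that(2) mat_sum_length[OF isoD(1)[OF B that(1)]] ij
        by (metis (no_types, lifting) nth_map nth_zip length_zip min.idem split_conv)
    note ia = mat_sum_nth[OF isoD(1)[OF B ab(1)] ij(1)] and ib = mat_sum_nth[OF isoD(1)[OF B ab(2)] ij(1)]
    have "mtrace (iso B m a ! i) = mtrace (iso B m b ! i)"
    proof (rule mtrace_eq_of_disjoint[OF ia mult[OF ab(1) idem(1)] ib mult[OF ab(2) idem(2)]])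
      fix X :: "complex mat" assume X: "X \<in> carrier_mat (?ms ! i) (?ms ! i)"
      show "X = 0\<^sub>m (?ms ! i) (?ms ! i)" if "iso B m a ! i * X = X" "iso B m b ! i * X = 0\<^sub>m (?ms ! i) (?ms ! i)"
        using disjoint[OF ab X that] Ad_projections_disjoint[OF u v p] by (simp add: a_def b_def)
      show "X = 0\<^sub>m (?ms ! i) (?ms ! i)" if "iso B m b ! i * X = X" "iso B m a ! i * X = 0\<^sub>m (?ms ! i) (?ms ! i)"
        using disjoint[OF ab(2,1) X that] Ad_projections_disjoint[OF v u p] by (simp add: a_def b_def)
    qed
    then show "mtrace (?\<alpha> (munit ?ns j 0 0 1) ! i) = of_nat (mult_matrix_of ?ns ?ms ?\<beta> $$ (i, j))"
      using has_mult_matrix_entry[OF \<beta> has_mult_matrix_of[OF \<beta> pos_sizesD[OF pos]] pos_sizesD[OF pos] ij]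
      by (simp add: a_def b_def p_def e_def)
  qed
  then show ?thesis by (simp add: sub_mult_def)
qed

section \<open>Lifting a premorphism to a homomorphism\<close>

lemma star_hom_on_of_mat_sum_hom:
  assumes A: "af_object A" and B: "af_object B" and \<kappa>: "mat_sum_hom (sizes A n) (sizes B m) \<kappa>"
  shows "star_hom_on (subalg A n) (subalg B m) (iso_inv B m \<circ> \<kappa> \<circ> iso A n)"
    and "sub_mult A n B m (iso_inv B m \<circ> \<kappa> \<circ> iso A n) = mult_matrix_of (sizes A n) (sizes B m) \<kappa>"
proof -
  show "star_hom_on (subalg A n) (subalg B m) (iso_inv B m \<circ> \<kappa> \<circ> iso A n)"
    by (simp add: star_hom_on_def isoD[OF A] mat_sum_homD[OF \<kappa>] iso_inv_subalg[OF B] iso_invD[OF B])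
  show "sub_mult A n B m (iso_inv B m \<circ> \<kappa> \<circ> iso A n) = mult_matrix_of (sizes A n) (sizes B m) \<kappa>"
    unfolding sub_mult_def
    by (rule mult_matrix_of_cong) (simp add: iso_inv_subalg[OF A] iso_inv_subalg[OF B] mat_sum_homD[OF \<kappa>])
qed

lemma star_hom_on_with_mult:
  assumes A: "af_object A" and B: "af_object B" and pos: "pos_sizes A"
    and F: "multiplicity_matrix (diagram_vecs A n) (diagram_vecs B m) F"
  obtains \<theta> where "star_hom_on (subalg A n) (subalg B m) \<theta>" "sub_mult A n B m \<theta> = F"
  using mat_sum_hom_with_mult_matrix[OF F[unfolded diagram_vecs_def] pos_sizesD[OF pos]]
    star_hom_on_of_mat_sum_hom[OF A B] by metis

lemma star_hom_on_extend:
  assumes A: "af_object A" and B: "af_object B" and pos: "pos_sizes A" "pos_sizes B"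
    and \<theta>: "star_hom_on (subalg A n) (subalg B k) \<theta>" and kl: "k \<le> l"
    and F: "multiplicity_matrix (diagram_vecs A (Suc n)) (diagram_vecs B l) F"
    and comm: "F * diagram_mats A n = connecting (diagram_vecs B) (diagram_mats B) k l * sub_mult A n B k \<theta>"
  obtains \<theta>' where "star_hom_on (subalg A (Suc n)) (subalg B l) \<theta>'" "sub_mult A (Suc n) B l \<theta>' = F"
    "\<And>x. x \<in> subalg A n \<Longrightarrow> \<theta>' x = \<theta> x"
proof -
  let ?n = "sizes A n" and ?n' = "sizes A (Suc n)" and ?l = "sizes B l"
  obtain \<kappa> where \<kappa>: "mat_sum_hom ?n' ?l \<kappa>" "mult_matrix_of ?n' ?l \<kappa> = F"
    using mat_sum_hom_with_mult_matrix[OF F[unfolded diagram_vecs_def] pos_sizesD[OF pos(1)]] by blast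
  define \<iota> where "\<iota> = iso A (Suc n) \<circ> id \<circ> iso_inv A n"
  have \<iota>: "mat_sum_hom ?n ?n' \<iota>"
    unfolding \<iota>_def by (rule mat_sum_hom_iso_comp[OF A A star_hom_on_inclusion[OF A]]) simp
  have \<theta>l: "star_hom_on (subalg A n) (subalg B l) \<theta>"
    using star_hom_on_comp[OF \<theta> star_hom_on_inclusion[OF B kl]] by simp
  define \<beta> where "\<beta> = iso B l \<circ> \<theta> \<circ> iso_inv A n"
  have \<beta>: "mat_sum_hom ?n ?l \<beta>" unfolding \<beta>_def by (rule mat_sum_hom_iso_comp[OF A B \<theta>l])
  have "mult_matrix_of ?n ?l (\<kappa> \<circ> \<iota>) = F * diagram_mats A n"
    using mult_matrix_of_comp[OF \<iota> \<kappa>(1) pos_sizesD[OF pos(1)] pos_sizesD[OF pos(1)]]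
    by (simp add: \<kappa>(2) diagram_mats_sub_mult sub_mult_def \<iota>_def)
  also have "\<dots> = mult_matrix_of ?n ?l \<beta>"
    unfolding comm connecting_mult_sub_mult[OF A B pos \<theta> kl] by (simp add: sub_mult_def \<beta>_def)
  finally obtain v where v: "length v = length ?l" "\<forall>i<length ?l. unitary_mat (?l ! i) (v ! i)"
    and v\<beta>: "\<And>u. u \<in> mat_sum ?n \<Longrightarrow> conj_hom v ((\<kappa> \<circ> \<iota>) u) = \<beta> u"
    using mat_sum_hom_unitarily_equivalent[OF mat_sum_hom_comp[OF \<iota> \<kappa>(1)] \<beta> pos_sizesD[OF pos(1)]] by blast
  \<comment> \<open>The unitary corrects the new homomorphism and leaves \<open>\<theta>\<close>
    alone, so that successive extensions fit together.\<close>
  let ?\<kappa>' = "conj_hom v \<circ> \<kappa>"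
  have \<kappa>': "mat_sum_hom ?n' ?l ?\<kappa>'" by (rule mat_sum_hom_comp[OF \<kappa>(1) conj_hom_mat_sum_hom[OF v]])
  have "mult_matrix_of ?n' ?l ?\<kappa>' = 1\<^sub>m (length ?l) * F"
    using mult_matrix_of_comp[OF \<kappa>(1) conj_hom_mat_sum_hom[OF v] pos_sizesD[OF pos(1)] pos_sizesD[OF pos(2)]]
      mult_matrix_of_conj_hom[OF v pos_sizesD[OF pos(2)]] \<kappa>(2) by simp
  also have "\<dots> = F"
    using left_mult_one_mat[OF mult_matrix_of_carrier[OF \<kappa>(1) pos_sizesD[OF pos(1)]]] \<kappa>(2) by simp
  finally have F': "mult_matrix_of ?n' ?l ?\<kappa>' = F" .
  have "(iso_inv B l \<circ> ?\<kappa>' \<circ> iso A (Suc n)) x = \<theta> x" if x: "x \<in> subalg A n" for x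
  proof -
    have "?\<kappa>' (iso A (Suc n) x) = conj_hom v ((\<kappa> \<circ> \<iota>) (iso A n x))"
      by (simp add: \<iota>_def isoD[OF A x])
    also have "\<dots> = iso B l (\<theta> x)"
      unfolding v\<beta>[OF isoD(1)[OF A x]] by (simp add: \<beta>_def isoD[OF A x])
    finally show ?thesis using isoD(2)[OF B star_hom_onD(1)[OF \<theta>l x]] by simp
  qed
  from that[OF star_hom_on_of_mat_sum_hom[OF A B \<kappa>', unfolded F'] this] show thesis .
qed

section \<open>Passage from the dense union to the whole algebra\<close>

lemma bounded_linear_adj: "bounded_linear (adj :: 'a::cstar_algebra \<Rightarrow> 'a)"
  by (rule bounded_linear_intro[of _ 1]) (simp_all add: adj_add scaleR_scaleC adj_scaleC)

lemma bounded_linear_scaleC: "bounded_linear (\<lambda>x :: 'a::cstar_algebra. c *\<^sub>C x)"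
  by (rule bounded_linear_intro[of _ "cmod c"])
     (simp_all add: scaleC_add_right scaleR_scaleC scaleC_scaleC mult.commute norm_scaleC)

text \<open>Contractivity and additivity give uniform continuity, hence a continuous extension. Each
  law equates continuous functions, so it holds on a closed set that contains the dense
  \<open>U\<close> or \<open>U \<times> U\<close>.\<close>

lemma star_hom_on_dense_extension:
  fixes g :: "'a::cstar_algebra \<Rightarrow> 'b::cstar_algebra"
  assumes dense: "closure U = UNIV" and g: "star_hom_on U UNIV g"
    and closed: "\<And>x y. x \<in> U \<Longrightarrow> y \<in> U \<Longrightarrow> x + y \<in> U" "\<And>x y. x \<in> U \<Longrightarrow> y \<in> U \<Longrightarrow> x * y \<in> U"
      "\<And>c x. x \<in> U \<Longrightarrow> c *\<^sub>C x \<in> U" "\<And>x. x \<in> U \<Longrightarrow> adj x \<in> U"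
    and contr: "\<And>x. x \<in> U \<Longrightarrow> norm (g x) \<le> norm x"
  obtains \<phi> where "star_hom \<phi>" "\<And>x. x \<in> U \<Longrightarrow> \<phi> x = g x"
proof -
  have diff: "norm (g x - g y) \<le> norm (x - y)" if "x \<in> U" "y \<in> U" for x y
  proof -
    \<comment> \<open>Differences are formed with the scalar -1, as \<open>U\<close> is given as
      closed under sums and complex multiples.\<close>
    have eq: "a - b = a + (-1) *\<^sub>C b" for a b :: "'c::cstar_algebra"
      using scaleC_minus_left[of 0 1 b] by (simp add: scaleC_one)
    have "(-1) *\<^sub>C y \<in> U" by (rule closed(3)[OF that(2)])
    then have "x - y \<in> U" "g (x - y) = g x - g y"
      unfolding eq[of x y] eq[of "g x" "g y"] using that closed(1) star_hom_onD(2,4)[OF g] by auto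
    then show ?thesis using contr by metis
  qed
  have uc: "uniformly_continuous_on U g"
    unfolding uniformly_continuous_on_def dist_norm using diff by (meson order_le_less_trans)
  obtain \<phi> where \<phi>c: "uniformly_continuous_on (closure U) \<phi>" and \<phi>: "\<And>x. x \<in> U \<Longrightarrow> g x = \<phi> x"
    by (rule uniformly_continuous_on_extension_on_closure[OF uc], rule that)
  have cont: "continuous_on UNIV \<phi>"
    using uniformly_continuous_imp_continuous[OF \<phi>c] dense by simp
  have contf: "continuous_on S (\<lambda>z. \<phi> (f z))" if "continuous_on S f" for f :: "'c::topological_space \<Rightarrow> 'a" and S
    using continuous_on_compose2[OF cont that] by simp
  have two: "P x y" if cl: "closed {z. P (fst z) (snd z)}" and U: "\<And>x y. x \<in> U \<Longrightarrow> y \<in> U \<Longrightarrow> P x y" for P x y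
  proof -
    have "closure (U \<times> U) \<subseteq> {z. P (fst z) (snd z)}"
      by (rule closure_minimal[OF _ cl]) (use U in auto)
    then have "(x, y) \<in> {z. P (fst z) (snd z)}" using dense by (auto simp only: closure_Times)
    then show ?thesis by simp
  qed
  have one: "P x" if cl: "closed {x. P x}" and U: "\<And>x. x \<in> U \<Longrightarrow> P x" for P x
    using closure_minimal[of U "{x. P x}"] cl U dense by auto
  have "star_hom \<phi>"
    unfolding star_hom_def
  proof (intro conjI allI)
    fix x y c
    show "\<phi> (x + y) = \<phi> x + \<phi> y"
      by (rule two[of "\<lambda>x y. \<phi> (x + y) = \<phi> x + \<phi> y"])
         (auto intro!: closed_Collect_eq contf continuous_intros simp: closed star_hom_onD[OF g] simp flip: \<phi>)
    show "\<phi> (x * y) = \<phi> x * \<phi> y"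
      by (rule two[of "\<lambda>x y. \<phi> (x * y) = \<phi> x * \<phi> y"])
         (auto intro!: closed_Collect_eq contf continuous_intros simp: closed star_hom_onD[OF g] simp flip: \<phi>)
    show "\<phi> (c *\<^sub>C x) = c *\<^sub>C \<phi> x"
      by (rule one[of "\<lambda>x. \<phi> (c *\<^sub>C x) = c *\<^sub>C \<phi> x"])
         (auto intro!: closed_Collect_eq contf bounded_linear.continuous_on[OF bounded_linear_scaleC] continuous_intros
           simp: closed star_hom_onD[OF g] simp flip: \<phi>)
    show "\<phi> (adj x) = adj (\<phi> x)"
      by (rule one[of "\<lambda>x. \<phi> (adj x) = adj (\<phi> x)"])
         (auto intro!: closed_Collect_eq contf bounded_linear.continuous_on[OF bounded_linear_adj] continuous_intros
           simp: closed star_hom_onD[OF g] simp flip: \<phi>)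
  qed
  then show thesis using that \<phi> by metis
qed

text \<open>The lift sends \<open>subalg A n\<close> into \<open>subalg B (f n)\<close> without
  perturbation, so the unitary 1 is admissible for it at every level.\<close>

lemma premorphism_lift:
  assumes A: "af_object A" and B: "af_object B" and pos: "pos_sizes A" "pos_sizes B"
    and F: "(F, f) \<in> premorphisms (diagram_vecs A) (diagram_mats A) (diagram_vecs B) (diagram_mats B)"
  obtains \<phi> where "star_hom \<phi>" "\<And>n. \<phi> ` subalg A n \<subseteq> subalg B (f n)" "\<And>n. sub_mult A n B (f n) \<phi> = F n"
proof -
  have mono: "mono f" and mult: "\<And>n. multiplicity_matrix (diagram_vecs A n) (diagram_vecs B (f n)) (F n)"
    and comm: "\<And>n. F (Suc n) * diagram_mats A n =
      connecting (diagram_vecs B) (diagram_mats B) (f n) (f (Suc n)) * F n"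
    using F by (auto simp: premorphisms_def)
  have "\<exists>\<theta>. \<forall>n. (star_hom_on (subalg A n) (subalg B (f n)) (\<theta> n) \<and> sub_mult A n B (f n) (\<theta> n) = F n) \<and>
      (\<forall>x\<in>subalg A n. \<theta> (Suc n) x = \<theta> n x)"
  \<comment> \<open>Each homomorphism must extend the one chosen before it, and its multiplicities
    are carried along to make the next extension possible.\<close>
  proof (rule dependent_nat_choice)
    show "\<exists>\<theta>. star_hom_on (subalg A 0) (subalg B (f 0)) \<theta> \<and> sub_mult A 0 B (f 0) \<theta> = F 0"
      using star_hom_on_with_mult[OF A B pos(1) mult] by blast
    fix \<theta> n assume \<theta>: "star_hom_on (subalg A n) (subalg B (f n)) \<theta> \<and> sub_mult A n B (f n) \<theta> = F n"
    have "f n \<le> f (Suc n)" using mono by (simp add: mono_def)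
    from star_hom_on_extend[OF A B pos conjunct1[OF \<theta>] this mult]
    show "\<exists>\<theta>'. (star_hom_on (subalg A (Suc n)) (subalg B (f (Suc n))) \<theta>' \<and>
        sub_mult A (Suc n) B (f (Suc n)) \<theta>' = F (Suc n)) \<and> (\<forall>x\<in>subalg A n. \<theta>' x = \<theta> x)"
      using comm \<theta> by (metis (no_types, lifting))
  qed
  then obtain \<theta> where \<theta>: "\<And>n. star_hom_on (subalg A n) (subalg B (f n)) (\<theta> n)"
    and \<theta>F: "\<And>n. sub_mult A n B (f n) (\<theta> n) = F n"
    and \<theta>S: "\<And>n x. x \<in> subalg A n \<Longrightarrow> \<theta> (Suc n) x = \<theta> n x" by blast
  have \<theta>m: "\<theta> m x = \<theta> n x" if "n \<le> m" "x \<in> subalg A n" for n m x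
    using that(1)
  proof (induction m rule: dec_induct)
    case (step m)
    have "x \<in> subalg A m" using subalg_mono[OF A step(1)] that(2) by blast
    then show ?case using \<theta>S step by simp
  qed simp
  define U where "U = (\<Union>n. subalg A n)"
  \<comment> \<open>Any level containing \<open>x\<close> gives the same value; the least one merely
    makes the choice definite.\<close>
  define g where "g x = \<theta> (LEAST n. x \<in> subalg A n) x" for x
  have g: "g x = \<theta> n x" if "x \<in> subalg A n" for n x
    unfolding g_def using \<theta>m[of "LEAST n. x \<in> subalg A n" n x] Least_le[of "\<lambda>n. x \<in> subalg A n", OF that]
      LeastI[of "\<lambda>n. x \<in> subalg A n", OF that] by simp
  have U2: "\<exists>n. x \<in> subalg A n \<and> y \<in> subalg A n" if xy: "x \<in> U" "y \<in> U" for x y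
  proof -
    obtain k l where "x \<in> subalg A k" "y \<in> subalg A l" using xy by (auto simp: U_def)
    then show ?thesis using subalg_mono[OF A, of k "max k l"] subalg_mono[OF A, of l "max k l"] by auto
  qed
  have dense: "closure U = UNIV" unfolding U_def by (rule af_objectD(3)[OF A])
  have mem: "x \<in> U" if "x \<in> subalg A n" for x n using that by (auto simp: U_def)
  have closed: "x + y \<in> U" "x * y \<in> U" "g (x + y) = g x + g y" "g (x * y) = g x * g y" if xy: "x \<in> U" "y \<in> U" for x y
  proof -
    obtain n where n: "x \<in> subalg A n" "y \<in> subalg A n" using U2[OF xy] by blast
    note c = subalg_closed(3,4)[OF A n]
    show "x + y \<in> U" "x * y \<in> U" using c mem by auto
    show "g (x + y) = g x + g y" "g (x * y) = g x * g y"
      using star_hom_onD(4,5)[OF \<theta> n] by (simp_all add: g[OF n(1)] g[OF n(2)] g[OF c(1)] g[OF c(2)])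
  qed
  have closed': "c *\<^sub>C x \<in> U" "adj x \<in> U" "g (c *\<^sub>C x) = c *\<^sub>C g x" "g (adj x) = adj (g x)" "norm (g x) \<le> norm x"
    if x: "x \<in> U" for x c
  proof -
    obtain n where n: "x \<in> subalg A n" using x by (auto simp: U_def)
    note cl = subalg_closed(1)[OF A n, of c] subalg_closed(2)[OF A n]
    show "c *\<^sub>C x \<in> U" "adj x \<in> U" using cl mem by auto
    show "g (c *\<^sub>C x) = c *\<^sub>C g x" "g (adj x) = adj (g x)"
      using star_hom_onD(2,3)[OF \<theta> n] by (simp_all add: g[OF n] g[OF cl(1)] g[OF cl(2)])
    show "norm (g x) \<le> norm x" unfolding g[OF n] by (rule star_hom_on_contractive[OF A \<theta> n])
  qed
  have "star_hom_on U UNIV g" using closed closed' by (simp add: star_hom_on_def)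
  from star_hom_on_dense_extension[OF dense this closed(1,2) closed'(1,2,5)]
  obtain \<phi> where \<phi>: "star_hom \<phi>" "\<And>x. x \<in> U \<Longrightarrow> \<phi> x = g x" by blast
  have \<phi>\<theta>: "\<phi> x = \<theta> n x" if "x \<in> subalg A n" for x n
    using \<phi>(2)[OF mem[OF that]] g[OF that] by simp
  show thesis
  proof (rule that[OF \<phi>(1)])
    show "\<phi> ` subalg A n \<subseteq> subalg B (f n)" for n
      using star_hom_onD(1)[OF \<theta>] by (auto simp: \<phi>\<theta>)
    show "sub_mult A n B (f n) \<phi> = F n" for n
      using sub_mult_cong[OF A, of n \<phi> "\<theta> n" B "f n"] \<phi>\<theta> \<theta>F by simp
  qed
qed

section \<open>Equivalence of the premorphisms arising from different choices\<close>

text \<open>For transitivity both witnessing levels are pushed to a common later one, where the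
  functoriality of the connecting matrices preserves the equalities. With symmetry, equivalent
  premorphisms have the same class.\<close>

lemma premorphism_rel_Image_eq:
  assumes W: "\<And>k l m. k \<le> l \<Longrightarrow> l \<le> m \<Longrightarrow> connecting W S l m * connecting W S k l = connecting W S k m"
    and Wc: "\<And>k l. k \<le> l \<Longrightarrow> connecting W S k l \<in> carrier_mat (dim_vec (W l)) (dim_vec (W k))"
    and rel: "((F, f), (G, g)) \<in> premorphism_rel V E W S"
  shows "premorphism_rel V E W S `` {(F, f)} = premorphism_rel V E W S `` {(G, g)}"
proof -
  have sub: "((F, f), (H, h)) \<in> premorphism_rel V E W S"
    if 1: "((F, f), (G, g)) \<in> premorphism_rel V E W S" and 2: "((G, g), (H, h)) \<in> premorphism_rel V E W S"
    for F f G g H h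
  proof -
    have "\<exists>m. f n \<le> m \<and> h n \<le> m \<and> connecting W S (f n) m * F n = connecting W S (h n) m * H n" for n
    proof -
      obtain k where k: "f n \<le> k" "g n \<le> k" "connecting W S (f n) k * F n = connecting W S (g n) k * G n"
        using 1 unfolding premorphism_rel_def by blast
      obtain l where l: "g n \<le> l" "h n \<le> l" "connecting W S (g n) l * G n = connecting W S (h n) l * H n"
        using 2 unfolding premorphism_rel_def by blast
      define m where "m = max k l"
      have m: "k \<le> m" "l \<le> m" by (auto simp: m_def)
      have c: "F n \<in> carrier_mat (dim_vec (W (f n))) (dim_vec (V n))"
        "G n \<in> carrier_mat (dim_vec (W (g n))) (dim_vec (V n))"
        "H n \<in> carrier_mat (dim_vec (W (h n))) (dim_vec (V n))"
        using 1 2 by (auto simp: premorphism_rel_def premorphisms_def multiplicity_matrix_def)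
      have push: "connecting W S p m * X = connecting W S q m * (connecting W S p q * X)"
        if "p \<le> q" "q \<le> m" "X \<in> carrier_mat (dim_vec (W p)) (dim_vec (V n))" for p q X
        unfolding W[OF that(1,2), symmetric] by (rule assoc_mult_mat[OF Wc[OF that(2)] Wc[OF that(1)] that(3)])
      have "connecting W S (f n) m * F n = connecting W S (g n) m * G n"
        unfolding push[OF k(1) m(1) c(1)] push[OF k(2) m(1) c(2)] k(3) ..
      also have "\<dots> = connecting W S (h n) m * H n"
        unfolding push[OF l(1) m(2) c(2)] push[OF l(2) m(2) c(3)] l(3) ..
      finally show ?thesis using k(1) l(2) m by (intro exI[of _ m]) auto
    qed
    then show ?thesis using 1 2 by (auto simp: premorphism_rel_def)
  qed
  have "((G, g), (F, f)) \<in> premorphism_rel V E W S"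
    using rel unfolding premorphism_rel_def by (auto; metis)
  from sub[OF this] sub[OF rel] show ?thesis
    by (auto simp only: Image_singleton_iff)
qed

text \<open>On \<open>subalg A n\<close> the homomorphisms of two successive levels use different
  unitaries, both near 1; viewed in \<open>subalg B (g (Suc n))\<close> they have equal
  multiplicities by \<open>sub_mult_perturb\<close>.\<close>

lemma induced_premorphism:
  assumes A: "af_object A" and B: "af_object B" and pos: "pos_sizes A" "pos_sizes B"
    and \<phi>: "star_hom \<phi>" and adm: "admissible_choice A B \<phi> u g"
  shows "(induced_mats A B \<phi> u g, g) \<in> premorphisms (diagram_vecs A) (diagram_mats A) (diagram_vecs B) (diagram_mats B)"
proof -
  have g: "mono g" "filterlim g at_top sequentially" and near: "\<And>n. near_one (u n)"
    and sub: "\<And>n. Ad (u n) ` \<phi> ` subalg A n \<subseteq> subalg B (g n)"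
    using adm by (auto simp: admissible_choice_def near_one_def)
  have hom: "star_hom_on (subalg A n) (subalg B (g n)) (Ad (u n) \<circ> \<phi>)" for n
    using star_hom_comp[OF \<phi> star_hom_Ad] near[of n] sub[of n]
    by (intro star_hom_imp_star_hom_on) (auto simp: near_one_def)
  have "induced_mats A B \<phi> u g (Suc n) * diagram_mats A n =
      connecting (diagram_vecs B) (diagram_mats B) (g n) (g (Suc n)) * induced_mats A B \<phi> u g n" for n
  proof -
    have le: "g n \<le> g (Suc n)" using g(1) by (simp add: mono_def)
    have 1: "star_hom_on (subalg A n) (subalg B (g (Suc n))) (Ad (u (Suc n)) \<circ> \<phi>)"
      using star_hom_on_comp[OF star_hom_on_inclusion[OF A, of n "Suc n"] hom] by simp
    have 2: "star_hom_on (subalg A n) (subalg B (g (Suc n))) (Ad (u n) \<circ> \<phi>)"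
      using star_hom_on_comp[OF hom star_hom_on_inclusion[OF B le]] by simp
    have "star_hom_on (subalg A n) UNIV \<phi>" using \<phi> by (intro star_hom_imp_star_hom_on) auto
    from sub_mult_perturb[OF A B pos(1) near near this 1 2] show ?thesis
      unfolding induced_mats_sub_mult sub_mult_mult_diagram_mats[OF A B pos(1) hom]
        connecting_mult_sub_mult[OF A B pos hom le] .
  qed
  moreover have "multiplicity_matrix (diagram_vecs A n) (diagram_vecs B (g n)) (induced_mats A B \<phi> u g n)" for n
    unfolding induced_mats_sub_mult by (rule sub_mult_multiplicity[OF A B pos(1) hom])
  ultimately show ?thesis using g by (simp add: premorphisms_def)
qed

text \<open>At level \<open>max (g n) (f n)\<close> the map \<open>\<phi>\<close>, as its own
  conjugate by 1, is comparable with its conjugate by \<open>u n\<close>.\<close>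

lemma induced_premorphism_rel:
  assumes A: "af_object A" and B: "af_object B" and pos: "pos_sizes A" "pos_sizes B"
    and F: "(F, f) \<in> premorphisms (diagram_vecs A) (diagram_mats A) (diagram_vecs B) (diagram_mats B)"
    and \<phi>: "star_hom \<phi>" "\<And>n. \<phi> ` subalg A n \<subseteq> subalg B (f n)" "\<And>n. sub_mult A n B (f n) \<phi> = F n"
    and adm: "admissible_choice A B \<phi> u g"
  shows "((induced_mats A B \<phi> u g, g), (F, f)) \<in>
    premorphism_rel (diagram_vecs A) (diagram_mats A) (diagram_vecs B) (diagram_mats B)"
proof -
  have near: "\<And>n. near_one (u n)" and sub: "\<And>n. Ad (u n) ` \<phi> ` subalg A n \<subseteq> subalg B (g n)"
    using adm by (auto simp: admissible_choice_def near_one_def)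
  have "\<exists>m. g n \<le> m \<and> f n \<le> m \<and> connecting (diagram_vecs B) (diagram_mats B) (g n) m * induced_mats A B \<phi> u g n =
      connecting (diagram_vecs B) (diagram_mats B) (f n) m * F n" for n
  proof -
    define m where "m = max (g n) (f n)"
    have m: "g n \<le> m" "f n \<le> m" by (auto simp: m_def)
    have 1: "star_hom_on (subalg A n) (subalg B (g n)) (Ad (u n) \<circ> \<phi>)"
      using star_hom_comp[OF \<phi>(1) star_hom_Ad] near[of n] sub[of n]
      by (intro star_hom_imp_star_hom_on) (auto simp: near_one_def)
    have 2: "star_hom_on (subalg A n) (subalg B (f n)) \<phi>"
      by (rule star_hom_imp_star_hom_on[OF \<phi>(1,2)])
    have one: "Ad tilde_one \<circ> \<phi> = \<phi>" by auto
    have "star_hom_on (subalg A n) UNIV \<phi>" using \<phi>(1) by (intro star_hom_imp_star_hom_on) auto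
    note perturb = sub_mult_perturb[OF A B pos(1) near near_one_tilde_one this, unfolded one]
    have "sub_mult A n B m (Ad (u n) \<circ> \<phi>) = sub_mult A n B m \<phi>"
      using star_hom_on_comp[OF 1 star_hom_on_inclusion[OF B m(1)]] star_hom_on_comp[OF 2 star_hom_on_inclusion[OF B m(2)]]
      by (intro perturb) simp_all
    then show ?thesis
      using m unfolding induced_mats_sub_mult
      by (intro exI[of _ m] conjI) (simp_all add: connecting_mult_sub_mult[OF A B pos 1 m(1)]
          connecting_mult_sub_mult[OF A B pos 2 m(2)] flip: \<phi>(3))
  qed
  then show ?thesis
    using F induced_premorphism[OF A B pos \<phi>(1) adm] by (simp add: premorphism_rel_def)
qed

theorem theorem4p1:
  fixes A1 :: "'a::cstar_algebra af_data" and A2 :: "'b::cstar_algebra af_data"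
    and f :: bd_morphism
  assumes "af_object A1" and "af_object A2"
    and "f \<in> bd_hom (B_obj A1) (B_obj A2)"
  shows "\<exists>\<phi> :: 'a \<Rightarrow> 'b. star_hom \<phi> \<and> B_mor A1 A2 \<phi> = f"
proof (cases "zero_algebra TYPE('a) \<or> zero_algebra TYPE('b)")
  case True
  \<comment> \<open>Only one morphism exists here and every homomorphism induces it, so the zero map
    will do.\<close>
  then have "f = Zero_morphism"
    using assms(3) by (cases "zero_algebra TYPE('a)"; cases "zero_algebra TYPE('b)") (simp_all add: B_obj_def)
  then show ?thesis using True by (intro exI[of _ "\<lambda>_. 0"]) (simp add: B_mor_def star_hom_def)
next
  case False
  note A = assms(1) and B = assms(2)
  have pos: "pos_sizes A1" "pos_sizes A2"
    using assms(1,2) False by (simp_all add: af_object_def pos_sizes_def)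
  let ?V = "diagram_vecs A1" and ?E = "diagram_mats A1" and ?W = "diagram_vecs A2" and ?S = "diagram_mats A2"
  obtain F k where Fk: "(F, k) \<in> premorphisms ?V ?E ?W ?S"
    and f: "f = Class (premorphism_rel ?V ?E ?W ?S `` {(F, k)})"
    using assms(3) False by (auto simp: B_obj_def elim!: quotientE)
  obtain \<phi> where \<phi>: "star_hom \<phi>" "\<And>n. \<phi> ` subalg A1 n \<subseteq> subalg A2 (k n)" "\<And>n. sub_mult A1 n A2 (k n) \<phi> = F n"
    using premorphism_lift[OF A B pos Fk] by blast
  \<comment> \<open>Some admissible choice must exist before anything can be said of the one that
    \<open>B_mor\<close> selects.\<close>
  have "admissible_choice A1 A2 \<phi> (\<lambda>_. tilde_one) k"
    using Fk \<phi>(2) near_one_tilde_one[where 'b='b]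
    by (auto simp: admissible_choice_def premorphisms_def near_one_def)
  then have ex: "\<exists>p. case p of (u, g) \<Rightarrow> admissible_choice A1 A2 \<phi> u g" by auto
  obtain u g where ug: "(SOME (u, g). admissible_choice A1 A2 \<phi> u g) = (u, g)" by fastforce
  with someI_ex[OF ex] have "admissible_choice A1 A2 \<phi> u g" by simp
  from induced_premorphism_rel[OF A B pos Fk \<phi> this]
  have "premorphism_rel ?V ?E ?W ?S `` {(induced_mats A1 A2 \<phi> u g, g)} = premorphism_rel ?V ?E ?W ?S `` {(F, k)}"
  proof (rule premorphism_rel_Image_eq[rotated 2])
    show "connecting ?W ?S l m * connecting ?W ?S k l = connecting ?W ?S k m" if "k \<le> l" "l \<le> m" for k l m
      using connecting_mult_sub_mult[OF B B pos(2) pos(2) star_hom_on_inclusion[OF B that(1)] that(2)] that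
      by (simp add: connecting_sub_mult[OF B pos(2)])
    show "connecting ?W ?S k l \<in> carrier_mat (dim_vec (?W l)) (dim_vec (?W k))" if "k \<le> l" for k l
      using sub_mult_carrier[OF B B pos(2) star_hom_on_inclusion[OF B that]] that
      by (simp add: connecting_sub_mult[OF B pos(2)] diagram_vecs_def)
  qed
  then have "B_mor A1 A2 \<phi> = f" using False ug by (simp add: B_mor_def f)
  then show ?thesis using \<phi>(1) by blast
qed

end
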